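(* There exists an absolute constant $C>0$ such that for all $\beta,N>0$ the following holds. Let $F:B_N\to\mathbf R$ be a Lipschitz function such that $|F(\phi)-F(\psi)|\le\Vert\phi-\psi\Vert_{L^2}$ for all $\phi,\psi\in B_N$, and suppose further that $\int_{B_N}F(\phi)\,\nu_N^\beta(d\phi)=0$. Then $$\int_{B_N}\exp(tF(\phi))\,\nu_N^\beta(d\phi)\le\exp\Bigl(e^{C\beta^{5/2}N^{9/4}}t^2\Bigr)\qquad(t\in\mathbf R).$$
   Context: $\mathbf T=\mathbf R/2\pi\mathbf Z$, and $L^2(\mathbf T)$ is the real Hilbert space of real-valued functions with $\Vert\phi\Vert_{L^2}^2=\int_{\mathbf T}\phi(x)^2\frac{dx}{2\pi}$. For $N>0$, $B_N=\{\phi\in L^2(\mathbf T):\int_{\mathbf T}\phi(x)^2\frac{dx}{2\pi}\le N\}$. Gibbs measure. Formally, $\nu_N^\beta(d\phi)=Z_N(\beta)^{-1}\mathbf I_{B_N}(\phi)e^{-H(\phi)}\prod_{x}d\phi(x)$ with the KdV Hamiltonian $H(\phi)=\frac12\int_{\mathbf T}\phi'(x)^2\frac{dx}{2\pi}-\frac{\beta}{6}\int_{\mathbf T}\phi(x)^3\frac{dx}{2\pi}$. Rigorously: let $(\gamma_j)_{j=-\infty}^\infty$ be mutually independent standard (real, mean $0$, variance $1$) Gaussian random variables on a probability space, and let $W$ be the law on $L^2(\mathbf T)$ of the random Fourier series (Brownian loop) $$\phi_\omega(x)=\gamma_0+\sqrt2\sum_{j=-\infty}^{-1}\gamma_j\frac{\sin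 jx}{j}+\sqrt2\sum_{j=1}^{\infty}\gamma_j\frac{\cos jx}{j}.$$ Then $$\nu_N^\beta(d\phi)=Z_N(\beta)^{-1}\mathbf I_{B_N}(\phi)\exp\Bigl(\frac{\beta}{6}\int_{\mathbf T}\phi(x)^3\frac{dx}{2\pi}\Bigr)W(d\phi),$$ where $Z_N(\beta)\in(0,\infty)$ is the constant making $\nu_N^\beta$ a probability measure on $B_N$ (its existence is known). *)

theory Defs
  imports "HOL-Probability.Probability"
begin

text \<open>Functions on the torus are represented by functions on the reals of which only the values
  on the fundamental domain matter: the measure below has total mass one and lives on that domain.\<close>

definition torus :: "real measure" where
  "torus = uniform_measure lborel {0..<2 * pi}"

definition square_integrable :: "(real \<Rightarrow> real) \<Rightarrow> bool" where
  "square_integrable f \<longleftrightarrow> f \<in> borel_measurable torus \<and> integrable torus (\<lambda>x. (f x)\<^sup>2)"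

definition l2_rel :: "(real \<Rightarrow> real) \<Rightarrow> (real \<Rightarrow> real) \<Rightarrow> bool" where
  "l2_rel f g \<longleftrightarrow> square_integrable f \<and> square_integrable g \<and> (AE x in torus. f x = g x)"

lemma sets_torus [measurable_cong, simp]: "sets torus = sets borel"
  and space_torus [simp]: "space torus = UNIV"
  by (simp_all add: torus_def)

lemma prob_space_torus: "prob_space torus"
  unfolding torus_def by (rule prob_space_uniform_measure) auto

interpretation torus: prob_space torus
  by (rule prob_space_torus)

lemma square_integrable_measurable: "square_integrable f \<Longrightarrow> f \<in> borel_measurable torus"
  by (simp add: square_integrable_def)

lemma square_integrable_mult:
  assumes "square_integrable f" "square_integrable g"
  shows "integrable torus (\<lambda>x. f x * g x)"
proof (rule Bochner_Integration.integrable_bound)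
  show "integrable torus (\<lambda>x. (f x)\<^sup>2 + (g x)\<^sup>2)"
    using assms by (simp add: square_integrable_def)
  show "(\<lambda>x. f x * g x) \<in> borel_measurable torus"
    using assms[THEN square_integrable_measurable] by measurable
  have "\<bar>a * b\<bar> \<le> a\<^sup>2 + b\<^sup>2" for a b :: real
  proof -
    have "2 * (\<bar>a\<bar> * \<bar>b\<bar>) \<le> a\<^sup>2 + b\<^sup>2"
      using sum_squares_bound[of "\<bar>a\<bar>" "\<bar>b\<bar>"] by simp
    moreover have "0 \<le> \<bar>a\<bar> * \<bar>b\<bar>" by simp
    ultimately show ?thesis unfolding abs_mult by linarith
  qed
  then show "AE x in torus. norm (f x * g x) \<le> norm ((f x)\<^sup>2 + (g x)\<^sup>2)"
    by (auto intro!: AE_I2)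
qed

lemma square_integrable_add:
  assumes "square_integrable f" "square_integrable g"
  shows "square_integrable (\<lambda>x. f x + g x)"
proof -
  have "(\<lambda>x. (f x + g x)\<^sup>2) = (\<lambda>x. (f x)\<^sup>2 + (g x)\<^sup>2 + 2 * (f x * g x))"
    by (auto simp: power2_eq_square algebra_simps)
  then show ?thesis
    using assms square_integrable_mult[OF assms] by (auto simp: square_integrable_def)
qed

lemma square_integrable_scale:
  "square_integrable f \<Longrightarrow> square_integrable (\<lambda>x. c * f x)"
  by (auto simp: square_integrable_def power_mult_distrib)

lemma square_integrable_diff:
  "square_integrable f \<Longrightarrow> square_integrable g \<Longrightarrow> square_integrable (\<lambda>x. f x - g x)"
  using square_integrable_add[of f "\<lambda>x. - 1 * g x"] square_integrable_scale[of g "-1"] by simp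

lemma square_integrable_bounded:
  assumes "f \<in> borel_measurable borel" "\<And>x. \<bar>f x\<bar> \<le> B"
  shows "square_integrable f"
  unfolding square_integrable_def
proof
  show meas: "f \<in> borel_measurable torus"
    using assms(1) by simp
  have "norm ((f x)\<^sup>2) \<le> B\<^sup>2" for x
    using power_mono[OF assms(2)[of x], of 2] by simp
  then show "integrable torus (\<lambda>x. (f x)\<^sup>2)"
    using meas by (intro torus.integrable_const_bound[where B = "B\<^sup>2"]) auto
qed

quotient_type l2 = "real \<Rightarrow> real" / partial: l2_rel
proof (rule part_equivpI)
  show "\<exists>x. l2_rel x x"
    by (rule exI[of _ "\<lambda>_. 0"]) (simp add: l2_rel_def square_integrable_bounded[of _ 0])
  show "symp l2_rel"
    by (auto simp: symp_def l2_rel_def)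
  show "transp l2_rel"
    by (auto simp: transp_def l2_rel_def)
qed

instantiation l2 :: real_inner
begin

lift_definition zero_l2 :: l2 is "\<lambda>_. 0"
  by (simp add: l2_rel_def square_integrable_bounded[of _ 0])

lift_definition plus_l2 :: "l2 \<Rightarrow> l2 \<Rightarrow> l2" is "\<lambda>f g x. f x + g x"
  by (auto simp: l2_rel_def square_integrable_add)

lift_definition scaleR_l2 :: "real \<Rightarrow> l2 \<Rightarrow> l2" is "\<lambda>c f x. c * f x"
  by (auto simp: l2_rel_def square_integrable_scale)

lift_definition uminus_l2 :: "l2 \<Rightarrow> l2" is "\<lambda>f x. - f x"
  using square_integrable_scale[of _ "-1"] by (auto simp: l2_rel_def)

lift_definition inner_l2 :: "l2 \<Rightarrow> l2 \<Rightarrow> real" is "\<lambda>f g. LINT x|torus. f x * g x"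
  by (rule integral_cong_AE) (auto simp: l2_rel_def square_integrable_def)

definition minus_l2 :: "l2 \<Rightarrow> l2 \<Rightarrow> l2" where
  "minus_l2 \<phi> \<psi> = \<phi> + - \<psi>"

definition norm_l2 :: "l2 \<Rightarrow> real" where
  "norm_l2 \<phi> = sqrt (inner \<phi> \<phi>)"

definition dist_l2 :: "l2 \<Rightarrow> l2 \<Rightarrow> real" where
  "dist_l2 \<phi> \<psi> = norm (\<phi> - \<psi>)"

definition sgn_l2 :: "l2 \<Rightarrow> l2" where
  "sgn_l2 \<phi> = scaleR (inverse (norm \<phi>)) \<phi>"

definition uniformity_l2 :: "(l2 \<times> l2) filter" where
  "uniformity_l2 = (INF e\<in>{0<..}. principal {(\<phi>, \<psi>). dist \<phi> \<psi> < e})"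

definition open_l2 :: "l2 set \<Rightarrow> bool" where
  "open_l2 U \<longleftrightarrow> (\<forall>\<phi>\<in>U. eventually (\<lambda>(\<phi>', \<psi>). \<phi>' = \<phi> \<longrightarrow> \<psi> \<in> U) uniformity)"

instance
proof
  fix a b c :: l2 and r s :: real and U :: "l2 set"
  show "a + b + c = a + (b + c)"
    by transfer (auto simp: l2_rel_def add.assoc intro!: square_integrable_add)
  show "a + b = b + a"
    by transfer (auto simp: l2_rel_def add.commute intro!: square_integrable_add)
  show "0 + a = a"
    by transfer (auto simp: l2_rel_def)
  show "- a + a = 0"
    by transfer (auto simp: l2_rel_def square_integrable_bounded[of _ 0])
  show "a - b = a + - b"
    by (rule minus_l2_def)
  show "r *\<^sub>R (a + b) = r *\<^sub>R a + r *\<^sub>R b"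
    by transfer
      (auto simp: l2_rel_def distrib_left intro!: square_integrable_add square_integrable_scale)
  show "(r + s) *\<^sub>R a = r *\<^sub>R a + s *\<^sub>R a"
    by transfer
      (auto simp: l2_rel_def distrib_right intro!: square_integrable_add square_integrable_scale)
  show "r *\<^sub>R s *\<^sub>R a = (r * s) *\<^sub>R a"
    by transfer (auto simp: l2_rel_def mult.assoc intro!: square_integrable_scale)
  show "1 *\<^sub>R a = a"
    by transfer (auto simp: l2_rel_def)
  show "dist a b = norm (a - b)"
    by (rule dist_l2_def)
  show "sgn a = scaleR (inverse (norm a)) a"
    by (rule sgn_l2_def)
  show "uniformity = (INF e\<in>{0<..}. principal {(x, y :: l2). dist x y < e})"
    by (rule uniformity_l2_def)
  show "open U \<longleftrightarrow> (\<forall>x\<in>U. \<forall>\<^sub>F (x', y) in uniformity. x' = x \<longrightarrow> y \<in> U)"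
    by (rule open_l2_def)
  show "inner a b = inner b a"
    by transfer (simp add: mult.commute)
  show "inner (a + b) c = inner a c + inner b c"
    by transfer (simp add: l2_rel_def distrib_right square_integrable_mult)
  show "inner (r *\<^sub>R a) b = r * inner a b"
    by transfer (simp add: mult.assoc)
  show "0 \<le> inner a a"
    by transfer simp
  show "inner a a = 0 \<longleftrightarrow> a = 0"
  proof (transfer, goal_cases)
    case (1 f)
    then have f: "square_integrable f" by (simp add: l2_rel_def)
    have "(LINT x|torus. f x * f x) = 0 \<longleftrightarrow> (AE x in torus. f x * f x = 0)"
      by (rule integral_nonneg_eq_0_iff_AE) (use square_integrable_mult[OF f f] in auto)
    then show ?case
      using f by (auto simp: l2_rel_def square_integrable_bounded[of _ 0])
  qed
  show "norm a = sqrt (inner a a)"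
    by (rule norm_l2_def)
qed

end

lemma l2_cases:
  obtains f where "square_integrable f" "\<phi> = abs_l2 f"
proof
  have "l2_rel (rep_l2 \<phi>) (rep_l2 \<phi>)"
    by (rule Quotient3_rep_reflp[OF Quotient3_l2])
  then show "square_integrable (rep_l2 \<phi>)"
    by (simp add: l2_rel_def)
  show "\<phi> = abs_l2 (rep_l2 \<phi>)"
    by (rule Quotient3_abs_rep[OF Quotient3_l2, symmetric])
qed

lemma l2_rel_refl: "square_integrable f \<Longrightarrow> l2_rel f f"
  by (simp add: l2_rel_def)

lemma diff_abs_l2:
  assumes "square_integrable f" "square_integrable g"
  shows "abs_l2 f - abs_l2 g = abs_l2 (\<lambda>x. f x - g x)"
  using assms
  by (simp add: minus_l2_def uminus_l2.abs_eq plus_l2.abs_eq l2_rel_refl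
      square_integrable_scale[of g "-1", simplified])

lemma norm_abs_l2:
  assumes "square_integrable f"
  shows "norm (abs_l2 f) = sqrt (LINT x|torus. (f x)\<^sup>2)"
  using assms by (simp add: norm_l2_def inner_l2.abs_eq l2_rel_refl power2_eq_square)

lemma nn_integral_square:
  assumes "square_integrable f"
  shows "(\<integral>\<^sup>+x. ennreal ((f x)\<^sup>2) \<partial>torus) = ennreal ((norm (abs_l2 f))\<^sup>2)"
  using assms by (simp add: norm_abs_l2 nn_integral_eq_integral square_integrable_def)

lemma nn_integral_abs_le:
  assumes f: "square_integrable f"
  shows "(\<integral>\<^sup>+x. ennreal \<bar>f x\<bar> \<partial>torus) \<le> ennreal (norm (abs_l2 f))"
proof -
  have int: "integrable torus (\<lambda>x. \<bar>f x\<bar>)" "integrable torus (\<lambda>x. \<bar>f x\<bar>\<^sup>2)"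
    using square_integrable_mult[OF f square_integrable_bounded[of "\<lambda>_. 1" 1]] f
    by (simp_all add: square_integrable_def)
  have "0 \<le> torus.expectation (\<lambda>x. \<bar>f x\<bar>\<^sup>2) - (torus.expectation (\<lambda>x. \<bar>f x\<bar>))\<^sup>2"
    using torus.variance_eq[OF int] torus.variance_positive[of "\<lambda>x. \<bar>f x\<bar>"] by simp
  then have "(LINT x|torus. \<bar>f x\<bar>) \<le> norm (abs_l2 f)"
    using f by (simp add: norm_abs_l2 real_le_rsqrt)
  then show ?thesis
    using int by (simp add: nn_integral_eq_integral ennreal_leI)
qed

lemma l2_subseq_limit:
  fixes f :: "nat \<Rightarrow> real \<Rightarrow> real"
  assumes f: "\<And>n. square_integrable (f n)"
    and small: "\<And>n. norm (abs_l2 (f (Suc n)) - abs_l2 (f n)) \<le> (1 / 2) ^ n"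
    and near: "\<And>e. e > 0 \<Longrightarrow> \<exists>M. \<forall>m\<ge>M. \<forall>n\<ge>M. norm (abs_l2 (f m) - abs_l2 (f n)) < e"
  shows "\<exists>L. (\<lambda>n. abs_l2 (f n)) \<longlonglongrightarrow> L"
proof -
  have [measurable]: "f n \<in> borel_measurable torus" for n
    by (rule square_integrable_measurable[OF f])
  have "(\<integral>\<^sup>+x. (\<Sum>n. ennreal \<bar>f (Suc n) x - f n x\<bar>) \<partial>torus)
      = (\<Sum>n. \<integral>\<^sup>+x. ennreal \<bar>f (Suc n) x - f n x\<bar> \<partial>torus)"
    by (rule nn_integral_suminf) measurable
  also have "\<dots> \<le> (\<Sum>n. ennreal ((1 / 2) ^ n))"
  proof (rule suminf_le)
    fix n
    have "(\<integral>\<^sup>+x. ennreal \<bar>f (Suc n) x - f n x\<bar> \<partial>torus)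
        \<le> ennreal (norm (abs_l2 (\<lambda>x. f (Suc n) x - f n x)))"
      by (rule nn_integral_abs_le) (intro square_integrable_diff f)
    also have "\<dots> \<le> ennreal ((1 / 2) ^ n)"
      using small[of n] by (simp add: diff_abs_l2 f ennreal_leI)
    finally show "(\<integral>\<^sup>+x. ennreal \<bar>f (Suc n) x - f n x\<bar> \<partial>torus) \<le> ennreal ((1 / 2) ^ n)" .
  qed auto
  also have "\<dots> < \<infinity>"
    by (subst suminf_ennreal2) (auto simp: summable_geometric)
  finally have "AE x in torus. (\<Sum>n. ennreal \<bar>f (Suc n) x - f n x\<bar>) \<noteq> \<infinity>"
    by (intro nn_integral_noteq_infinite) auto
  then have conv: "AE x in torus. (\<lambda>n. f n x) \<longlonglongrightarrow> lim (\<lambda>n. f n x)"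
  proof eventually_elim
    case (elim x)
    have "summable (\<lambda>n. \<bar>f (Suc n) x - f n x\<bar>)"
      by (rule summable_suminf_not_top) (use elim in auto)
    then have "summable (\<lambda>n. f (Suc n) x - f n x)"
      by (rule summable_rabs_cancel)
    then have "convergent (\<lambda>n. \<Sum>i<n. f (Suc i) x - f i x)"
      by (simp add: summable_iff_convergent)
    then have "convergent (\<lambda>n. f n x - f 0 x)"
      by (simp only: sum_lessThan_telescope[of "\<lambda>n. f n x"])
    then have "convergent (\<lambda>n. f n x)"
      using convergent_diff_const_right_iff by blast
    then show ?case
      by (rule convergent_LIMSEQ_iff[THEN iffD1])
  qed
  define F where "F = (\<lambda>x. lim (\<lambda>n. f n x))"
  have [measurable]: "F \<in> borel_measurable torus"
    unfolding F_def by measurable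
  have bound: "(\<integral>\<^sup>+x. ennreal ((F x - f n x)\<^sup>2) \<partial>torus) \<le> ennreal (e\<^sup>2)"
    if "e > 0" "\<And>m. m \<ge> M \<Longrightarrow> norm (abs_l2 (f m) - abs_l2 (f n)) \<le> e" for e n M
  proof -
    have "AE x in torus. ennreal ((F x - f n x)\<^sup>2) = liminf (\<lambda>m. ennreal ((f m x - f n x)\<^sup>2))"
      using conv
    proof eventually_elim
      case (elim x)
      have "(\<lambda>m. ennreal ((f m x - f n x)\<^sup>2)) \<longlonglongrightarrow> ennreal ((F x - f n x)\<^sup>2)"
        unfolding F_def by (intro tendsto_ennrealI tendsto_intros elim)
      then show ?case
        using lim_imp_Liminf trivial_limit_sequentially by metis
    qed
    then have "(\<integral>\<^sup>+x. ennreal ((F x - f n x)\<^sup>2) \<partial>torus)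
        = (\<integral>\<^sup>+x. liminf (\<lambda>m. ennreal ((f m x - f n x)\<^sup>2)) \<partial>torus)"
      by (rule nn_integral_cong_AE)
    also have "\<dots> \<le> liminf (\<lambda>m. \<integral>\<^sup>+x. ennreal ((f m x - f n x)\<^sup>2) \<partial>torus)"
      by (rule nn_integral_liminf) measurable
    also have "\<dots> \<le> liminf (\<lambda>m. ennreal (e\<^sup>2))"
    proof (rule Liminf_mono, rule eventually_sequentiallyI)
      fix m assume "M \<le> m"
      have "(\<integral>\<^sup>+x. ennreal ((f m x - f n x)\<^sup>2) \<partial>torus)
          = ennreal ((norm (abs_l2 (f m) - abs_l2 (f n)))\<^sup>2)"
        using nn_integral_square[OF square_integrable_diff[OF f f], of m n]
        by (simp add: diff_abs_l2 f)
      also have "\<dots> \<le> ennreal (e\<^sup>2)"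
        using that(2)[OF \<open>M \<le> m\<close>] by (intro ennreal_leI power_mono) auto
      finally show "(\<integral>\<^sup>+x. ennreal ((f m x - f n x)\<^sup>2) \<partial>torus) \<le> ennreal (e\<^sup>2)" .
    qed
    also have "\<dots> = ennreal (e\<^sup>2)"
      by (simp add: Liminf_const)
    finally show ?thesis .
  qed
  obtain M where M: "\<And>m n. m \<ge> M \<Longrightarrow> n \<ge> M \<Longrightarrow> norm (abs_l2 (f m) - abs_l2 (f n)) < 1"
    using near[OF zero_less_one] by blast
  have "square_integrable (\<lambda>x. F x - f M x)"
    unfolding square_integrable_def
  proof
    have "(\<integral>\<^sup>+x. ennreal ((F x - f M x)\<^sup>2) \<partial>torus) < \<infinity>"
    proof (rule le_less_trans)
      show "(\<integral>\<^sup>+x. ennreal ((F x - f M x)\<^sup>2) \<partial>torus) \<le> ennreal (1\<^sup>2)"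
        by (rule bound[where M = M]) (use M in \<open>auto intro: less_imp_le\<close>)
    qed simp
    then show "integrable torus (\<lambda>x. (F x - f M x)\<^sup>2)"
      by (simp add: integrable_iff_bounded)
  qed simp
  from square_integrable_add[OF this f[of M]] have F: "square_integrable F"
    by simp
  have "(\<lambda>n. abs_l2 (f n)) \<longlonglongrightarrow> abs_l2 F"
  proof (rule LIMSEQ_I)
    fix e :: real assume "e > 0"
    then obtain M where M:
      "\<And>m n. m \<ge> M \<Longrightarrow> n \<ge> M \<Longrightarrow> norm (abs_l2 (f m) - abs_l2 (f n)) < e / 2"
      using near[OF half_gt_zero] by blast
    have "norm (abs_l2 (f n) - abs_l2 F) < e" if "n \<ge> M" for n
    proof -
      have "(\<integral>\<^sup>+x. ennreal ((F x - f n x)\<^sup>2) \<partial>torus) \<le> ennreal ((e / 2)\<^sup>2)"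
        by (rule bound[where M = M]) (use \<open>e > 0\<close> M[OF _ that] in \<open>auto intro: less_imp_le\<close>)
      then have "ennreal ((norm (abs_l2 (\<lambda>x. F x - f n x)))\<^sup>2) \<le> ennreal ((e / 2)\<^sup>2)"
        by (simp only: nn_integral_square[OF square_integrable_diff[OF F f]])
      then have "(norm (abs_l2 F - abs_l2 (f n)))\<^sup>2 \<le> (e / 2)\<^sup>2"
        by (simp add: diff_abs_l2 F f)
      then have "norm (abs_l2 F - abs_l2 (f n)) \<le> e / 2"
        by (rule power2_le_imp_le) (use \<open>e > 0\<close> in simp)
      then show ?thesis
        using \<open>e > 0\<close> by (simp add: norm_minus_commute)
    qed
    then show "\<exists>no. \<forall>n\<ge>no. norm (abs_l2 (f n) - abs_l2 F) < e"
      by blast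
  qed
  then show ?thesis ..
qed

instance l2 :: banach
proof
  fix X :: "nat \<Rightarrow> l2"
  assume X: "Cauchy X"
  have "\<exists>M. \<forall>m\<ge>M. \<forall>n\<ge>M. norm (X m - X n) < (1 / 2) ^ k" for k
    using CauchyD[OF X, of "(1 / 2) ^ k"] by simp
  then obtain M where M: "\<And>k m n. m \<ge> M k \<Longrightarrow> n \<ge> M k \<Longrightarrow> norm (X m - X n) < (1 / 2) ^ k"
    by metis
  define r where "r = (\<lambda>k. k + (\<Sum>i\<le>k. M i))"
  have r_ge: "M k \<le> r k" for k
    unfolding r_def by (rule trans_le_add2) (rule member_le_sum, auto)
  have "strict_mono r"
    by (rule strict_monoI_Suc) (simp add: r_def)
  have "\<exists>f. square_integrable f \<and> X (r n) = abs_l2 f" for n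
    by (meson l2_cases)
  then obtain f where f: "\<And>n. square_integrable (f n)" "\<And>n. X (r n) = abs_l2 (f n)"
    by metis
  have "\<exists>L. (\<lambda>n. abs_l2 (f n)) \<longlonglongrightarrow> L"
  proof (rule l2_subseq_limit)
    show "norm (abs_l2 (f (Suc n)) - abs_l2 (f n)) \<le> (1 / 2) ^ n" for n
    proof -
      have "r n \<le> r (Suc n)"
        by (rule strict_mono_leD[OF \<open>strict_mono r\<close>]) simp
      then show ?thesis
        using M[of n "r (Suc n)" "r n"] r_ge[of n] by (simp add: f(2))
    qed
    fix e :: real assume "e > 0"
    show "\<exists>M. \<forall>m\<ge>M. \<forall>n\<ge>M. norm (abs_l2 (f m) - abs_l2 (f n)) < e"
      using CauchyD[OF Cauchy_subseq_Cauchy[OF X \<open>strict_mono r\<close>] \<open>e > 0\<close>]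
      by (simp add: f(2))
  qed (rule f(1))
  then obtain L where L: "(X \<circ> r) \<longlonglongrightarrow> L"
    by (auto simp: comp_def f(2))
  show "convergent X"
    unfolding convergent_def
    using Cauchy_converges_subseq[OF X \<open>strict_mono r\<close> L] by blast
qed

definition l2_ball :: "real \<Rightarrow> l2 set" where
  "l2_ball N = {\<phi>. inner \<phi> \<phi> \<le> N}"

text \<open>The Bochner integral takes the value zero where the cube is not integrable;
  Brownian loops are almost surely continuous, so this set is negligible for their law.\<close>

lift_definition cube_integral :: "l2 \<Rightarrow> real" is "\<lambda>f. LINT x|torus. (f x) ^ 3"
  by (rule integral_cong_AE) (auto simp: l2_rel_def square_integrable_def)

lift_definition l2_one :: l2 is "\<lambda>_. 1"
  by (simp add: l2_rel_def square_integrable_bounded[of _ 1])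

lift_definition sin_mode :: "int \<Rightarrow> l2" is "\<lambda>j x. sin (of_int j * x)"
  by (simp add: l2_rel_def square_integrable_bounded[of _ 1])

lift_definition cos_mode :: "int \<Rightarrow> l2" is "\<lambda>j x. cos (of_int j * x)"
  by (simp add: l2_rel_def square_integrable_bounded[of _ 1])

definition sin_term :: "(int \<Rightarrow> real) \<Rightarrow> int \<Rightarrow> l2" where
  "sin_term \<gamma> j = (\<gamma> j / of_int j) *\<^sub>R sin_mode j"

definition cos_term :: "(int \<Rightarrow> real) \<Rightarrow> int \<Rightarrow> l2" where
  "cos_term \<gamma> j = (\<gamma> j / of_int j) *\<^sub>R cos_mode j"

text \<open>The two series run over the negative and over the positive integers, and converge in the
  norm of the Hilbert space for almost all Gaussian sequences.\<close>

definition brownian_loop :: "(int \<Rightarrow> real) \<Rightarrow> l2" where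
  "brownian_loop \<gamma> = \<gamma> 0 *\<^sub>R l2_one
     + sqrt 2 *\<^sub>R (\<Sum>n. sin_term \<gamma> (- int (Suc n)))
     + sqrt 2 *\<^sub>R (\<Sum>n. cos_term \<gamma> (int (Suc n)))"

definition std_gaussian :: "real measure" where
  "std_gaussian = density lborel std_normal_density"

text \<open>The law is defined through the canonical independent sequence; by
  \<open>distr_brownian_loop\<close> below every independent standard Gaussian sequence on
  any probability space yields the same measure.\<close>

definition loop_law :: "l2 measure" where
  "loop_law = distr (\<Pi>\<^sub>M j\<in>UNIV. std_gaussian) borel brownian_loop"

lemma summable_measurable_set:
  fixes f :: "nat \<Rightarrow> (int \<Rightarrow> real) \<Rightarrow> 'a :: real_normed_vector"
  assumes cont: "\<And>n. continuous_on UNIV (f n)"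
  shows "Measurable.pred borel (\<lambda>\<gamma>. Cauchy (\<lambda>m. \<Sum>n<m. f n \<gamma>))"
proof -
  have [measurable]: "(\<lambda>\<gamma>. dist (\<Sum>n<m. f n \<gamma>) (\<Sum>n<k. f n \<gamma>)) \<in> borel_measurable borel" for m k
    by (intro borel_measurable_continuous_onI continuous_intros cont)
  show ?thesis
    unfolding metric_Cauchy_iff2 by measurable
qed

lemma measurable_brownian_loop: "brownian_loop \<in> borel_measurable borel"
proof -
  let ?s = "\<lambda>n \<gamma>. sin_term \<gamma> (- int (Suc n))"
  let ?c = "\<lambda>n \<gamma>. cos_term \<gamma> (int (Suc n))"
  define S where "S = (\<lambda>m \<gamma>. \<Sum>n<m. ?s n \<gamma>)"
  define K where "K = (\<lambda>m \<gamma>. \<Sum>n<m. ?c n \<gamma>)"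
  define d :: l2 where "d = (THE l. False)"
  have cont: "continuous_on UNIV (?s n)" "continuous_on UNIV (?c n)" for n
    unfolding sin_term_def cos_term_def
    by (intro continuous_intros continuous_on_product_coordinates; simp)+
  have [measurable]: "Measurable.pred borel (\<lambda>\<gamma>. Cauchy (\<lambda>m. S m \<gamma>))"
    "Measurable.pred borel (\<lambda>\<gamma>. Cauchy (\<lambda>m. K m \<gamma>))"
    unfolding S_def K_def by (rule summable_measurable_set[OF cont(1)] summable_measurable_set[OF cont(2)])+
  have contSK: "continuous_on UNIV (S m)" "continuous_on UNIV (K m)" for m
    unfolding S_def K_def by (intro continuous_on_sum cont)+
  let ?a = "\<lambda>\<gamma>. \<gamma> 0 *\<^sub>R l2_one"
  have contA: "continuous_on UNIV ?a"
    by (intro continuous_intros continuous_on_product_coordinates)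
  have [measurable]: "(\<lambda>\<gamma>. ?a \<gamma> + sqrt 2 *\<^sub>R S m \<gamma> + sqrt 2 *\<^sub>R K m \<gamma>) \<in> borel_measurable borel"
    "(\<lambda>\<gamma>. ?a \<gamma> + sqrt 2 *\<^sub>R S m \<gamma> + sqrt 2 *\<^sub>R d) \<in> borel_measurable borel"
    "(\<lambda>\<gamma>. ?a \<gamma> + sqrt 2 *\<^sub>R d + sqrt 2 *\<^sub>R K m \<gamma>) \<in> borel_measurable borel"
    "(\<lambda>\<gamma>. ?a \<gamma> + sqrt 2 *\<^sub>R d + sqrt 2 *\<^sub>R d) \<in> borel_measurable borel" for m
    by (intro borel_measurable_continuous_onI continuous_intros contA contSK)+
  define U where "U = (\<lambda>m \<gamma>.
    if Cauchy (\<lambda>m. S m \<gamma>)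
    then (if Cauchy (\<lambda>m. K m \<gamma>) then ?a \<gamma> + sqrt 2 *\<^sub>R S m \<gamma> + sqrt 2 *\<^sub>R K m \<gamma>
      else ?a \<gamma> + sqrt 2 *\<^sub>R S m \<gamma> + sqrt 2 *\<^sub>R d)
    else (if Cauchy (\<lambda>m. K m \<gamma>) then ?a \<gamma> + sqrt 2 *\<^sub>R d + sqrt 2 *\<^sub>R K m \<gamma>
      else ?a \<gamma> + sqrt 2 *\<^sub>R d + sqrt 2 *\<^sub>R d))"
  have lims: "(\<lambda>m. if Cauchy (\<lambda>m. \<Sum>n<m. f n) then \<Sum>n<m. f n else d) \<longlonglongrightarrow> suminf f"
    for f :: "nat \<Rightarrow> l2"
  proof (cases "Cauchy (\<lambda>m. \<Sum>n<m. f n)")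
    case True
    then have "summable f"
      by (simp add: summable_iff_convergent Cauchy_convergent_iff)
    then show ?thesis
      using True by (simp add: summable_LIMSEQ)
  next
    case False
    then have "\<not> f sums l" for l
      unfolding sums_def by (auto dest: LIMSEQ_imp_Cauchy)
    then show ?thesis
      using False by (simp add: suminf_def d_def)
  qed
  show ?thesis
  proof (rule borel_measurable_LIMSEQ_metric)
    show "U m \<in> borel_measurable borel" for m
      unfolding U_def by measurable
    fix \<gamma> :: "int \<Rightarrow> real"
    have "(\<lambda>m. U m \<gamma>) = (\<lambda>m. ?a \<gamma>
        + sqrt 2 *\<^sub>R (if Cauchy (\<lambda>m. S m \<gamma>) then S m \<gamma> else d)
        + sqrt 2 *\<^sub>R (if Cauchy (\<lambda>m. K m \<gamma>) then K m \<gamma> else d))"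
      by (auto simp: U_def)
    moreover have "\<dots> \<longlonglongrightarrow> brownian_loop \<gamma>"
      unfolding brownian_loop_def S_def K_def by (intro tendsto_intros lims)
    ultimately show "(\<lambda>m. U m \<gamma>) \<longlonglongrightarrow> brownian_loop \<gamma>"
      by (simp only:)
  qed
qed

lemma prob_space_loop_law: "prob_space loop_law"
proof -
  have "prob_space (\<Pi>\<^sub>M j\<in>(UNIV :: int set). std_gaussian)"
    unfolding std_gaussian_def by (intro prob_space_PiM prob_space_normal_density) simp
  moreover have "brownian_loop \<in> borel_measurable (\<Pi>\<^sub>M j\<in>UNIV. std_gaussian)"
  proof -
    have "sets (\<Pi>\<^sub>M j\<in>(UNIV :: int set). std_gaussian) = sets (\<Pi>\<^sub>M j\<in>UNIV. borel)"
      by (intro sets_PiM_cong) (auto simp: std_gaussian_def)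
    then show ?thesis
      using measurable_brownian_loop by (simp add: sets_PiM_equal_borel cong: measurable_cong_sets)
  qed
  ultimately show ?thesis
    unfolding loop_law_def by (rule prob_space.prob_space_distr)
qed

lemma (in prob_space) distr_brownian_loop:
  fixes \<gamma> :: "int \<Rightarrow> 'a \<Rightarrow> real"
  assumes indep: "indep_vars (\<lambda>_. borel) \<gamma> UNIV"
    and normal: "\<And>j. distributed M lborel (\<gamma> j) std_normal_density"
  shows "distr M borel (\<lambda>\<omega>. brownian_loop (\<lambda>j. \<gamma> j \<omega>)) = loop_law"
proof -
  have rv [measurable]: "\<gamma> j \<in> borel_measurable M" for j
    using distributed_measurable[OF normal[of j]] by simp
  have "distr M (\<Pi>\<^sub>M j\<in>UNIV. borel) (\<lambda>\<omega>. \<lambda>j\<in>UNIV. \<gamma> j \<omega>) = (\<Pi>\<^sub>M j\<in>UNIV. distr M borel (\<gamma> j))"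
    using indep indep_vars_iff_distr_eq_PiM[where I = UNIV and M' = "\<lambda>_. borel" and X = \<gamma>] by simp
  moreover have "distr M borel (\<gamma> j) = std_gaussian" for j
    using distributed_distr_eq_density[OF normal[of j]]
    by (simp add: std_gaussian_def cong: distr_cong)
  ultimately have *: "(\<Pi>\<^sub>M j\<in>UNIV. std_gaussian) = distr M (\<Pi>\<^sub>M j\<in>UNIV. borel) (\<lambda>\<omega> j. \<gamma> j \<omega>)"
    by (simp add: restrict_def)
  have "(\<lambda>\<omega> j. \<gamma> j \<omega>) \<in> measurable M (\<Pi>\<^sub>M j\<in>UNIV. borel)"
    by (rule measurable_PiM_single') (auto simp: space_PiM)
  moreover have "brownian_loop \<in> borel_measurable (\<Pi>\<^sub>M j\<in>UNIV. borel)"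
    using measurable_brownian_loop measurable_cong_sets[OF sets_PiM_equal_borel refl] by blast
  ultimately show ?thesis
    unfolding loop_law_def * by (subst distr_distr) (auto simp: comp_def)
qed

definition gibbs_weight :: "real \<Rightarrow> real \<Rightarrow> l2 \<Rightarrow> ennreal" where
  "gibbs_weight N \<beta> \<phi> = ennreal (indicator (l2_ball N) \<phi> * exp (\<beta> / 6 * cube_integral \<phi>))"

definition gibbs_norm_const :: "real \<Rightarrow> real \<Rightarrow> ennreal" where
  "gibbs_norm_const N \<beta> = (\<integral>\<^sup>+\<phi>. gibbs_weight N \<beta> \<phi> \<partial>loop_law)"

definition gibbs :: "real \<Rightarrow> real \<Rightarrow> l2 measure" where
  "gibbs N \<beta> = density loop_law (\<lambda>\<phi>. gibbs_weight N \<beta> \<phi> / gibbs_norm_const N \<beta>)"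

end

theory Submission
  imports Defs
begin

text \<open>
  The parameters enter through \<open>\<beta> * sqrt N\<close>, because
  \<open>\<beta>\<^bsup>5/2\<^esup> N\<^bsup>9/4\<^esup> = (\<beta> sqrt N)\<^bsup>5/2\<^esup> N\<close>. The constant \<open>C = 162\<^bsup>5/2\<^esup>\<close> separates two regimes.

  If \<open>\<beta> * sqrt N > 1 / 162\<close>, the exponent \<open>C \<beta>\<^bsup>5/2\<^esup> N\<^bsup>9/4\<^esup>\<close> is at least \<open>N\<close>, and the claim follows from
  Hoeffding's lemma alone: a 1-Lipschitz function on the ball oscillates by at most \<open>2 * sqrt N\<close>, so
  its Laplace transform is at most \<open>exp (N / 2 * t\<^sup>2)\<close> (\<open>laplace_gibbs_hoeffding\<close>).

  If \<open>\<beta> * sqrt N \<le> 1 / 162\<close>, the Gibbs measure is strongly log-concave and its Laplace transform is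
  at most \<open>exp (t\<^sup>2)\<close>. In the coordinates \<open>\<gamma>\<^sub>j\<close> the law of the loop is a standard Gaussian measure, and
  a trigonometric sum has \<open>L\<^sup>2\<close> norm at most \<open>\<bar>\<gamma>\<bar>\<close> and supremum norm at most \<open>3 \<bar>\<gamma>\<bar>\<close>. On the ball the second
  derivative of the cubic term is therefore at most a multiple of \<open>\<beta> sqrt N \<bar>\<gamma>\<bar>\<^sup>2\<close>, which uses up at
  most a third of the convexity of the Gaussian exponent
  (\<open>trunc_cube_integral_defect\<close>). For a measure with convexity constant \<open>\<kappa>\<close> the Prekopa-Leindler
  inequality with weights \<open>1 - s\<close> and \<open>s\<close>, applied to the densities tilted by \<open>exp (t F)\<close> and by
  \<open>exp (- (1 - s) / s * t F)\<close>, bounds the weighted geometric mean of the two Laplace transforms by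
  \<open>exp ((1 - s) t\<^sup>2 / (2 \<kappa> s))\<close>. For centred \<open>F\<close> the second transform is at least \<open>1\<close> by Jensen's
  inequality, so the first one is at most \<open>exp (t\<^sup>2 / (2 \<kappa> s))\<close>. With \<open>\<kappa> = 2/3\<close> and \<open>s = 3/4\<close> this is
  \<open>exp (t\<^sup>2)\<close>. Equal weights would only give \<open>exp (t\<^sup>2 / \<kappa>)\<close> with \<open>\<kappa> < 1\<close>, which is too weak because the
  right-hand side of the claim tends to \<open>exp (t\<^sup>2)\<close> as \<open>\<beta>\<close> tends to \<open>0\<close>.

  The Prekopa-Leindler inequality is proved on the line by comparing level sets, transferred to the
  Gaussian measure and tensorised (\<open>gaussian_prekopa_leindler\<close>). It is applied to partial sums of the
  Fourier series, with the cube replaced by a Lipschitz truncation so that the weight is a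
  bounded function, continuous on the ball (\<open>prekopa_leindler_partial_loop\<close>). Bounded
  convergence then leads to the full loop. The truncation is removed by dominated convergence: on
  the ball, Jensen's inequality bounds \<open>exp (c \<integral> \<bar>\<phi>\<bar>\<^sup>3)\<close> by \<open>\<integral> exp (a \<bar>\<phi>\<bar>)\<close> (\<open>exp_abs_cube_le\<close>), and this has
  finite expectation because the value of the loop at a point is a Gaussian variable
  (\<open>nn_integral_exp_moment_loop\<close>).
\<close>

section \<open>The Prekopa-Leindler inequality on the line\<close>

lemma emeasure_lborel_inner_compact:
  fixes S :: "real set"
  assumes "S \<in> sets borel"
  shows "emeasure lborel S = (SUP K\<in>{K. K \<subseteq> S \<and> compact K}. emeasure lborel K)"
proof (rule antisym)
  define I where "I = (\<lambda>n::nat. {- real n..real n})"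
  have "emeasure lborel S = emeasure lborel (\<Union>n. S \<inter> I n)"
  proof -
    have "x \<in> (\<Union>n. I n)" for x
      using real_arch_simple[of "\<bar>x\<bar>"] by (auto simp: I_def abs_le_iff minus_le_iff)
    then show ?thesis by (intro arg_cong[where f = "emeasure lborel"]) blast
  qed
  also have "\<dots> = (SUP n. emeasure lborel (S \<inter> I n))"
    using assms by (intro SUP_emeasure_incseq[symmetric]) (auto simp: incseq_def I_def)
  also have "\<dots> \<le> (SUP K\<in>{K. K \<subseteq> S \<and> compact K}. emeasure lborel K)"
  proof (rule SUP_least)
    fix n
    define M where "M = density lborel (indicator (I n))"
    have M: "emeasure M X = emeasure lborel (X \<inter> I n)" if "X \<in> sets borel" for X
      using that by (simp add: M_def emeasure_restricted I_def Int_commute)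
    have "emeasure M S = (SUP K\<in>{K. K \<subseteq> S \<and> compact K}. emeasure M K)"
    proof (rule inner_regular)
      show "emeasure M (space M) \<noteq> \<infinity>"
        using M[of UNIV] by (simp add: M_def I_def)
    qed (use assms in \<open>auto simp: M_def\<close>)
    also have "\<dots> \<le> (SUP K\<in>{K. K \<subseteq> S \<and> compact K}. emeasure lborel K)"
    proof (rule SUP_mono)
      fix K assume "K \<in> {K. K \<subseteq> S \<and> compact K}"
      then show "\<exists>L\<in>{K. K \<subseteq> S \<and> compact K}. emeasure M K \<le> emeasure lborel L"
        by (intro bexI[of _ K]) (auto simp: M borel_compact intro!: emeasure_mono)
    qed
    finally show "emeasure lborel (S \<inter> I n) \<le> (SUP K\<in>{K. K \<subseteq> S \<and> compact K}. emeasure lborel K)"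
      using M[OF assms] by simp
  qed
  finally show "emeasure lborel S \<le> (SUP K\<in>{K. K \<subseteq> S \<and> compact K}. emeasure lborel K)" .
  show "(SUP K\<in>{K. K \<subseteq> S \<and> compact K}. emeasure lborel K) \<le> emeasure lborel S"
    using assms by (intro SUP_least emeasure_mono) auto
qed

lemma emeasure_lborel_affine_image:
  fixes K :: "real set"
  assumes "compact K" "c > 0"
  shows "emeasure lborel ((\<lambda>x. c * x + d) ` K) = ennreal c * emeasure lborel K"
proof -
  have "compact ((\<lambda>x. c * x + d) ` K)"
    using assms by (intro compact_continuous_image continuous_intros)
  then show ?thesis
    using emeasure_lebesgue_affine[of c d K] assms
    by (simp add: borel_compact)
qed

text \<open>On the line the inequality is elementary: translating \<open>(1 - s) A\<close> by \<open>s * Inf B\<close> and \<open>s B\<close> by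
  \<open>(1 - s) * Sup A\<close> puts both copies inside \<open>S\<close>, the first one to the left and the second one to
  the right of a single common point.\<close>

lemma brunn_minkowski_compact_real:
  fixes A B S :: "real set"
  assumes A: "compact A" "A \<noteq> {}" and B: "compact B" "B \<noteq> {}" and s: "0 < s" "s < 1"
    and S: "S \<in> sets borel" "\<And>a b. a \<in> A \<Longrightarrow> b \<in> B \<Longrightarrow> (1 - s) * a + s * b \<in> S"
  shows "ennreal (1 - s) * emeasure lborel A + ennreal s * emeasure lborel B \<le> emeasure lborel S"
proof -
  define p q where "p = Sup A" and "q = Inf B"
  have p: "p \<in> A" "\<And>a. a \<in> A \<Longrightarrow> a \<le> p" and q: "q \<in> B" "\<And>b. b \<in> B \<Longrightarrow> q \<le> b"
    unfolding p_def q_def using A B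
    by (simp_all add: closed_contains_Sup closed_contains_Inf cSup_upper cInf_lower compact_imp_closed
        bounded_imp_bdd_above bounded_imp_bdd_below compact_imp_bounded)
  define A' B' where "A' = (\<lambda>x. (1 - s) * x + s * q) ` A" and "B' = (\<lambda>x. s * x + (1 - s) * p) ` B"
  define r where "r = (1 - s) * p + s * q"
  have [measurable]: "A' \<in> sets borel" "B' \<in> sets borel"
    unfolding A'_def B'_def using A B
    by (auto intro!: borel_compact compact_continuous_image continuous_intros)
  have A'_le: "x \<le> r" if "x \<in> A'" for x
    using that p(2) s by (auto simp: A'_def r_def)
  have B'_ge: "r \<le> x" if "x \<in> B'" for x
    using that q(2) s by (auto simp: B'_def r_def)
  have "ennreal (1 - s) * emeasure lborel A + ennreal s * emeasure lborel B
      = emeasure lborel A' + emeasure lborel B'"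
    using A B s by (simp add: A'_def B'_def emeasure_lborel_affine_image)
  also have "emeasure lborel B' = emeasure lborel (B' - {r})"
    by (rule emeasure_Diff_null_set[symmetric]) auto
  also have "emeasure lborel A' + emeasure lborel (B' - {r}) = emeasure lborel (A' \<union> (B' - {r}))"
    using A'_le B'_ge by (intro plus_emeasure) (auto dest: antisym)
  also have "\<dots> \<le> emeasure lborel S"
    using S p q by (intro emeasure_mono) (auto simp: A'_def B'_def add.commute)
  finally show ?thesis .
qed

text \<open>Inner approximation by compact sets. One point of \<open>A\<close> and one of \<open>B\<close> are adjoined to the compact
  sets so that the compact case, which is false for empty sets, applies.\<close>

lemma brunn_minkowski_real:
  fixes A B S :: "real set"
  assumes A: "A \<in> sets borel" "A \<noteq> {}" and B: "B \<in> sets borel" "B \<noteq> {}" and s: "0 < s" "s < 1"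
    and S: "S \<in> sets borel" "\<And>a b. a \<in> A \<Longrightarrow> b \<in> B \<Longrightarrow> (1 - s) * a + s * b \<in> S"
  shows "ennreal (1 - s) * emeasure lborel A + ennreal s * emeasure lborel B \<le> emeasure lborel S"
proof -
  obtain a b where ab: "a \<in> A" "b \<in> B" using A B by blast
  have le: "ennreal (1 - s) * emeasure lborel K + ennreal s * emeasure lborel L \<le> emeasure lborel S"
    if "K \<subseteq> A" "compact K" "L \<subseteq> B" "compact L" for K L
  proof -
    have "ennreal (1 - s) * emeasure lborel K + ennreal s * emeasure lborel L
        \<le> ennreal (1 - s) * emeasure lborel (insert a K) + ennreal s * emeasure lborel (insert b L)"
      using that by (intro add_mono mult_left_mono emeasure_mono) (auto intro: borel_compact)
    also have "\<dots> \<le> emeasure lborel S"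
      using that ab s S by (intro brunn_minkowski_compact_real) auto
    finally show ?thesis .
  qed
  define \<A> \<B> where "\<A> = {K. K \<subseteq> A \<and> compact K}" and "\<B> = {K. K \<subseteq> B \<and> compact K}"
  have ne: "\<A> \<noteq> {}" "\<B> \<noteq> {}"
    by (auto simp: \<A>_def \<B>_def)
  have "ennreal (1 - s) * emeasure lborel A + ennreal s * emeasure lborel B
      = (SUP K\<in>\<A>. ennreal (1 - s) * emeasure lborel K) + (SUP L\<in>\<B>. ennreal s * emeasure lborel L)"
    unfolding emeasure_lborel_inner_compact[OF A(1), folded \<A>_def]
      emeasure_lborel_inner_compact[OF B(1), folded \<B>_def] SUP_mult_left_ennreal ..
  also have "\<dots> = (SUP K\<in>\<A>. ennreal (1 - s) * emeasure lborel K + (SUP L\<in>\<B>. ennreal s * emeasure lborel L))"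
    by (rule ennreal_SUP_add_left[OF ne(1), symmetric])
  also have "\<dots> \<le> emeasure lborel S"
  proof (rule SUP_least)
    fix K assume "K \<in> \<A>"
    then show "ennreal (1 - s) * emeasure lborel K + (SUP L\<in>\<B>. ennreal s * emeasure lborel L) \<le> emeasure lborel S"
      unfolding ennreal_SUP_add_right[OF ne(2)]
      by (intro SUP_least le) (auto simp: \<A>_def \<B>_def)
  qed
  finally show ?thesis .
qed

lemma nn_integral_layer_cake:
  fixes f :: "real \<Rightarrow> real"
  assumes [measurable]: "f \<in> borel_measurable borel"
  shows "(\<integral>\<^sup>+x. ennreal (f x) \<partial>lborel)
    = (\<integral>\<^sup>+l. indicator {0..} l * emeasure lborel {x. l < f x} \<partial>lborel)"
proof -
  have "ennreal (f x) = (\<integral>\<^sup>+l. indicator {0..<f x} l \<partial>lborel)" for x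
    by (cases "f x \<ge> 0") (auto simp: ennreal_neg)
  then have "(\<integral>\<^sup>+x. ennreal (f x) \<partial>lborel)
      = (\<integral>\<^sup>+x. (\<integral>\<^sup>+l. indicator {0..<f x} l \<partial>lborel) \<partial>lborel)"
    by simp
  also have "\<dots> = (\<integral>\<^sup>+x. (\<integral>\<^sup>+l. indicator {0..} l * indicator {x. l < f x} x \<partial>lborel) \<partial>lborel)"
    by (intro nn_integral_cong) (auto simp: indicator_def)
  also have "\<dots> = (\<integral>\<^sup>+l. (\<integral>\<^sup>+x. indicator {0..} l * indicator {x. l < f x} x \<partial>lborel) \<partial>lborel)"
    by (rule lborel_pair.Fubini') measurable
  also have "\<dots> = (\<integral>\<^sup>+l. indicator {0..} l * emeasure lborel {x. l < f x} \<partial>lborel)"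
    by (intro nn_integral_cong) (simp add: nn_integral_cmult)
  finally show ?thesis .
qed

lemma powr_arith_geo_mean:
  fixes a b :: real
  assumes "0 < s" "s < 1" "0 \<le> a" "0 \<le> b"
  shows "a powr (1 - s) * b powr s \<le> (1 - s) * a + s * b"
  using Youngs_inequality_0[of "1 - s" s a b] assms by (cases "a = 0 \<or> b = 0") auto

text \<open>For functions with supremum \<open>1\<close> the superlevel sets of \<open>f\<close> and \<open>g\<close> are both nonempty at exactly
  the same nonnegative levels. The one-dimensional Brunn-Minkowski inequality can therefore be
  applied level by level and integrated; even the arithmetic mean of the two integrals is
  dominated.\<close>

lemma prekopa_leindler_normalized:
  fixes f g h :: "real \<Rightarrow> real"
  assumes [measurable]: "f \<in> borel_measurable borel" "g \<in> borel_measurable borel"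
      "h \<in> borel_measurable borel"
    and f: "\<And>x. f x \<le> 1" "\<And>l. l < 1 \<Longrightarrow> \<exists>x. l < f x"
    and g: "\<And>x. g x \<le> 1" "\<And>l. l < 1 \<Longrightarrow> \<exists>x. l < g x"
    and s: "0 < s" "s < 1"
    and h: "\<And>x y. f x powr (1 - s) * g y powr s \<le> h ((1 - s) * x + s * y)"
  shows "ennreal (1 - s) * (\<integral>\<^sup>+x. ennreal (f x) \<partial>lborel) + ennreal s * (\<integral>\<^sup>+x. ennreal (g x) \<partial>lborel)
    \<le> (\<integral>\<^sup>+x. ennreal (h x) \<partial>lborel)"
proof -
  have "ennreal (1 - s) * (\<integral>\<^sup>+x. ennreal (f x) \<partial>lborel) + ennreal s * (\<integral>\<^sup>+x. ennreal (g x) \<partial>lborel)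
    = (\<integral>\<^sup>+l. ennreal (1 - s) * (indicator {0..} l * emeasure lborel {x. l < f x})
        + ennreal s * (indicator {0..} l * emeasure lborel {x. l < g x}) \<partial>lborel)"
    by (simp add: nn_integral_layer_cake nn_integral_add nn_integral_cmult)
  also have "\<dots> \<le> (\<integral>\<^sup>+l. indicator {0..} l * emeasure lborel {x. l < h x} \<partial>lborel)"
  proof (rule nn_integral_mono)
    fix l :: real
    consider "l < 0" | "0 \<le> l" "l < 1" | "1 \<le> l" by linarith
    then show "ennreal (1 - s) * (indicator {0..} l * emeasure lborel {x. l < f x})
        + ennreal s * (indicator {0..} l * emeasure lborel {x. l < g x})
        \<le> indicator {0..} l * emeasure lborel {x. l < h x}"
    proof cases
      case 2
      have "ennreal (1 - s) * emeasure lborel {x. l < f x} + ennreal s * emeasure lborel {x. l < g x}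
          \<le> emeasure lborel {x. l < h x}"
      proof (rule brunn_minkowski_real)
        fix a b assume ab: "a \<in> {x. l < f x}" "b \<in> {x. l < g x}"
        have "l = l powr (1 - s) * l powr s"
          using 2 by (cases "l = 0") (simp_all flip: powr_add)
        also have "\<dots> \<le> l powr (1 - s) * g b powr s"
          using ab 2 s by (intro mult_left_mono powr_mono2) auto
        also have "\<dots> < f a powr (1 - s) * g b powr s"
          using ab 2 s by (intro mult_strict_right_mono powr_less_mono2) auto
        also have "\<dots> \<le> h ((1 - s) * a + s * b)" by (rule h)
        finally show "(1 - s) * a + s * b \<in> {x. l < h x}" by simp
      qed (use 2 f(2) g(2) s in auto)
      then show ?thesis using 2 by simp
    next
      case 3
      then have "{x. l < f x} = {}" "{x. l < g x} = {}"
        using f(1) g(1) by (meson dual_order.trans not_less Collect_empty_eq)+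
      then show ?thesis by simp
    qed simp
  qed
  also have "\<dots> = (\<integral>\<^sup>+x. ennreal (h x) \<partial>lborel)"
    by (simp add: nn_integral_layer_cake)
  finally show ?thesis .
qed

text \<open>Dividing \<open>f\<close> and \<open>g\<close> by their suprema reduces the claim to the normalised case, and the
  arithmetic mean obtained there dominates the geometric one.\<close>

lemma prekopa_leindler_real:
  fixes f g h :: "real \<Rightarrow> real"
  assumes int: "integrable lborel f" "integrable lborel g" "integrable lborel h"
    and f: "\<And>x. 0 \<le> f x" "\<And>x. f x \<le> K" and g: "\<And>x. 0 \<le> g x" "\<And>x. g x \<le> K"
    and h0: "\<And>x. 0 \<le> h x" and s: "0 < s" "s < 1"
    and h: "\<And>x y. f x powr (1 - s) * g y powr s \<le> h ((1 - s) * x + s * y)"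
  shows "(LINT x|lborel. f x) powr (1 - s) * (LINT x|lborel. g x) powr s \<le> (LINT x|lborel. h x)"
proof -
  have [measurable]: "f \<in> borel_measurable borel" "g \<in> borel_measurable borel" "h \<in> borel_measurable borel"
    using int by auto
  define p q where "p = (SUP x. f x)" and "q = (SUP x. g x)"
  have bdd: "bdd_above (range f)" "bdd_above (range g)"
    using f g by (auto simp: bdd_above_def)
  have p: "f x \<le> p" and q: "g x \<le> q" for x
    unfolding p_def q_def by (auto intro!: cSUP_upper bdd)
  have pq_ge: "p \<ge> 0" "q \<ge> 0"
    using p[of 0] f(1)[of 0] q[of 0] g(1)[of 0] by linarith+
  show ?thesis
  proof (cases "p = 0 \<or> q = 0")
    case True
    then have "(\<forall>x. f x = 0) \<or> (\<forall>x. g x = 0)"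
      using p q f(1) g(1) by (metis order.antisym)
    then show ?thesis
      by (auto intro!: integral_nonneg_AE h0)
  next
    case False
    then have pq: "p > 0" "q > 0" using pq_ge by auto
    define m where "m = p powr (1 - s) * q powr s"
    have m: "m > 0" using pq by (simp add: m_def)
    have nn: "(\<integral>\<^sup>+x. ennreal (u x / c) \<partial>lborel) = ennreal ((LINT x|lborel. u x) / c)"
      if "integrable lborel u" "\<And>x. 0 \<le> u x" "c > 0" for u :: "real \<Rightarrow> real" and c
      using that by (subst nn_integral_eq_integral) auto
    have "ennreal (1 - s) * (\<integral>\<^sup>+x. ennreal (f x / p) \<partial>lborel)
        + ennreal s * (\<integral>\<^sup>+x. ennreal (g x / q) \<partial>lborel) \<le> (\<integral>\<^sup>+x. ennreal (h x / m) \<partial>lborel)"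
    proof (rule prekopa_leindler_normalized)
      fix l :: real assume "l < 1"
      then have "l * p < p" "l * q < q" using pq by auto
      then show "\<exists>x. l < f x / p" "\<exists>x. l < g x / q"
        using pq less_cSUP_iff[OF _ bdd(1)] less_cSUP_iff[OF _ bdd(2)]
        by (auto simp: pos_less_divide_eq p_def q_def)
    next
      fix x y
      have "(f x / p) powr (1 - s) * (g y / q) powr s = f x powr (1 - s) * g y powr s / m"
        using f g pq by (simp add: m_def powr_divide)
      also have "\<dots> \<le> h ((1 - s) * x + s * y) / m"
        using m by (intro divide_right_mono h) auto
      finally show "(f x / p) powr (1 - s) * (g y / q) powr s \<le> h ((1 - s) * x + s * y) / m" .
    qed (use p q pq s in auto)
    then have "ennreal (1 - s) * ennreal ((LINT x|lborel. f x) / p)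
        + ennreal s * ennreal ((LINT x|lborel. g x) / q) \<le> ennreal ((LINT x|lborel. h x) / m)"
      using int f g h0 pq m by (simp add: nn)
    then have le: "(1 - s) * ((LINT x|lborel. f x) / p) + s * ((LINT x|lborel. g x) / q)
        \<le> (LINT x|lborel. h x) / m"
      using s pq m f(1) g(1) h0
      by (simp add: integral_nonneg_AE flip: ennreal_mult ennreal_plus)
    have "(LINT x|lborel. f x) powr (1 - s) * (LINT x|lborel. g x) powr s
        = m * (((LINT x|lborel. f x) / p) powr (1 - s) * ((LINT x|lborel. g x) / q) powr s)"
      using pq f(1) g(1) by (simp add: m_def powr_divide)
    also have "\<dots> \<le> m * ((1 - s) * ((LINT x|lborel. f x) / p) + s * ((LINT x|lborel. g x) / q))"
      using m s pq f(1) g(1) by (intro mult_left_mono powr_arith_geo_mean) auto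
    also have "\<dots> \<le> m * ((LINT x|lborel. h x) / m)"
      using m by (intro mult_left_mono le) auto
    finally show ?thesis using m by simp
  qed
qed

section \<open>The Gaussian Prekopa-Leindler inequality\<close>

lemma prob_space_std_gaussian: "prob_space std_gaussian"
  unfolding std_gaussian_def by (rule prob_space_normal_density) simp

lemma sets_std_gaussian [measurable_cong, simp]: "sets std_gaussian = sets borel"
  and space_std_gaussian [simp]: "space std_gaussian = UNIV"
  by (simp_all add: std_gaussian_def)

lemma std_normal_density_le_1: "std_normal_density x \<le> 1"
proof -
  have "1 / sqrt (2 * pi) * exp (- x\<^sup>2 / 2) \<le> 1 * 1"
    using pi_gt3 by (intro mult_mono) (auto simp: divide_simps)
  then show ?thesis
    unfolding std_normal_density_def by simp
qed

text \<open>The Gaussian density \<open>\<rho>\<close> satisfies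
  \<open>\<rho> x powr (1 - s) * \<rho> y powr s * exp (s * (1 - s) / 2 * (x - y)\<^sup>2) = \<rho> ((1 - s) * x + s * y)\<close>,
  so multiplying the functions by \<open>\<rho>\<close> turns the hypothesis into the one for Lebesgue measure. The
  quadratic gain expresses the strong log-concavity of \<open>\<rho>\<close>.\<close>

lemma gaussian_prekopa_leindler_real:
  fixes f g h :: "real \<Rightarrow> real"
  assumes meas [measurable]: "f \<in> borel_measurable borel" "g \<in> borel_measurable borel"
      "h \<in> borel_measurable borel"
    and f: "\<And>x. 0 \<le> f x" "\<And>x. f x \<le> K" and g: "\<And>x. 0 \<le> g x" "\<And>x. g x \<le> K"
    and h0: "\<And>x. 0 \<le> h x" "\<And>x. h x \<le> L" and s: "0 < s" "s < 1"
    and h: "\<And>x y. f x powr (1 - s) * g y powr s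
      \<le> h ((1 - s) * x + s * y) * exp (s * (1 - s) / 2 * (x - y)\<^sup>2)"
  shows "(LINT x|std_gaussian. f x) powr (1 - s) * (LINT x|std_gaussian. g x) powr s
    \<le> (LINT x|std_gaussian. h x)"
proof -
  interpret prob_space std_gaussian by (rule prob_space_std_gaussian)
  let ?\<rho> = "std_normal_density"
  have eq: "(LINT x|std_gaussian. u x) = (LINT x|lborel. ?\<rho> x * u x)"
    and int: "integrable lborel (\<lambda>x. ?\<rho> x * u x)"
    if [measurable]: "u \<in> borel_measurable borel" and "\<And>x. 0 \<le> u x" "\<And>x. u x \<le> B"
    for u :: "real \<Rightarrow> real" and B
  proof -
    have "integrable std_gaussian u"
      using that by (intro integrable_const_bound[where B = B]) auto
    then show "integrable lborel (\<lambda>x. ?\<rho> x * u x)"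
      unfolding std_gaussian_def by (subst (asm) integrable_density) auto
    show "(LINT x|std_gaussian. u x) = (LINT x|lborel. ?\<rho> x * u x)"
      unfolding std_gaussian_def by (subst integral_density) auto
  qed
  have \<rho>: "?\<rho> x powr (1 - s) * ?\<rho> y powr s * exp (s * (1 - s) / 2 * (x - y)\<^sup>2)
      = ?\<rho> ((1 - s) * x + s * y)" for x y
  proof -
    have ln: "ln (?\<rho> u) = ln (1 / sqrt (2 * pi)) - u\<^sup>2 / 2" for u
      unfolding std_normal_density_def by (subst ln_mult) auto
    have "?\<rho> x powr (1 - s) * ?\<rho> y powr s * exp (s * (1 - s) / 2 * (x - y)\<^sup>2)
      = exp ((1 - s) * ln (?\<rho> x) + s * ln (?\<rho> y) + s * (1 - s) / 2 * (x - y)\<^sup>2)"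
      using normal_density_pos[of 1 0] by (simp add: powr_def exp_add less_imp_neq[symmetric])
    also have "(1 - s) * ln (?\<rho> x) + s * ln (?\<rho> y) + s * (1 - s) / 2 * (x - y)\<^sup>2
      = ln (?\<rho> ((1 - s) * x + s * y))"
      unfolding ln by (simp add: field_simps power2_eq_square)
    finally show ?thesis by (simp add: normal_density_pos)
  qed
  have \<rho>_bound: "?\<rho> x * a \<le> K" if "0 \<le> a" "a \<le> K" for x a
    using mult_mono[OF std_normal_density_le_1[of x] that(2)] that by simp
  note int' = int[OF meas(1) f] int[OF meas(2) g] int[OF meas(3) h0]
  have "(LINT x|lborel. ?\<rho> x * f x) powr (1 - s) * (LINT x|lborel. ?\<rho> x * g x) powr s
      \<le> (LINT x|lborel. ?\<rho> x * h x)"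
  proof (rule prekopa_leindler_real[where K = K, OF int'])
    fix x y
    have "(?\<rho> x * f x) powr (1 - s) * (?\<rho> y * g y) powr s
        = (?\<rho> x powr (1 - s) * ?\<rho> y powr s) * (f x powr (1 - s) * g y powr s)"
      by (simp add: powr_mult f g normal_density_nonneg)
    also have "\<dots> \<le> (?\<rho> x powr (1 - s) * ?\<rho> y powr s)
        * (h ((1 - s) * x + s * y) * exp (s * (1 - s) / 2 * (x - y)\<^sup>2))"
      by (intro mult_left_mono h) auto
    also have "\<dots> = ?\<rho> ((1 - s) * x + s * y) * h ((1 - s) * x + s * y)"
      by (simp add: \<rho>[symmetric])
    finally show "(?\<rho> x * f x) powr (1 - s) * (?\<rho> y * g y) powr s
        \<le> ?\<rho> ((1 - s) * x + s * y) * h ((1 - s) * x + s * y)" .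
  qed (simp_all add: f g h0 s \<rho>_bound)
  then show ?thesis
    by (simp only: eq[OF meas(1) f] eq[OF meas(2) g] eq[OF meas(3) h0])
qed

text \<open>The inequality tensorises: integrating out one coordinate with the one-dimensional inequality
  leaves functions of the remaining coordinates that again satisfy the hypothesis, because the
  quadratic gain is a sum over the coordinates.\<close>

lemma gaussian_prekopa_leindler_PiM:
  fixes f g h :: "('i \<Rightarrow> real) \<Rightarrow> real"
  assumes "finite I" and s: "0 < s" "s < 1"
    and "f \<in> borel_measurable (\<Pi>\<^sub>M i\<in>I. std_gaussian)" "g \<in> borel_measurable (\<Pi>\<^sub>M i\<in>I. std_gaussian)"
      "h \<in> borel_measurable (\<Pi>\<^sub>M i\<in>I. std_gaussian)"
    and "\<And>x. 0 \<le> f x" "\<And>x. f x \<le> K" "\<And>x. 0 \<le> g x" "\<And>x. g x \<le> K"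
    and "\<And>x. 0 \<le> h x" "\<And>x. h x \<le> K"
    and "\<And>x y. x \<in> extensional I \<Longrightarrow> y \<in> extensional I \<Longrightarrow> f x powr (1 - s) * g y powr s
      \<le> h (\<lambda>i\<in>I. (1 - s) * x i + s * y i) * exp (s * (1 - s) / 2 * (\<Sum>i\<in>I. (x i - y i)\<^sup>2))"
  shows "(LINT x|(\<Pi>\<^sub>M i\<in>I. std_gaussian). f x) powr (1 - s)
      * (LINT x|(\<Pi>\<^sub>M i\<in>I. std_gaussian). g x) powr s \<le> (LINT x|(\<Pi>\<^sub>M i\<in>I. std_gaussian). h x)"
  using assms(1,4-)
proof (induction I arbitrary: f g h)
  case empty
  have "(LINT x|(\<Pi>\<^sub>M i\<in>{}. std_gaussian). u x) = u (\<lambda>_. undefined)" for u :: "('i \<Rightarrow> real) \<Rightarrow> real"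
    by (simp add: PiM_empty lebesgue_integral_count_space_finite)
  then show ?case
    using empty.prems(10)[of "\<lambda>_. undefined" "\<lambda>_. undefined"] by (simp add: restrict_def)
next
  case (insert i I)
  interpret G: prob_space std_gaussian by (rule prob_space_std_gaussian)
  interpret P: product_prob_space "\<lambda>_::'i. std_gaussian" by unfold_locales
  interpret I: finite_product_prob_space "\<lambda>_::'i. std_gaussian" I
    by unfold_locales (rule insert)
  interpret J: finite_product_prob_space "\<lambda>_::'i. std_gaussian" "insert i I"
    by unfold_locales (simp add: insert)
  note [measurable] = insert.prems(1-3)
  let ?c = "s * (1 - s) / 2"
  define \<I> where "\<I> = (\<lambda>(u :: ('i \<Rightarrow> real) \<Rightarrow> real) x. LINT b|std_gaussian. u (x(i := b)))"
  have eq: "(LINT x|(\<Pi>\<^sub>M i\<in>insert i I. std_gaussian). u x) = (LINT x|(\<Pi>\<^sub>M i\<in>I. std_gaussian). \<I> u x)"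
    and \<I>_meas: "\<I> u \<in> borel_measurable (\<Pi>\<^sub>M i\<in>I. std_gaussian)"
    and \<I>_bound: "\<And>x. 0 \<le> \<I> u x" "\<And>x. \<I> u x \<le> K"
    if u [measurable]: "u \<in> borel_measurable (\<Pi>\<^sub>M i\<in>insert i I. std_gaussian)"
      and ub: "\<And>x. 0 \<le> u x" "\<And>x. u x \<le> K" for u
  proof -
    have "integrable (\<Pi>\<^sub>M i\<in>insert i I. std_gaussian) u"
      using ub by (intro J.integrable_const_bound[where B = K]) auto
    then show "(LINT x|(\<Pi>\<^sub>M i\<in>insert i I. std_gaussian). u x) = (LINT x|(\<Pi>\<^sub>M i\<in>I. std_gaussian). \<I> u x)"
      unfolding \<I>_def by (intro P.product_integral_insert insert.hyps)
    show "\<I> u \<in> borel_measurable (\<Pi>\<^sub>M i\<in>I. std_gaussian)"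
      unfolding \<I>_def by measurable
    show "0 \<le> \<I> u x" for x
      unfolding \<I>_def by (intro integral_nonneg_AE) (simp add: ub)
    have "0 \<le> K" using ub by (meson order_trans)
    show "\<I> u x \<le> K" for x
    proof (cases "integrable std_gaussian (\<lambda>b. u (x(i := b)))")
      case True
      have "\<I> u x \<le> (LINT b|std_gaussian. K)"
        unfolding \<I>_def by (intro integral_mono True) (auto simp: ub)
      also have "\<dots> = K" using G.prob_space by simp
      finally show ?thesis .
    qed (use \<open>0 \<le> K\<close> in \<open>simp add: \<I>_def not_integrable_integral_eq\<close>)
  qed
  have slice: "(\<lambda>b. u (x(i := b))) \<in> borel_measurable borel"
    if [measurable]: "u \<in> borel_measurable (\<Pi>\<^sub>M i\<in>insert i I. std_gaussian)"
      and "x \<in> extensional I" for u :: "('i \<Rightarrow> real) \<Rightarrow> real" and x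
  proof -
    have "x \<in> space (\<Pi>\<^sub>M i\<in>I. std_gaussian)"
      using that(2) by (simp add: space_PiM PiE_def)
    then have "(\<lambda>b. x(i := b)) \<in> measurable std_gaussian (\<Pi>\<^sub>M i\<in>insert i I. std_gaussian)"
      by measurable
    from measurable_compose[OF this that(1)] show ?thesis
      using measurable_cong_sets[OF sets_std_gaussian refl] by blast
  qed
  have "(LINT x|(\<Pi>\<^sub>M i\<in>I. std_gaussian). \<I> f x) powr (1 - s)
      * (LINT x|(\<Pi>\<^sub>M i\<in>I. std_gaussian). \<I> g x) powr s \<le> (LINT x|(\<Pi>\<^sub>M i\<in>I. std_gaussian). \<I> h x)"
  proof (rule insert.IH)
    fix x y :: "'i \<Rightarrow> real" assume xy: "x \<in> extensional I" "y \<in> extensional I"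
    let ?z = "\<lambda>i\<in>I. (1 - s) * x i + s * y i"
    let ?e = "exp (?c * (\<Sum>i\<in>I. (x i - y i)\<^sup>2))"
    have "(LINT a|std_gaussian. f (x(i := a))) powr (1 - s) * (LINT b|std_gaussian. g (y(i := b))) powr s
        \<le> (LINT c|std_gaussian. h (?z(i := c)) * ?e)"
    proof (rule gaussian_prekopa_leindler_real[where K = K and L = "K * ?e"])
      fix a b
      have z: "(\<lambda>j\<in>insert i I. (1 - s) * (x(i := a)) j + s * (y(i := b)) j) = ?z(i := (1 - s) * a + s * b)"
        using insert.hyps by (auto simp: restrict_def)
      have sum: "(\<Sum>j\<in>insert i I. ((x(i := a)) j - (y(i := b)) j)\<^sup>2) = (a - b)\<^sup>2 + (\<Sum>j\<in>I. (x j - y j)\<^sup>2)"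
        using insert.hyps by (auto intro!: sum.cong)
      have "f (x(i := a)) powr (1 - s) * g (y(i := b)) powr s
          \<le> h (\<lambda>j\<in>insert i I. (1 - s) * (x(i := a)) j + s * (y(i := b)) j)
            * exp (?c * (\<Sum>j\<in>insert i I. ((x(i := a)) j - (y(i := b)) j)\<^sup>2))"
        using xy by (intro insert.prems) (auto simp: extensional_def)
      then show "f (x(i := a)) powr (1 - s) * g (y(i := b)) powr s
          \<le> h (?z(i := (1 - s) * a + s * b)) * ?e * exp (?c * (a - b)\<^sup>2)"
        unfolding z sum by (simp add: distrib_left exp_add mult_ac)
    qed (use insert.prems s xy in \<open>auto intro!: slice borel_measurable_times\<close>)
    then show "\<I> f x powr (1 - s) * \<I> g y powr s \<le> \<I> h ?z * ?e"
      by (simp add: \<I>_def)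
  qed (use insert.prems in \<open>auto intro!: \<I>_meas \<I>_bound\<close>)
  then show ?case
    using insert.prems by (simp add: eq)
qed

lemma sets_PiM_std_gaussian: "sets (\<Pi>\<^sub>M i\<in>(UNIV :: 'i::countable set). std_gaussian) = sets borel"
proof -
  have "sets (\<Pi>\<^sub>M i\<in>(UNIV :: 'i set). std_gaussian) = sets (\<Pi>\<^sub>M i\<in>(UNIV :: 'i set). borel :: real measure)"
    by (intro sets_PiM_cong) auto
  then show ?thesis by (simp add: sets_PiM_equal_borel)
qed

definition gaussian_sequence :: "(int \<Rightarrow> real) measure" where
  "gaussian_sequence = (\<Pi>\<^sub>M j\<in>UNIV. std_gaussian)"

lemma sets_gaussian_sequence [measurable_cong, simp]: "sets gaussian_sequence = sets borel"
  and space_gaussian_sequence [simp]: "space gaussian_sequence = UNIV"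
  by (simp_all add: gaussian_sequence_def sets_PiM_std_gaussian space_PiM)

lemma prob_space_gaussian_sequence: "prob_space gaussian_sequence"
  unfolding gaussian_sequence_def by (intro prob_space_PiM prob_space_std_gaussian)

interpretation \<gamma>: prob_space gaussian_sequence
  by (rule prob_space_gaussian_sequence)

text \<open>Setting the coordinates outside \<open>I\<close> to zero carries points of a finite product, which are
  undefined there, to sequences; functions invariant under it are the cylinder functions over \<open>I\<close>.\<close>

definition coords :: "int set \<Rightarrow> (int \<Rightarrow> real) \<Rightarrow> int \<Rightarrow> real" where
  "coords I x = (\<lambda>i. if i \<in> I then x i else 0)"

lemma measurable_coords: "coords I \<in> measurable (\<Pi>\<^sub>M i\<in>I. std_gaussian) borel"
proof -
  have "coords I \<in> measurable (\<Pi>\<^sub>M i\<in>I. std_gaussian) (\<Pi>\<^sub>M j\<in>UNIV. borel)"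
  proof (rule measurable_PiM_single')
    show "(\<lambda>x. coords I x i) \<in> borel_measurable (\<Pi>\<^sub>M i\<in>I. std_gaussian)" for i
    proof (cases "i \<in> I")
      case True
      then have "(\<lambda>x. x i) \<in> measurable (\<Pi>\<^sub>M i\<in>I. std_gaussian) std_gaussian"
        by (rule measurable_component_singleton)
      then show ?thesis using True by (simp add: coords_def)
    qed (simp add: coords_def)
  qed (simp_all add: coords_def)
  then show ?thesis
    using measurable_cong_sets[OF refl sets_PiM_equal_borel] by blast
qed

lemma gaussian_sequence_marginal:
  fixes f :: "(int \<Rightarrow> real) \<Rightarrow> real"
  assumes "finite I" and [measurable]: "f \<in> borel_measurable borel" and "\<And>x. f (coords I x) = f x"
  shows "(LINT x|gaussian_sequence. f x) = (LINT x|(\<Pi>\<^sub>M i\<in>I. std_gaussian). f (coords I x))"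
proof -
  interpret G: prob_space std_gaussian by (rule prob_space_std_gaussian)
  interpret P: product_prob_space "\<lambda>_::int. std_gaussian" UNIV by unfold_locales
  note [measurable] = measurable_coords
  have "(LINT x|(\<Pi>\<^sub>M i\<in>I. std_gaussian). f (coords I x))
      = (LINT x|distr gaussian_sequence (\<Pi>\<^sub>M i\<in>I. std_gaussian) (\<lambda>x. restrict x I). f (coords I x))"
    unfolding gaussian_sequence_def by (subst P.distr_PiM_restrict_finite) (use assms in auto)
  also have "\<dots> = (LINT x|gaussian_sequence. f (coords I (restrict x I)))"
    unfolding gaussian_sequence_def by (rule integral_distr) (auto intro: measurable_restrict_subset)
  also have "\<dots> = (LINT x|gaussian_sequence. f x)"
  proof (rule Bochner_Integration.integral_cong)
    fix x :: "int \<Rightarrow> real"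
    have "coords I (restrict x I) = coords I x" by (auto simp: coords_def)
    then show "f (coords I (restrict x I)) = f x" by (simp add: assms)
  qed simp
  finally show ?thesis by simp
qed

text \<open>The form used for the loop: all functions live on the space of Gaussian sequences, independently
  of the number of coordinates that they depend on.\<close>

lemma gaussian_prekopa_leindler:
  fixes f g h :: "(int \<Rightarrow> real) \<Rightarrow> real"
  assumes I: "finite I" and s: "0 < s" "s < 1"
    and meas [measurable]: "f \<in> borel_measurable borel" "g \<in> borel_measurable borel"
      "h \<in> borel_measurable borel"
    and cyl: "\<And>x. f (coords I x) = f x" "\<And>x. g (coords I x) = g x" "\<And>x. h (coords I x) = h x"
    and bounds: "\<And>x. 0 \<le> f x" "\<And>x. f x \<le> K" "\<And>x. 0 \<le> g x" "\<And>x. g x \<le> K"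
      "\<And>x. 0 \<le> h x" "\<And>x. h x \<le> K"
    and h: "\<And>x y. f x powr (1 - s) * g y powr s
      \<le> h (\<lambda>i. (1 - s) * x i + s * y i) * exp (s * (1 - s) / 2 * (\<Sum>i\<in>I. (x i - y i)\<^sup>2))"
  shows "(LINT x|gaussian_sequence. f x) powr (1 - s) * (LINT x|gaussian_sequence. g x) powr s
    \<le> (LINT x|gaussian_sequence. h x)"
proof -
  note [measurable] = measurable_coords
  have "(LINT x|(\<Pi>\<^sub>M i\<in>I. std_gaussian). f (coords I x)) powr (1 - s)
      * (LINT x|(\<Pi>\<^sub>M i\<in>I. std_gaussian). g (coords I x)) powr s
      \<le> (LINT x|(\<Pi>\<^sub>M i\<in>I. std_gaussian). h (coords I x))"
  proof (rule gaussian_prekopa_leindler_PiM[where K = K])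
    fix x y :: "int \<Rightarrow> real"
    have z: "coords I (\<lambda>i\<in>I. (1 - s) * x i + s * y i)
        = coords I (\<lambda>i. (1 - s) * coords I x i + s * coords I y i)"
      by (auto simp: coords_def)
    have sum: "(\<Sum>i\<in>I. (coords I x i - coords I y i)\<^sup>2) = (\<Sum>i\<in>I. (x i - y i)\<^sup>2)"
      by (intro sum.cong) (auto simp: coords_def)
    show "f (coords I x) powr (1 - s) * g (coords I y) powr s
      \<le> h (coords I (\<lambda>i\<in>I. (1 - s) * x i + s * y i)) * exp (s * (1 - s) / 2 * (\<Sum>i\<in>I. (x i - y i)\<^sup>2))"
      using h[of "coords I x" "coords I y"] by (simp only: z sum cyl)
  qed (use I s bounds in auto)
  then show ?thesis
    using I cyl by (simp only: gaussian_sequence_marginal[of I] meas)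
qed

section \<open>Fourier modes on the torus\<close>

lemma integrable_torus_bounded:
  fixes f :: "real \<Rightarrow> real"
  assumes "f \<in> borel_measurable borel" "\<And>x. \<bar>f x\<bar> \<le> B"
  shows "integrable torus f"
  using assms by (intro torus.integrable_const_bound[where B = B]) auto

lemma integral_torus_FTC:
  fixes f F :: "real \<Rightarrow> real"
  assumes F: "\<And>x. (F has_real_derivative f x) (at x)" and f: "continuous_on UNIV f"
  shows "(LINT x|torus. f x) = (F (2 * pi) - F 0) / (2 * pi)"
proof -
  have [measurable]: "f \<in> borel_measurable borel"
    using f by (rule borel_measurable_continuous_onI)
  have eq: "torus = density lborel (\<lambda>x. ennreal (indicator {0..<2 * pi} x / (2 * pi)))"
    unfolding torus_def uniform_measure_def
    by (intro density_cong) (auto simp: indicator_def divide_ennreal[symmetric])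
  have "(LINT x|torus. f x) = (LINT x|lborel. indicator {0..<2 * pi} x / (2 * pi) * f x)"
    unfolding eq by (subst integral_density) auto
  also have "\<dots> = (LINT x|lborel. indicator {0..2 * pi} x *\<^sub>R f x / (2 * pi))"
  proof (rule integral_cong_AE)
    show "AE x in lborel. indicator {0..<2 * pi} x / (2 * pi) * f x = indicator {0..2 * pi} x *\<^sub>R f x / (2 * pi)"
      using AE_lborel_singleton[of "2 * pi"] by eventually_elim (auto simp: indicator_def)
  qed auto
  also have "\<dots> = (F (2 * pi) - F 0) / (2 * pi)"
    using f by (subst integral_divide_zero, subst integral_FTC_atLeastAtMost[of _ _ F])
      (auto simp: has_real_derivative_iff_has_vector_derivative[symmetric]
        intro: F DERIV_subset continuous_on_subset)
  finally show ?thesis .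
qed

lemma integral_torus_cos: "(LINT x|torus. cos (of_int k * x)) = (if k = 0 then 1 else 0)"
proof (cases "k = 0")
  case False
  have "(LINT x|torus. cos (of_int k * x))
      = (sin (of_int k * (2 * pi)) / of_int k - sin (of_int k * 0) / of_int k) / (2 * pi)"
    using False by (intro integral_torus_FTC) (auto intro!: derivative_eq_intros continuous_intros)
  also have "sin (of_int k * (2 * pi)) = 0"
    using sin_int_2pin[of k] by (simp add: mult.commute)
  finally show ?thesis using False by simp
qed (simp add: torus.prob_space[simplified])

lemma integral_torus_sin: "(LINT x|torus. sin (of_int k * x)) = 0"
proof (cases "k = 0")
  case False
  have "(LINT x|torus. sin (of_int k * x))
      = (- cos (of_int k * (2 * pi)) / of_int k - (- cos (of_int k * 0) / of_int k)) / (2 * pi)"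
    using False by (intro integral_torus_FTC) (auto intro!: derivative_eq_intros continuous_intros)
  also have "cos (of_int k * (2 * pi)) = 1"
    using cos_int_2pin[of k] by (simp add: mult.commute)
  finally show ?thesis by simp
qed simp

text \<open>The Fourier modes with the factors \<open>sqrt 2 / j\<close> of the loop included, so that the loop is the
  series of the \<open>\<gamma> j * loop_mode j\<close> with standard Gaussian coefficients.\<close>

definition loop_mode :: "int \<Rightarrow> real \<Rightarrow> real" where
  "loop_mode j x = (if j = 0 then 1
     else if j < 0 then sqrt 2 / of_int j * sin (of_int j * x)
     else sqrt 2 / of_int j * cos (of_int j * x))"

definition mode_variance :: "int \<Rightarrow> real" where
  "mode_variance j = (if j = 0 then 1 else 1 / (of_int j)\<^sup>2)"

lemma continuous_on_loop_mode: "continuous_on A (loop_mode j)"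
  unfolding loop_mode_def by (cases "j = 0"; cases "j < 0") (auto intro!: continuous_intros)

lemma measurable_loop_mode [measurable]: "loop_mode j \<in> borel_measurable borel"
  by (rule borel_measurable_continuous_onI) (rule continuous_on_loop_mode)

lemma loop_mode_sq_le: "(loop_mode j x)\<^sup>2 \<le> (if j = 0 then 1 else 2 / (of_int j)\<^sup>2)"
proof -
  have "(sin y)\<^sup>2 \<le> 1" "(cos y)\<^sup>2 \<le> 1" for y :: real
    by (simp_all add: abs_square_le_1)
  then show ?thesis
    unfolding loop_mode_def by (auto simp: power_mult_distrib power_divide intro!: divide_right_mono mult_left_le)
qed

lemma abs_loop_mode_le: "\<bar>loop_mode j x\<bar> \<le> 2"
proof -
  have "2 / (of_int j)\<^sup>2 \<le> (2 :: real)" if "j \<noteq> 0"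
  proof -
    have "1 \<le> (real_of_int j)\<^sup>2"
      using that by (metis of_int_1_le_iff of_int_power one_le_power int_one_le_iff_zero_less zero_less_power2)
    then show ?thesis by (simp add: divide_simps)
  qed
  then have "(loop_mode j x)\<^sup>2 \<le> 2\<^sup>2"
    using loop_mode_sq_le[of j x] by (auto split: if_splits)
  then show ?thesis
    using power2_le_iff_abs_le[of 2 "loop_mode j x"] by simp
qed

text \<open>Product-to-sum formulas reduce everything to the integrals of \<open>cos (k x)\<close> and \<open>sin (k x)\<close>.
  The sign convention (sines for negative and cosines for positive frequencies) excludes
  \<open>i + j = 0\<close> within one family.\<close>

lemma loop_mode_orthogonal:
  "(LINT x|torus. loop_mode i x * loop_mode j x) = (if i = j then mode_variance j else 0)"
proof -
  have int: "integrable torus (\<lambda>x. cos (of_int k * x))" "integrable torus (\<lambda>x. sin (of_int k * x))" for k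
    by (intro integrable_torus_bounded[where B = 1]; simp)+
  have cc: "(LINT x|torus. cos (of_int i * x) * cos (of_int j * x))
      = ((if i - j = 0 then 1 else 0) + (if i + j = 0 then 1 else 0)) / 2" for i j
    by (simp add: cos_times_cos int integral_torus_cos left_diff_distrib[symmetric] distrib_right[symmetric]
        flip: of_int_diff of_int_add)
  have ss: "(LINT x|torus. sin (of_int i * x) * sin (of_int j * x))
      = ((if i - j = 0 then 1 else 0) - (if i + j = 0 then 1 else 0)) / 2" for i j
    by (simp add: sin_times_sin int integral_torus_cos left_diff_distrib[symmetric] distrib_right[symmetric]
        flip: of_int_diff of_int_add)
  have sc: "(LINT x|torus. sin (of_int i * x) * cos (of_int j * x)) = 0" for i j
    by (simp add: sin_times_cos int integral_torus_sin left_diff_distrib[symmetric] distrib_right[symmetric]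
        flip: of_int_diff of_int_add)
  have cs: "(LINT x|torus. cos (of_int j * x) * sin (of_int i * x)) = 0" for i j
    using sc[of i j] by (simp add: mult.commute)
  have pull: "(LINT x|torus. u x * (sqrt 2 * v x)) = sqrt 2 * (LINT x|torus. u x * v x)" for u v
    by (simp only: mult.left_commute[of _ "sqrt 2"] integral_mult_right_zero)
  consider "i = 0" "j = 0" | "i = 0" "j < 0" | "i = 0" "j > 0" | "i < 0" "j = 0" | "i > 0" "j = 0"
    | "i < 0" "j < 0" | "i < 0" "j > 0" | "i > 0" "j < 0" | "i > 0" "j > 0" by linarith
  then show ?thesis
    by cases
      (simp_all add: loop_mode_def mode_variance_def integral_torus_sin integral_torus_cos
        torus.prob_space[simplified] cc ss sc cs mult.assoc pull[of "\<lambda>x. sin (of_int k * x)" for k] pull[of "\<lambda>x. cos (of_int k * x)" for k]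
        power2_eq_square)
qed

lemma sum_symmetric_Suc:
  fixes f :: "int \<Rightarrow> 'a :: comm_monoid_add"
  shows "(\<Sum>j\<in>{- int (Suc n)..int (Suc n)}. f j)
    = (\<Sum>j\<in>{- int n..int n}. f j) + (f (- int (Suc n)) + f (int (Suc n)))"
proof -
  have "{- int (Suc n)..int (Suc n)} = insert (- int (Suc n)) (insert (int (Suc n)) {- int n..int n})"
    by auto
  then show ?thesis by (simp add: add_ac)
qed

text \<open>By Cauchy-Schwarz this bounds the supremum norm of a trigonometric sum by three times the
  Euclidean norm of its coefficients, and it also bounds the variance of the loop at every point.
  The sum of \<open>4 / k\<^sup>2\<close> is compared with a telescoping one, which gives the stronger bound
  \<open>9 - 4 / n\<close> that the induction needs.\<close>

lemma sum_loop_mode_sq_le: "(\<Sum>j\<in>{- int n..int n}. (loop_mode j x)\<^sup>2) \<le> 9"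
proof (cases n)
  case 0
  then show ?thesis using loop_mode_sq_le[of 0 x] by simp
next
  case (Suc m)
  have "(\<Sum>j\<in>{- int (Suc m)..int (Suc m)}. (loop_mode j x)\<^sup>2) \<le> 9 - 4 / real (Suc m)"
  proof (induction m)
    case 0
    have "{-1..1::int} = {-1, 0, 1}" by auto
    then show ?case
      using loop_mode_sq_le[of 0 x] loop_mode_sq_le[of 1 x] loop_mode_sq_le[of "-1" x] by simp
  next
    case (Suc n)
    have "(loop_mode (- int (Suc (Suc n))) x)\<^sup>2 + (loop_mode (int (Suc (Suc n))) x)\<^sup>2
        \<le> 4 / (real (Suc (Suc n)))\<^sup>2"
      using loop_mode_sq_le[of "- int (Suc (Suc n))" x] loop_mode_sq_le[of "int (Suc (Suc n))" x]
      by (simp add: power2_commute power2_eq_square algebra_simps)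
    also have "\<dots> \<le> 4 / real (Suc n) - 4 / real (Suc (Suc n))"
      by (simp add: divide_simps power2_eq_square)
    finally show ?case
      using Suc by (subst sum_symmetric_Suc) linarith
  qed
  also have "\<dots> \<le> 9" by simp
  finally show ?thesis using Suc by simp
qed

section \<open>Integral functionals on the Hilbert space\<close>

lemma square_integrable_rep_l2: "square_integrable (rep_l2 \<phi>)"
  using Quotient3_rep_reflp[OF Quotient3_l2, of \<phi>] by (simp add: l2_rel_def)

lemma measurable_rep_l2 [measurable]: "rep_l2 \<phi> \<in> borel_measurable borel"
  using square_integrable_measurable[OF square_integrable_rep_l2] by simp

lemma abs_rep_l2: "abs_l2 (rep_l2 \<phi>) = \<phi>"
  by (rule Quotient3_abs_rep[OF Quotient3_l2])

lemma AE_rep_abs_l2: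
  assumes "square_integrable f"
  shows "AE x in torus. rep_l2 (abs_l2 f) x = f x"
  using rep_abs_rsp_left[OF Quotient3_l2, OF l2_rel_refl[OF assms]] by (simp add: l2_rel_def)

lemma AE_rep_l2_diff: "AE x in torus. rep_l2 (\<phi> - \<psi>) x = rep_l2 \<phi> x - rep_l2 \<psi> x"
proof -
  have "\<phi> - \<psi> = abs_l2 (\<lambda>x. rep_l2 \<phi> x - rep_l2 \<psi> x)"
    using diff_abs_l2[OF square_integrable_rep_l2 square_integrable_rep_l2] by (simp add: abs_rep_l2)
  then show ?thesis
    by (simp add: AE_rep_abs_l2 square_integrable_diff square_integrable_rep_l2)
qed

text \<open>The integral of \<open>\<theta> \<circ> \<phi>\<close> does not depend on the representative of \<open>\<phi>\<close>.\<close>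

definition l2_integral :: "(real \<Rightarrow> real) \<Rightarrow> l2 \<Rightarrow> real" where
  "l2_integral \<theta> \<phi> = (LINT x|torus. \<theta> (rep_l2 \<phi> x))"

lemma l2_integral_abs:
  assumes [measurable]: "\<theta> \<in> borel_measurable borel" and f: "square_integrable f"
  shows "l2_integral \<theta> (abs_l2 f) = (LINT x|torus. \<theta> (f x))"
proof -
  have [measurable]: "f \<in> borel_measurable borel"
    using square_integrable_measurable[OF f] by simp
  show ?thesis
    unfolding l2_integral_def using AE_rep_abs_l2[OF f] by (intro integral_cong_AE) auto
qed

lemma cube_integral_eq: "cube_integral \<phi> = (LINT x|torus. (rep_l2 \<phi> x) ^ 3)"
  using cube_integral.abs_eq[OF l2_rel_refl[OF square_integrable_rep_l2], of \<phi>] by (simp add: abs_rep_l2)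

lemma integrable_abs_rep_l2: "integrable torus (\<lambda>x. \<bar>rep_l2 \<phi> x\<bar>)"
  using square_integrable_mult[OF square_integrable_rep_l2 square_integrable_bounded[of "\<lambda>_. 1" 1], of \<phi>]
  by simp

lemma integrable_rep_l2_sq: "integrable torus (\<lambda>x. (rep_l2 \<phi> x)\<^sup>2)"
  using square_integrable_rep_l2 by (simp add: square_integrable_def)

lemma integral_rep_l2_sq: "(LINT x|torus. (rep_l2 \<phi> x)\<^sup>2) = (norm \<phi>)\<^sup>2"
  using norm_abs_l2[OF square_integrable_rep_l2, of \<phi>] by (simp add: abs_rep_l2)

lemma integral_abs_rep_l2_le: "(LINT x|torus. \<bar>rep_l2 \<phi> x\<bar>) \<le> norm \<phi>"
proof -
  have "ennreal (LINT x|torus. \<bar>rep_l2 \<phi> x\<bar>) \<le> ennreal (norm \<phi>)"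
    using nn_integral_abs_le[OF square_integrable_rep_l2, of \<phi>]
    by (simp add: abs_rep_l2 nn_integral_eq_integral integrable_abs_rep_l2)
  then show ?thesis by simp
qed

text \<open>Functionals with a Lipschitz integrand are Lipschitz on the Hilbert space because the \<open>L\<^sup>1\<close> norm is
  dominated by the \<open>L\<^sup>2\<close> norm. The cube itself is not of this kind, which is the reason for
  truncating it.\<close>

lemma
  assumes L: "\<And>a b. \<bar>\<theta> a - \<theta> b\<bar> \<le> L * \<bar>a - b\<bar>"
  shows measurable_lipschitz: "\<theta> \<in> borel_measurable borel"
    and integrable_lipschitz_rep_l2: "integrable torus (\<lambda>x. \<theta> (rep_l2 \<phi> x))"
    and l2_integral_lipschitz: "\<bar>l2_integral \<theta> \<phi> - l2_integral \<theta> \<psi>\<bar> \<le> L * norm (\<phi> - \<psi>)"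
proof -
  have "0 \<le> L" using L[of 1 0] by simp
  have "L-lipschitz_on UNIV \<theta>"
    using L \<open>0 \<le> L\<close> by (auto simp: lipschitz_on_def dist_real_def)
  then show meas [measurable]: "\<theta> \<in> borel_measurable borel"
    by (intro borel_measurable_continuous_onI lipschitz_on_continuous_on)
  have int: "integrable torus (\<lambda>x. \<theta> (rep_l2 \<phi> x))" for \<phi>
  proof (rule Bochner_Integration.integrable_bound)
    show "integrable torus (\<lambda>x. \<bar>\<theta> 0\<bar> + L * \<bar>rep_l2 \<phi> x\<bar>)"
      using integrable_abs_rep_l2 by simp
    have "\<bar>\<theta> y\<bar> \<le> \<bar>\<bar>\<theta> 0\<bar> + L * \<bar>y\<bar>\<bar>" for y
      using L[of y 0] by simp
    then show "AE x in torus. norm (\<theta> (rep_l2 \<phi> x)) \<le> norm (\<bar>\<theta> 0\<bar> + L * \<bar>rep_l2 \<phi> x\<bar>)"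
      by simp
  qed simp
  show "integrable torus (\<lambda>x. \<theta> (rep_l2 \<phi> x))" by (rule int)
  have "l2_integral \<theta> \<phi> - l2_integral \<theta> \<psi> = (LINT x|torus. \<theta> (rep_l2 \<phi> x) - \<theta> (rep_l2 \<psi> x))"
    unfolding l2_integral_def using int by simp
  also have "\<bar>\<dots>\<bar> \<le> (LINT x|torus. \<bar>\<theta> (rep_l2 \<phi> x) - \<theta> (rep_l2 \<psi> x)\<bar>)"
    by (rule integral_abs_bound)
  also have "\<dots> \<le> (LINT x|torus. L * \<bar>rep_l2 (\<phi> - \<psi>) x\<bar>)"
  proof (rule integral_mono_AE)
    show "AE x in torus. \<bar>\<theta> (rep_l2 \<phi> x) - \<theta> (rep_l2 \<psi> x)\<bar> \<le> L * \<bar>rep_l2 (\<phi> - \<psi>) x\<bar>"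
      using AE_rep_l2_diff[of \<phi> \<psi>] by eventually_elim (simp add: L)
  qed (use int integrable_abs_rep_l2 in auto)
  also have "\<dots> \<le> L * norm (\<phi> - \<psi>)"
    using integral_abs_rep_l2_le[of "\<phi> - \<psi>"] \<open>0 \<le> L\<close> by (simp add: mult_left_mono)
  finally show "\<bar>l2_integral \<theta> \<phi> - l2_integral \<theta> \<psi>\<bar> \<le> L * norm (\<phi> - \<psi>)" .
qed

lemma continuous_on_l2_integral:
  assumes L: "\<And>a b. \<bar>\<theta> a - \<theta> b\<bar> \<le> L * \<bar>a - b\<bar>"
  shows "continuous_on A (l2_integral \<theta>)"
proof -
  have "0 \<le> L" using L[of 1 0] by simp
  then have "L-lipschitz_on A (l2_integral \<theta>)"
    using l2_integral_lipschitz[OF L] by (auto simp: lipschitz_on_def dist_real_def dist_norm)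
  then show ?thesis by (rule lipschitz_on_continuous_on)
qed

section \<open>The truncated cube\<close>

definition clip :: "real \<Rightarrow> real \<Rightarrow> real" where
  "clip k y = max (- k) (min k y)"

text \<open>The cube continued outside \<open>[- k, k]\<close> along its tangents. Its second derivative is bounded by that
  of the cube, so the convexity estimates are uniform in \<open>k\<close>, while for fixed \<open>k\<close> it is Lipschitz and
  its integral is continuous on the Hilbert space.\<close>

definition trunc_cube :: "real \<Rightarrow> real \<Rightarrow> real" where
  "trunc_cube k y = (clip k y) ^ 3 + 3 * k\<^sup>2 * (y - clip k y)"

lemma trunc_cube_eq: "\<bar>y\<bar> \<le> k \<Longrightarrow> trunc_cube k y = y ^ 3"
  by (simp add: trunc_cube_def clip_def min_absorb2 max_absorb2 abs_le_iff)

lemma trunc_cube_minus: "0 \<le> k \<Longrightarrow> trunc_cube k (- y) = - trunc_cube k y"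
proof -
  assume "0 \<le> k"
  then have "clip k (- y) = - clip k y" by (auto simp: clip_def max_def min_def)
  then show ?thesis by (simp add: trunc_cube_def algebra_simps)
qed

text \<open>A second-order Taylor bound: on \<open>[- M, M]\<close> the derivative \<open>3 (clip k z)\<^sup>2\<close> is Lipschitz with a constant
  proportional to \<open>M\<close>. The algebraic proof avoids differentiating at the two kinks of
  \<open>clip\<close>.\<close>

lemma trunc_cube_tangent:
  fixes k z a M :: real
  assumes k: "0 \<le> k" and az: "\<bar>a\<bar> \<le> M" "\<bar>z\<bar> \<le> M"
  shows "trunc_cube k a - trunc_cube k z - 3 * (clip k z)\<^sup>2 * (a - z) \<le> 9 * M * (a - z)\<^sup>2"
proof -
  define c d where "c = clip k a" and "d = clip k z"
  have c: "\<bar>c\<bar> \<le> k" "\<bar>c\<bar> \<le> \<bar>a\<bar>" and d: "\<bar>d\<bar> \<le> k" "\<bar>d\<bar> \<le> \<bar>z\<bar>" and cd: "\<bar>c - d\<bar> \<le> \<bar>a - z\<bar>"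
    using k by (auto simp: c_def d_def clip_def max_def min_def abs_if)
  have M: "0 \<le> M" using az by linarith
  have "trunc_cube k a - trunc_cube k z - 3 * (clip k z)\<^sup>2 * (a - z)
      = (c - d)\<^sup>2 * (c + 2 * d) + 3 * ((k\<^sup>2 - d\<^sup>2) * ((a - c) - (z - d)))"
    unfolding trunc_cube_def c_def[symmetric] d_def[symmetric]
    by (simp add: power2_eq_square power3_eq_cube algebra_simps)
  moreover have "(c - d)\<^sup>2 * (c + 2 * d) \<le> (a - z)\<^sup>2 * (3 * M)"
  proof -
    have "c + 2 * d \<le> 3 * M" using c d az by linarith
    then have "(c - d)\<^sup>2 * (c + 2 * d) \<le> (c - d)\<^sup>2 * (3 * M)"
      by (rule mult_left_mono) simp
    also have "\<dots> \<le> (a - z)\<^sup>2 * (3 * M)"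
      using cd M by (intro mult_right_mono) (simp_all add: abs_le_square_iff)
    finally show ?thesis .
  qed
  moreover have "(k\<^sup>2 - d\<^sup>2) * ((a - c) - (z - d)) \<le> 2 * M * (a - z)\<^sup>2"
  proof (cases "\<bar>z\<bar> \<le> k")
    case False
    then have "d\<^sup>2 = k\<^sup>2"
      using k by (auto simp: d_def clip_def max_def min_def abs_if split: if_splits)
    then show ?thesis using M by simp
  next
    case True
    then have dz: "d = z" by (auto simp: d_def clip_def max_def min_def abs_le_iff)
    have k2: "k\<^sup>2 - z\<^sup>2 = (k - z) * (k + z)" by (simp add: power2_eq_square algebra_simps)
    consider "a > k" | "\<bar>a\<bar> \<le> k" | "a < - k" by linarith
    then show ?thesis
    proof cases
      case 1
      then have "c = k" using k by (simp add: c_def clip_def)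
      have "(k - z) * (k + z) * (a - k) \<le> (a - z) * (2 * M) * (a - z)"
        using 1 True az k M by (intro mult_mono) auto
      then show ?thesis using \<open>c = k\<close> dz k2 by (simp add: power2_eq_square mult_ac)
    next
      case 2
      then have "c = a" by (auto simp: c_def clip_def max_def min_def abs_le_iff)
      then show ?thesis using dz M by simp
    next
      case 3
      then have "c = - k" using k by (simp add: c_def clip_def)
      have "(k\<^sup>2 - z\<^sup>2) * (a + k) \<le> 0"
        using 3 True k by (intro mult_nonneg_nonpos) (auto simp: power2_le_iff_abs_le)
      moreover have "0 \<le> 2 * M * (a - z)\<^sup>2" using M by simp
      ultimately show ?thesis using \<open>c = - k\<close> dz by simp
    qed
  qed
  ultimately show ?thesis
    by (simp add: algebra_simps)
qed

text \<open>The tangent bounds at \<open>z = (1 - s) a + s b\<close>, averaged with the weights \<open>1 - s\<close> and \<open>s\<close>: the linear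
  terms cancel and the quadratic ones combine to \<open>s (1 - s) (a - b)\<^sup>2\<close>.\<close>

lemma trunc_cube_convexity_defect:
  fixes a b k s :: real
  assumes "0 \<le> k" "0 \<le> s" "s \<le> 1"
  shows "(1 - s) * trunc_cube k a + s * trunc_cube k b - trunc_cube k ((1 - s) * a + s * b)
    \<le> 9 * s * (1 - s) * (a - b)\<^sup>2 * (\<bar>a\<bar> + \<bar>b\<bar>)"
proof -
  define z M where "z = (1 - s) * a + s * b" and "M = \<bar>a\<bar> + \<bar>b\<bar>"
  have "\<bar>z\<bar> \<le> (1 - s) * \<bar>a\<bar> + s * \<bar>b\<bar>"
    unfolding z_def using assms abs_triangle_ineq[of "(1 - s) * a" "s * b"] by (simp add: abs_mult)
  also have "\<dots> \<le> 1 * \<bar>a\<bar> + 1 * \<bar>b\<bar>"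
    using assms by (intro add_mono mult_right_mono) auto
  finally have z: "\<bar>z\<bar> \<le> M" by (simp add: M_def)
  have "(1 - s) * (trunc_cube k a - trunc_cube k z - 3 * (clip k z)\<^sup>2 * (a - z))
      + s * (trunc_cube k b - trunc_cube k z - 3 * (clip k z)\<^sup>2 * (b - z))
      \<le> (1 - s) * (9 * M * (a - z)\<^sup>2) + s * (9 * M * (b - z)\<^sup>2)"
    using assms z by (intro add_mono mult_left_mono trunc_cube_tangent) (auto simp: M_def)
  also have "\<dots> = 9 * s * (1 - s) * (a - b)\<^sup>2 * M"
    unfolding z_def by algebra
  finally have "(1 - s) * (trunc_cube k a - trunc_cube k z - 3 * (clip k z)\<^sup>2 * (a - z))
      + s * (trunc_cube k b - trunc_cube k z - 3 * (clip k z)\<^sup>2 * (b - z))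
      \<le> 9 * s * (1 - s) * (a - b)\<^sup>2 * M" .
  moreover have "(1 - s) * (trunc_cube k a - trunc_cube k z - 3 * (clip k z)\<^sup>2 * (a - z))
      + s * (trunc_cube k b - trunc_cube k z - 3 * (clip k z)\<^sup>2 * (b - z))
      = (1 - s) * trunc_cube k a + s * trunc_cube k b - trunc_cube k z"
    unfolding z_def by (simp add: algebra_simps)
  ultimately show ?thesis unfolding z_def M_def by simp
qed

lemma trunc_cube_lipschitz:
  assumes k: "0 \<le> k"
  shows "\<bar>trunc_cube k a - trunc_cube k b\<bar> \<le> 3 * k\<^sup>2 * \<bar>a - b\<bar>"
proof -
  \<comment> \<open>The function equals \<open>3 k\<^sup>2 y - p (clip k y)\<close>; both it and \<open>p \<circ> clip k\<close> are
    increasing, so its slopes lie between \<open>0\<close> and \<open>3 k\<^sup>2\<close>.\<close>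
  define p where "p = (\<lambda>c :: real. 3 * k\<^sup>2 * c - c ^ 3)"
  have p_mono: "0 \<le> p c - p d" if "d \<le> c" "\<bar>c\<bar> \<le> k" "\<bar>d\<bar> \<le> k" for c d
  proof -
    have "c\<^sup>2 \<le> k\<^sup>2" "d\<^sup>2 \<le> k\<^sup>2" using that k by (simp_all add: power2_le_iff_abs_le)
    moreover have "c * d \<le> k\<^sup>2"
      using that mult_mono[of "\<bar>c\<bar>" k "\<bar>d\<bar>" k] k abs_ge_self[of "c * d"]
      by (simp add: power2_eq_square abs_mult)
    ultimately have "0 \<le> (c - d) * (3 * k\<^sup>2 - c\<^sup>2 - c * d - d\<^sup>2)"
      using that by (intro mult_nonneg_nonneg) auto
    also have "\<dots> = p c - p d" by (simp add: p_def power2_eq_square power3_eq_cube algebra_simps)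
    finally show ?thesis .
  qed
  have *: "\<bar>trunc_cube k a - trunc_cube k b\<bar> \<le> 3 * k\<^sup>2 * \<bar>a - b\<bar>" if "b \<le> a" for a b
  proof -
    have "clip k b \<le> clip k a" "\<bar>clip k a\<bar> \<le> k" "\<bar>clip k b\<bar> \<le> k" "b - clip k b \<le> a - clip k a"
      using k that by (auto simp: clip_def max_def min_def abs_if)
    moreover have "(clip k b) ^ 3 \<le> (clip k a) ^ 3"
      using \<open>clip k b \<le> clip k a\<close> by (rule power_mono_odd[rotated]) simp
    moreover have "3 * k\<^sup>2 * (b - clip k b) \<le> 3 * k\<^sup>2 * (a - clip k a)"
      using \<open>b - clip k b \<le> a - clip k a\<close> by (intro mult_left_mono) auto
    ultimately have "trunc_cube k b \<le> trunc_cube k a" "0 \<le> p (clip k a) - p (clip k b)"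
      using p_mono[of "clip k b" "clip k a"] \<open>clip k b \<le> clip k a\<close> \<open>\<bar>clip k a\<bar> \<le> k\<close> \<open>\<bar>clip k b\<bar> \<le> k\<close>
      by (auto simp: trunc_cube_def)
    moreover have "trunc_cube k a - trunc_cube k b = 3 * k\<^sup>2 * (a - b) - (p (clip k a) - p (clip k b))"
      by (simp add: trunc_cube_def p_def algebra_simps)
    ultimately show ?thesis using that by simp
  qed
  show ?thesis
    using *[of a b] *[of b a] by (cases "b \<le> a") (auto simp: abs_minus_commute)
qed

lemma abs_trunc_cube_le: "0 \<le> k \<Longrightarrow> \<bar>trunc_cube k y\<bar> \<le> \<bar>y\<bar> ^ 3"
proof -
  assume k: "0 \<le> k"
  have *: "\<bar>trunc_cube k y\<bar> \<le> \<bar>y\<bar> ^ 3" if y: "0 \<le> y" for y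
  proof (cases "y \<le> k")
    case True
    then show ?thesis using y by (simp add: trunc_cube_eq)
  next
    case False
    then have T: "trunc_cube k y = k ^ 3 + 3 * k\<^sup>2 * (y - k)"
      using k by (simp add: trunc_cube_def clip_def)
    have "0 \<le> (y - k)\<^sup>2 * (y + 2 * k)" using y k by simp
    also have "\<dots> = y ^ 3 - trunc_cube k y"
      unfolding T by (simp add: power2_eq_square power3_eq_cube algebra_simps)
    finally have "trunc_cube k y \<le> y ^ 3" by simp
    moreover have "0 \<le> trunc_cube k y" using False k by (simp add: T)
    ultimately show ?thesis using y by simp
  qed
  show ?thesis
    using *[of y] *[of "- y"] k by (cases "0 \<le> y") (auto simp: trunc_cube_minus)
qed

section \<open>Partial Fourier sums of the loop\<close>

lemma square_integrable_loop_mode: "square_integrable (loop_mode j)"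
  by (rule square_integrable_bounded[where B = 2]) (auto simp: abs_loop_mode_le)

definition l2_mode :: "int \<Rightarrow> l2" where
  "l2_mode j = abs_l2 (loop_mode j)"

definition partial_loop_fun :: "nat \<Rightarrow> (int \<Rightarrow> real) \<Rightarrow> real \<Rightarrow> real" where
  "partial_loop_fun n \<gamma> x = (\<Sum>j\<in>{- int n..int n}. \<gamma> j * loop_mode j x)"

definition partial_loop :: "nat \<Rightarrow> (int \<Rightarrow> real) \<Rightarrow> l2" where
  "partial_loop n \<gamma> = (\<Sum>j\<in>{- int n..int n}. \<gamma> j *\<^sub>R l2_mode j)"

lemma
  assumes "finite A" and f: "\<And>j. j \<in> A \<Longrightarrow> square_integrable (f j)"
  shows square_integrable_sum: "square_integrable (\<lambda>x. \<Sum>j\<in>A. c j * f j x)"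
    and abs_l2_sum: "abs_l2 (\<lambda>x. \<Sum>j\<in>A. c j * f j x) = (\<Sum>j\<in>A. c j *\<^sub>R abs_l2 (f j))"
  using assms
proof (induction A rule: finite_induct)
  case empty
  { case 1 then show ?case by (simp add: square_integrable_bounded[of _ 0]) }
  { case 2 then show ?case by (simp add: zero_l2_def) }
next
  case (insert i A)
  { case 1 then show ?case using insert by (simp add: square_integrable_add square_integrable_scale) }
  { case 2 then show ?case
      using insert
      by (simp add: plus_l2.abs_eq[symmetric] scaleR_l2.abs_eq[symmetric] l2_rel_refl square_integrable_scale) }
qed

lemma square_integrable_partial_loop_fun: "square_integrable (partial_loop_fun n \<gamma>)"
  unfolding partial_loop_fun_def[abs_def] by (intro square_integrable_sum square_integrable_loop_mode) simp

lemma partial_loop_eq: "partial_loop n \<gamma> = abs_l2 (partial_loop_fun n \<gamma>)"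
  unfolding partial_loop_fun_def[abs_def] partial_loop_def l2_mode_def
  by (simp add: abs_l2_sum square_integrable_loop_mode)

lemma inner_l2_mode: "inner (l2_mode i) (l2_mode j) = (if i = j then mode_variance j else 0)"
  by (simp add: l2_mode_def inner_l2.abs_eq l2_rel_refl square_integrable_loop_mode loop_mode_orthogonal)

lemma norm_sum_modes:
  assumes "finite A"
  shows "(norm (\<Sum>j\<in>A. \<gamma> j *\<^sub>R l2_mode j))\<^sup>2 = (\<Sum>j\<in>A. (\<gamma> j)\<^sup>2 * mode_variance j)"
proof -
  have "(norm (\<Sum>j\<in>A. \<gamma> j *\<^sub>R l2_mode j))\<^sup>2 = (\<Sum>j\<in>A. (norm (\<gamma> j *\<^sub>R l2_mode j))\<^sup>2)"
    using assms by (intro norm_sum_Pythagorean) (auto simp: pairwise_def orthogonal_def inner_l2_mode)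
  also have "\<dots> = (\<Sum>j\<in>A. (\<gamma> j)\<^sup>2 * mode_variance j)"
    by (simp add: power_mult_distrib power2_norm_eq_inner[of "l2_mode _"] inner_l2_mode)
  finally show ?thesis .
qed

lemma mode_variance_nonneg: "0 \<le> mode_variance j"
  and mode_variance_le_1: "mode_variance j \<le> 1"
proof -
  have "1 \<le> (real_of_int j)\<^sup>2" if "j \<noteq> 0"
    using that by (metis of_int_1_le_iff of_int_power one_le_power int_one_le_iff_zero_less zero_less_power2)
  then show "0 \<le> mode_variance j" "mode_variance j \<le> 1"
    by (auto simp: mode_variance_def divide_simps)
qed

lemma norm_partial_loop: "(norm (partial_loop n \<gamma>))\<^sup>2 = (\<Sum>j\<in>{- int n..int n}. (\<gamma> j)\<^sup>2 * mode_variance j)"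
  by (simp add: partial_loop_def norm_sum_modes)

text \<open>In the Gaussian coordinates the \<open>L\<^sup>2\<close> norm is at most the Euclidean norm, so a 1-Lipschitz function
  of the loop is a 1-Lipschitz function of the coordinates.\<close>

lemma norm_partial_loop_le: "(norm (partial_loop n \<gamma>))\<^sup>2 \<le> (\<Sum>j\<in>{- int n..int n}. (\<gamma> j)\<^sup>2)"
  unfolding norm_partial_loop by (intro sum_mono mult_left_le mode_variance_le_1) auto

text \<open>Monotonicity makes the indicators of a ball at the partial sums decrease to the indicator at
  the limit, so the discontinuity of the indicator at the sphere does no harm.\<close>

lemma norm_partial_loop_mono: "m \<le> n \<Longrightarrow> norm (partial_loop m \<gamma>) \<le> norm (partial_loop n \<gamma>)"
  by (rule power2_le_imp_le) (auto simp: norm_partial_loop mode_variance_nonneg intro!: sum_mono2)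

lemma partial_loop_fun_sq_le:
  "(partial_loop_fun n \<gamma> x)\<^sup>2 \<le> 9 * (\<Sum>j\<in>{- int n..int n}. (\<gamma> j)\<^sup>2)"
proof -
  have "(partial_loop_fun n \<gamma> x)\<^sup>2
      \<le> (\<Sum>j\<in>{- int n..int n}. (\<gamma> j)\<^sup>2) * (\<Sum>j\<in>{- int n..int n}. (loop_mode j x)\<^sup>2)"
    unfolding partial_loop_fun_def by (rule Cauchy_Schwarz_ineq_sum)
  also have "\<dots> \<le> (\<Sum>j\<in>{- int n..int n}. (\<gamma> j)\<^sup>2) * 9"
    by (intro mult_left_mono sum_loop_mode_sq_le sum_nonneg) auto
  finally show ?thesis by simp
qed

lemma summable_l2_modes:
  fixes J :: "nat \<Rightarrow> int"
  assumes J: "inj J" and sum: "summable (\<lambda>n. (\<gamma> (J n))\<^sup>2 * mode_variance (J n))"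
  shows "summable (\<lambda>n. \<gamma> (J n) *\<^sub>R l2_mode (J n))"
  unfolding summable_Cauchy
proof (intro allI impI)
  fix e :: real assume e: "e > 0"
  obtain N where N: "norm (\<Sum>k\<in>{m..<n}. (\<gamma> (J k))\<^sup>2 * mode_variance (J k)) < e\<^sup>2" if "m \<ge> N" for m n
    using sum e unfolding summable_Cauchy by (metis zero_less_power)
  have "norm (\<Sum>k\<in>{m..<n}. \<gamma> (J k) *\<^sub>R l2_mode (J k)) < e" if "m \<ge> N" for m n
  proof -
    have inj: "inj_on J {m..<n}" using J by (rule inj_on_subset) simp
    have "(norm (\<Sum>k\<in>{m..<n}. \<gamma> (J k) *\<^sub>R l2_mode (J k)))\<^sup>2
        = (\<Sum>k\<in>{m..<n}. (\<gamma> (J k))\<^sup>2 * mode_variance (J k))"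
      using norm_sum_modes[of "J ` {m..<n}" \<gamma>] by (simp add: sum.reindex[OF inj])
    also have "\<dots> < e\<^sup>2" using N[OF that, of n] by simp
    finally show ?thesis using e by (simp add: power_less_imp_less_base)
  qed
  then show "\<exists>N. \<forall>m\<ge>N. \<forall>n. norm (\<Sum>k\<in>{m..<n}. \<gamma> (J k) *\<^sub>R l2_mode (J k)) < e" by blast
qed

lemma partial_loop_tendsto:
  assumes neg: "summable (\<lambda>n. (\<gamma> (- int (Suc n)))\<^sup>2 * mode_variance (- int (Suc n)))"
    and pos: "summable (\<lambda>n. (\<gamma> (int (Suc n)))\<^sup>2 * mode_variance (int (Suc n)))"
  shows "(\<lambda>n. partial_loop n \<gamma>) \<longlonglongrightarrow> brownian_loop \<gamma>"
proof -
  let ?s = "\<lambda>n. \<gamma> (- int (Suc n)) *\<^sub>R l2_mode (- int (Suc n))"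
  let ?c = "\<lambda>n. \<gamma> (int (Suc n)) *\<^sub>R l2_mode (int (Suc n))"
  have summable: "summable ?s" "summable ?c"
    by (intro summable_l2_modes neg pos; simp add: inj_def)+
  have mode_neg: "l2_mode (- int (Suc n)) = (sqrt 2 / of_int (- int (Suc n))) *\<^sub>R sin_mode (- int (Suc n))"
    and mode_pos: "l2_mode (int (Suc n)) = (sqrt 2 / of_int (int (Suc n))) *\<^sub>R cos_mode (int (Suc n))" for n
    by (simp_all add: l2_mode_def loop_mode_def[abs_def] sin_mode_def cos_mode_def scaleR_l2.abs_eq l2_rel_refl
        square_integrable_bounded[of _ 1])
  have s: "?s = (\<lambda>n. sqrt 2 *\<^sub>R sin_term \<gamma> (- int (Suc n)))"
    and c: "?c = (\<lambda>n. sqrt 2 *\<^sub>R cos_term \<gamma> (int (Suc n)))"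
    by (simp_all only: mode_neg mode_pos sin_term_def cos_term_def scaleR_scaleR) (simp_all add: mult_ac)
  have "summable (\<lambda>n. sin_term \<gamma> (- int (Suc n)))" "summable (\<lambda>n. cos_term \<gamma> (int (Suc n)))"
    using summable_scaleR_right[OF summable(1)[unfolded s], of "1 / sqrt 2"]
      summable_scaleR_right[OF summable(2)[unfolded c], of "1 / sqrt 2"] by simp_all
  then have "suminf ?s = sqrt 2 *\<^sub>R (\<Sum>n. sin_term \<gamma> (- int (Suc n)))"
      "suminf ?c = sqrt 2 *\<^sub>R (\<Sum>n. cos_term \<gamma> (int (Suc n)))"
    unfolding s c by (simp_all only: suminf_scaleR_right)
  moreover have "l2_mode 0 = l2_one"
    by (simp add: l2_mode_def loop_mode_def[abs_def] l2_one_def)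
  ultimately have loop: "brownian_loop \<gamma> = \<gamma> 0 *\<^sub>R l2_mode 0 + suminf ?s + suminf ?c"
    by (simp only: brownian_loop_def)
  have "partial_loop n \<gamma> = \<gamma> 0 *\<^sub>R l2_mode 0 + (\<Sum>k<n. ?s k) + (\<Sum>k<n. ?c k)" for n
  proof (induction n)
    case (Suc n)
    then show ?case
      unfolding partial_loop_def by (subst sum_symmetric_Suc) (simp add: add_ac)
  qed (simp add: partial_loop_def)
  then show ?thesis
    unfolding loop by (simp only:) (intro tendsto_intros summable_LIMSEQ summable)
qed

section \<open>Gaussian exponential moments\<close>

lemma measurable_coordinate [measurable]: "(\<lambda>\<gamma> :: int \<Rightarrow> real. \<gamma> j) \<in> borel_measurable borel"
  by (intro borel_measurable_continuous_onI continuous_on_product_coordinates)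

lemma
  shows integrable_std_gaussian_exp: "integrable std_gaussian (\<lambda>y. exp (c * y))"
    and integral_std_gaussian_exp: "(LINT y|std_gaussian. exp (c * y)) = exp (c\<^sup>2 / 2)"
proof -
  have eq: "std_normal_density y * exp (c * y) = exp (c\<^sup>2 / 2) * normal_density c 1 y" for y
    unfolding std_normal_density_def normal_density_def
    by (simp add: mult_exp_exp power2_eq_square field_simps)
  show "integrable std_gaussian (\<lambda>y. exp (c * y))"
    unfolding std_gaussian_def by (subst integrable_density) (auto simp: eq integrable_normal_density)
  show "(LINT y|std_gaussian. exp (c * y)) = exp (c\<^sup>2 / 2)"
    unfolding std_gaussian_def by (subst integral_density) (auto simp: eq integral_normal_density)
qed

lemma nn_integral_gaussian_sequence_exp:
  assumes I: "finite I"
  shows "(\<integral>\<^sup>+\<gamma>. ennreal (exp (\<Sum>j\<in>I. c j * \<gamma> j)) \<partial>gaussian_sequence) = ennreal (exp (\<Sum>j\<in>I. (c j)\<^sup>2 / 2))"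
proof -
  interpret G: prob_space std_gaussian by (rule prob_space_std_gaussian)
  interpret P: product_prob_space "\<lambda>_::int. std_gaussian" by unfold_locales
  have "(LINT \<gamma>|gaussian_sequence. exp (\<Sum>j\<in>I. c j * \<gamma> j))
      = (LINT \<gamma>|(\<Pi>\<^sub>M i\<in>I. std_gaussian). exp (\<Sum>j\<in>I. c j * coords I \<gamma> j))"
    by (rule gaussian_sequence_marginal[OF I]) (auto simp: coords_def)
  also have "\<dots> = (LINT \<gamma>|(\<Pi>\<^sub>M i\<in>I. std_gaussian). (\<Prod>j\<in>I. exp (c j * \<gamma> j)))"
    using I by (simp add: exp_sum coords_def)
  also have "\<dots> = (\<Prod>j\<in>I. exp ((c j)\<^sup>2 / 2))"
    using P.product_integral_prod[of I "\<lambda>j y. exp (c j * y)"] I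
    by (simp add: integrable_std_gaussian_exp integral_std_gaussian_exp)
  also have "\<dots> = exp (\<Sum>j\<in>I. (c j)\<^sup>2 / 2)"
    using I by (simp add: exp_sum)
  finally have eq: "(LINT \<gamma>|gaussian_sequence. exp (\<Sum>j\<in>I. c j * \<gamma> j)) = exp (\<Sum>j\<in>I. (c j)\<^sup>2 / 2)" .
  have "integrable gaussian_sequence (\<lambda>\<gamma>. exp (\<Sum>j\<in>I. c j * \<gamma> j))"
    by (rule ccontr, drule not_integrable_integral_eq) (use eq in simp)
  then show ?thesis
    by (subst nn_integral_eq_integral) (auto simp: eq)
qed

lemma nn_integral_gaussian_sequence_exp_abs:
  assumes "finite I" "0 \<le> a"
  shows "(\<integral>\<^sup>+\<gamma>. ennreal (exp (a * \<bar>\<Sum>j\<in>I. c j * \<gamma> j\<bar>)) \<partial>gaussian_sequence)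
    \<le> ennreal (2 * exp (a\<^sup>2 * (\<Sum>j\<in>I. (c j)\<^sup>2) / 2))"
proof -
  have "(\<integral>\<^sup>+\<gamma>. ennreal (exp (a * \<bar>\<Sum>j\<in>I. c j * \<gamma> j\<bar>)) \<partial>gaussian_sequence)
      \<le> (\<integral>\<^sup>+\<gamma>. ennreal (exp (\<Sum>j\<in>I. (a * c j) * \<gamma> j)) + ennreal (exp (\<Sum>j\<in>I. (- a * c j) * \<gamma> j)) \<partial>gaussian_sequence)"
  proof (rule nn_integral_mono)
    fix \<gamma> :: "int \<Rightarrow> real"
    define S where "S = (\<Sum>j\<in>I. c j * \<gamma> j)"
    have "(\<Sum>j\<in>I. (a * c j) * \<gamma> j) = a * S" "(\<Sum>j\<in>I. (- a * c j) * \<gamma> j) = - a * S"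
      by (simp_all add: S_def sum_distrib_left sum_negf mult_ac)
    moreover have "exp (a * \<bar>S\<bar>) \<le> exp (a * S) + exp (- a * S)"
      by (cases "S \<ge> 0") auto
    ultimately show "ennreal (exp (a * \<bar>\<Sum>j\<in>I. c j * \<gamma> j\<bar>))
        \<le> ennreal (exp (\<Sum>j\<in>I. (a * c j) * \<gamma> j)) + ennreal (exp (\<Sum>j\<in>I. (- a * c j) * \<gamma> j))"
      unfolding S_def[symmetric] by (simp flip: ennreal_plus)
  qed
  also have "\<dots> = ennreal (exp (\<Sum>j\<in>I. (a * c j)\<^sup>2 / 2)) + ennreal (exp (\<Sum>j\<in>I. (- a * c j)\<^sup>2 / 2))"
    using assms(1) by (subst nn_integral_add) (simp_all only: nn_integral_gaussian_sequence_exp, measurable)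
  also have "\<dots> = ennreal (2 * exp (a\<^sup>2 * (\<Sum>j\<in>I. (c j)\<^sup>2) / 2))"
    by (simp add: power_mult_distrib sum_distrib_left sum_divide_distrib flip: ennreal_plus)
  finally show ?thesis .
qed

text \<open>The expected sum is at most a multiple of the sum of \<open>1 / n\<^sup>2\<close>; second moments are estimated by the
  exponential moments already available.\<close>

lemma AE_summable_mode_variance:
  assumes J: "\<And>n. \<bar>J n\<bar> = int (Suc n)"
  shows "AE \<gamma> in gaussian_sequence. summable (\<lambda>n. (\<gamma> (J n))\<^sup>2 * mode_variance (J n))"
proof -
  have mv: "mode_variance (J n) = 1 / (real (Suc n))\<^sup>2" for n
  proof -
    have "(real_of_int (J n))\<^sup>2 = (of_int \<bar>J n\<bar>)\<^sup>2" by simp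
    then have "(real_of_int (J n))\<^sup>2 = (real (Suc n))\<^sup>2" unfolding J by simp
    moreover have "J n \<noteq> 0" using J[of n] by auto
    ultimately show ?thesis by (simp add: mode_variance_def)
  qed
  have second: "(\<integral>\<^sup>+\<gamma>. ennreal ((\<gamma> j)\<^sup>2) \<partial>gaussian_sequence) \<le> ennreal (4 * exp (1 / 2))" for j
  proof -
    have "(\<integral>\<^sup>+\<gamma>. ennreal ((\<gamma> j)\<^sup>2) \<partial>gaussian_sequence)
        \<le> (\<integral>\<^sup>+\<gamma>. ennreal 2 * ennreal (exp (1 * \<bar>\<Sum>i\<in>{j}. 1 * \<gamma> i\<bar>)) \<partial>gaussian_sequence)"
    proof (rule nn_integral_mono)
      fix \<gamma> :: "int \<Rightarrow> real"
      have "(\<gamma> j)\<^sup>2 \<le> 2 * exp \<bar>\<gamma> j\<bar>"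
        using exp_lower_Taylor_quadratic[of "\<bar>\<gamma> j\<bar>"] by (simp add: field_simps)
      then have "ennreal ((\<gamma> j)\<^sup>2) \<le> ennreal (2 * exp \<bar>\<gamma> j\<bar>)"
        by (rule ennreal_leI)
      also have "\<dots> = ennreal 2 * ennreal (exp \<bar>\<gamma> j\<bar>)"
        by (rule ennreal_mult) auto
      finally show "ennreal ((\<gamma> j)\<^sup>2) \<le> ennreal 2 * ennreal (exp (1 * \<bar>\<Sum>i\<in>{j}. 1 * \<gamma> i\<bar>))"
        by simp
    qed
    also have "\<dots> \<le> ennreal 2 * ennreal (2 * exp (1\<^sup>2 * (\<Sum>i\<in>{j}. 1\<^sup>2) / 2))"
      by (subst nn_integral_cmult) (simp, intro mult_left_mono nn_integral_gaussian_sequence_exp_abs, simp_all)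
    also have "\<dots> = ennreal (4 * exp (1 / 2))"
      by (subst ennreal_mult[symmetric]) auto
    finally show ?thesis .
  qed
  have "(\<integral>\<^sup>+\<gamma>. (\<Sum>n. ennreal ((\<gamma> (J n))\<^sup>2 * mode_variance (J n))) \<partial>gaussian_sequence)
      = (\<Sum>n. \<integral>\<^sup>+\<gamma>. ennreal ((\<gamma> (J n))\<^sup>2 * mode_variance (J n)) \<partial>gaussian_sequence)"
    by (rule nn_integral_suminf) measurable
  also have "\<dots> \<le> (\<Sum>n. ennreal (4 * exp (1 / 2) * (1 / (real (Suc n))\<^sup>2)))"
  proof (rule suminf_le)
    fix n
    have "(\<integral>\<^sup>+\<gamma>. ennreal ((\<gamma> (J n))\<^sup>2 * mode_variance (J n)) \<partial>gaussian_sequence)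
        = (\<integral>\<^sup>+\<gamma>. ennreal ((\<gamma> (J n))\<^sup>2) \<partial>gaussian_sequence) * ennreal (mode_variance (J n))"
      by (subst nn_integral_multc[symmetric]) (auto simp: ennreal_mult mode_variance_nonneg)
    also have "\<dots> \<le> ennreal (4 * exp (1 / 2)) * ennreal (mode_variance (J n))"
      by (intro mult_right_mono second) simp
    also have "\<dots> = ennreal (4 * exp (1 / 2) * (1 / (real (Suc n))\<^sup>2))"
      unfolding mv by (rule ennreal_mult[symmetric]) auto
    finally show "(\<integral>\<^sup>+\<gamma>. ennreal ((\<gamma> (J n))\<^sup>2 * mode_variance (J n)) \<partial>gaussian_sequence)
        \<le> ennreal (4 * exp (1 / 2) * (1 / (real (Suc n))\<^sup>2))" .
  qed auto
  also have "\<dots> < \<infinity>"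
  proof -
    have "summable (\<lambda>n. 4 * exp (1 / 2) * (1 / (real (Suc n))\<^sup>2))"
      using sums_summable[OF inverse_squares_sums] by (intro summable_mult) (simp add: add.commute)
    then show ?thesis by (subst suminf_ennreal2) simp_all
  qed
  finally have "AE \<gamma> in gaussian_sequence. (\<Sum>n. ennreal ((\<gamma> (J n))\<^sup>2 * mode_variance (J n))) \<noteq> \<infinity>"
    by (intro nn_integral_noteq_infinite) auto
  then show ?thesis
    by eventually_elim (rule summable_suminf_not_top, auto simp: mode_variance_nonneg)
qed

lemma AE_partial_loop_tendsto:
  "AE \<gamma> in gaussian_sequence. (\<lambda>n. partial_loop n \<gamma>) \<longlonglongrightarrow> brownian_loop \<gamma>"
proof -
  have "\<bar>- int (Suc n)\<bar> = int (Suc n)" "\<bar>int (Suc n)\<bar> = int (Suc n)" for n by simp_all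
  from AE_summable_mode_variance[OF this(1)] AE_summable_mode_variance[OF this(2)] show ?thesis
    by eventually_elim (rule partial_loop_tendsto)
qed

section \<open>Exponential moments of the cubic weight\<close>

lemma borel_measurable_torus: "measurable torus M = measurable borel M"
  by (rule measurable_cong_sets) simp_all

text \<open>Functionals \<open>\<integral> \<Psi> \<bar>\<phi>\<bar>\<close> with an increasing locally Lipschitz \<open>\<Psi>\<close> are increasing limits of
  continuous functionals. This gives their measurability on the Hilbert space, and their lower
  semicontinuity lets bounds pass from the partial sums to the loop. It is used for
  \<open>\<Psi> u = exp (a u)\<close> and for \<open>\<Psi> u = u\<^sup>3\<close>.\<close>

lemma l2_integral_min_approximation:
  fixes \<Psi> :: "real \<Rightarrow> real"
  assumes mono: "\<And>u v. 0 \<le> u \<Longrightarrow> u \<le> v \<Longrightarrow> \<Psi> u \<le> \<Psi> v" and nonneg: "\<And>u. 0 \<le> u \<Longrightarrow> 0 \<le> \<Psi> u"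
    and lip: "\<And>k u v. 0 \<le> u \<Longrightarrow> u \<le> k \<Longrightarrow> 0 \<le> v \<Longrightarrow> v \<le> k \<Longrightarrow> \<bar>\<Psi> u - \<Psi> v\<bar> \<le> L k * \<bar>u - v\<bar>"
    and L: "\<And>k. 0 \<le> L k"
  shows "continuous_on UNIV (l2_integral (\<lambda>y. \<Psi> (min \<bar>y\<bar> (real k))))"
    and "incseq (\<lambda>k. ennreal (l2_integral (\<lambda>y. \<Psi> (min \<bar>y\<bar> (real k))) \<phi>))"
    and "(\<integral>\<^sup>+x. ennreal (\<Psi> \<bar>rep_l2 \<phi> x\<bar>) \<partial>torus)
        = (SUP k. ennreal (l2_integral (\<lambda>y. \<Psi> (min \<bar>y\<bar> (real k))) \<phi>))"
proof -
  have lip': "\<bar>\<Psi> (min \<bar>a\<bar> (real k)) - \<Psi> (min \<bar>b\<bar> (real k))\<bar> \<le> L (real k) * \<bar>a - b\<bar>" for k a b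
  proof -
    have "\<bar>\<Psi> (min \<bar>a\<bar> (real k)) - \<Psi> (min \<bar>b\<bar> (real k))\<bar> \<le> L (real k) * \<bar>min \<bar>a\<bar> (real k) - min \<bar>b\<bar> (real k)\<bar>"
      by (rule lip) auto
    also have "\<dots> \<le> L (real k) * \<bar>a - b\<bar>"
      by (intro mult_left_mono L) (auto simp: min_def abs_if)
    finally show ?thesis .
  qed
  show "continuous_on UNIV (l2_integral (\<lambda>y. \<Psi> (min \<bar>y\<bar> (real k))))" for k
    by (rule continuous_on_l2_integral[OF lip'])
  have eq: "ennreal (l2_integral (\<lambda>y. \<Psi> (min \<bar>y\<bar> (real k))) \<phi>)
      = (\<integral>\<^sup>+x. ennreal (\<Psi> (min \<bar>rep_l2 \<phi> x\<bar> (real k))) \<partial>torus)" for k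
    unfolding l2_integral_def
    by (rule nn_integral_eq_integral[symmetric]) (auto intro!: integrable_lipschitz_rep_l2[OF lip'] nonneg)
  have [measurable]: "(\<lambda>y. \<Psi> (min \<bar>y\<bar> (real k))) \<in> borel_measurable borel" for k
    by (rule measurable_lipschitz[OF lip'])
  have inc: "incseq (\<lambda>k x. ennreal (\<Psi> (min \<bar>rep_l2 \<phi> x\<bar> (real k))))"
    by (auto simp: incseq_def le_fun_def intro!: ennreal_leI mono)
  then show "incseq (\<lambda>k. ennreal (l2_integral (\<lambda>y. \<Psi> (min \<bar>y\<bar> (real k))) \<phi>))"
    unfolding eq by (auto simp: incseq_def le_fun_def intro!: nn_integral_mono)
  have "ennreal (\<Psi> \<bar>y\<bar>) = (SUP k. ennreal (\<Psi> (min \<bar>y\<bar> (real k))))" for y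
  proof (rule antisym)
    obtain k where "\<bar>y\<bar> \<le> real k" using real_arch_simple by blast
    then show "ennreal (\<Psi> \<bar>y\<bar>) \<le> (SUP k. ennreal (\<Psi> (min \<bar>y\<bar> (real k))))"
      by (intro SUP_upper2[of k]) auto
  qed (auto intro!: SUP_least ennreal_leI mono)
  then have "(\<integral>\<^sup>+x. ennreal (\<Psi> \<bar>rep_l2 \<phi> x\<bar>) \<partial>torus)
      = (\<integral>\<^sup>+x. (SUP k. ennreal (\<Psi> (min \<bar>rep_l2 \<phi> x\<bar> (real k)))) \<partial>torus)"
    by simp
  also have "\<dots> = (SUP k. \<integral>\<^sup>+x. ennreal (\<Psi> (min \<bar>rep_l2 \<phi> x\<bar> (real k))) \<partial>torus)"
  proof (rule nn_integral_monotone_convergence_SUP[OF inc])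
    show "(\<lambda>x. ennreal (\<Psi> (min \<bar>rep_l2 \<phi> x\<bar> (real k)))) \<in> borel_measurable torus" for k
      using measurable_compose[OF measurable_rep_l2 \<open>(\<lambda>y. \<Psi> (min \<bar>y\<bar> (real k))) \<in> borel_measurable borel\<close>]
      by (simp add: borel_measurable_torus)
  qed
  finally show "(\<integral>\<^sup>+x. ennreal (\<Psi> \<bar>rep_l2 \<phi> x\<bar>) \<partial>torus)
        = (SUP k. ennreal (l2_integral (\<lambda>y. \<Psi> (min \<bar>y\<bar> (real k))) \<phi>))"
    by (simp only: eq)
qed

lemma exp_lipschitz_below:
  fixes a k u v :: real
  assumes "0 \<le> a" "u \<le> k" "v \<le> k"
  shows "\<bar>exp (a * u) - exp (a * v)\<bar> \<le> a * exp (a * k) * \<bar>u - v\<bar>"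
proof -
  have *: "\<bar>exp (a * u) - exp (a * v)\<bar> \<le> a * exp (a * k) * \<bar>u - v\<bar>" if "v \<le> u" "u \<le> k" for u v
  proof -
    have "1 + (a * v - a * u) \<le> exp (a * v - a * u)" by (rule exp_ge_add_one_self)
    then have "exp (a * u) * (1 + (a * v - a * u)) \<le> exp (a * u) * exp (a * v - a * u)"
      by (intro mult_left_mono) auto
    then have "exp (a * u) - exp (a * v) \<le> exp (a * u) * (a * (u - v))"
      by (simp add: mult_exp_exp algebra_simps)
    also have "\<dots> \<le> exp (a * k) * (a * (u - v))"
      using assms that by (intro mult_right_mono) (auto intro: mult_left_mono)
    finally have "exp (a * u) - exp (a * v) \<le> exp (a * k) * (a * (u - v))" .
    moreover have "exp (a * v) \<le> exp (a * u)" using that assms by (simp add: mult_left_mono)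
    ultimately show ?thesis using that by (simp add: mult_ac)
  qed
  show ?thesis using *[of v u] *[of u v] assms by (cases "v \<le> u") (auto simp: abs_minus_commute)
qed

lemma cube_lipschitz_below:
  fixes k u v :: real
  assumes "0 \<le> u" "u \<le> k" "0 \<le> v" "v \<le> k"
  shows "\<bar>u ^ 3 - v ^ 3\<bar> \<le> 3 * k\<^sup>2 * \<bar>u - v\<bar>"
  using trunc_cube_lipschitz[of k u v] assms by (simp add: trunc_cube_eq)

definition exp_moment :: "real \<Rightarrow> l2 \<Rightarrow> ennreal" where
  "exp_moment a \<phi> = (\<integral>\<^sup>+x. ennreal (exp (a * \<bar>rep_l2 \<phi> x\<bar>)) \<partial>torus)"

lemma measurable_partial_loop_fun [measurable]:
  "(\<lambda>(\<gamma>, x). partial_loop_fun n \<gamma> x) \<in> borel_measurable (gaussian_sequence \<Otimes>\<^sub>M torus)"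
proof -
  have [measurable]: "loop_mode j \<in> borel_measurable torus" for j
    by (simp add: borel_measurable_torus)
  have [measurable]: "(\<lambda>\<gamma>. \<gamma> j) \<in> borel_measurable gaussian_sequence" for j
    using measurable_coordinate by simp
  show ?thesis unfolding partial_loop_fun_def by measurable
qed

text \<open>By Fubini it is enough to look at one point \<open>x\<close>, where the partial sum is a centred Gaussian
  variable of variance at most \<open>9\<close>.\<close>

lemma nn_integral_exp_partial_loop:
  assumes "0 \<le> a"
  shows "(\<integral>\<^sup>+\<gamma>. \<integral>\<^sup>+x. ennreal (exp (a * \<bar>partial_loop_fun n \<gamma> x\<bar>)) \<partial>torus \<partial>gaussian_sequence)
    \<le> ennreal (2 * exp (a\<^sup>2 * 9 / 2))"
proof -
  interpret P: pair_sigma_finite gaussian_sequence torus by unfold_locales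
  have "(\<integral>\<^sup>+\<gamma>. \<integral>\<^sup>+x. ennreal (exp (a * \<bar>partial_loop_fun n \<gamma> x\<bar>)) \<partial>torus \<partial>gaussian_sequence)
      = (\<integral>\<^sup>+x. \<integral>\<^sup>+\<gamma>. ennreal (exp (a * \<bar>partial_loop_fun n \<gamma> x\<bar>)) \<partial>gaussian_sequence \<partial>torus)"
    by (rule P.Fubini'[symmetric]) measurable
  also have "\<dots> \<le> (\<integral>\<^sup>+x. ennreal (2 * exp (a\<^sup>2 * 9 / 2)) \<partial>torus)"
  proof (rule nn_integral_mono)
    fix x
    have "(\<integral>\<^sup>+\<gamma>. ennreal (exp (a * \<bar>partial_loop_fun n \<gamma> x\<bar>)) \<partial>gaussian_sequence)
        \<le> ennreal (2 * exp (a\<^sup>2 * (\<Sum>j\<in>{- int n..int n}. (loop_mode j x)\<^sup>2) / 2))"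
      using nn_integral_gaussian_sequence_exp_abs[OF _ assms, of "{- int n..int n}" "\<lambda>j. loop_mode j x"]
      by (simp add: partial_loop_fun_def mult.commute)
    also have "\<dots> \<le> ennreal (2 * exp (a\<^sup>2 * 9 / 2))"
      by (intro ennreal_leI mult_left_mono iffD2[OF exp_le_cancel_iff] divide_right_mono sum_loop_mode_sq_le) auto
    finally show "(\<integral>\<^sup>+\<gamma>. ennreal (exp (a * \<bar>partial_loop_fun n \<gamma> x\<bar>)) \<partial>gaussian_sequence)
        \<le> ennreal (2 * exp (a\<^sup>2 * 9 / 2))" .
  qed
  also have "\<dots> = ennreal (2 * exp (a\<^sup>2 * 9 / 2))"
    using torus.emeasure_space_1 by simp
  finally show ?thesis .
qed

lemma measurable_brownian_loop' [measurable]: "brownian_loop \<in> borel_measurable gaussian_sequence"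
  using measurable_brownian_loop by simp

lemma
  assumes a: "0 \<le> a"
  shows measurable_exp_moment: "exp_moment a \<in> borel_measurable borel"
    and nn_integral_exp_moment_loop:
      "(\<integral>\<^sup>+\<gamma>. exp_moment a (brownian_loop \<gamma>) \<partial>gaussian_sequence) \<le> ennreal (2 * exp (a\<^sup>2 * 9 / 2))"
proof -
  define \<psi> where "\<psi> = (\<lambda>(k::nat) y. exp (a * min \<bar>y\<bar> (real k)))"
  have \<psi>: "(\<lambda>y. exp (a * min \<bar>y\<bar> (real k))) = \<psi> k" for k by (simp add: \<psi>_def)
  have mono: "\<And>u v. 0 \<le> u \<Longrightarrow> u \<le> v \<Longrightarrow> exp (a * u) \<le> exp (a * v)"
    and lip: "\<And>k u v. 0 \<le> u \<Longrightarrow> u \<le> k \<Longrightarrow> 0 \<le> v \<Longrightarrow> v \<le> k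
      \<Longrightarrow> \<bar>exp (a * u) - exp (a * v)\<bar> \<le> a * exp (a * k) * \<bar>u - v\<bar>"
    using a by (auto simp: mult_left_mono exp_lipschitz_below)
  have nonneg: "\<And>u. 0 \<le> u \<Longrightarrow> 0 \<le> exp (a * u)" and L: "\<And>k. 0 \<le> a * exp (a * k)"
    using a by simp_all
  note SUP = l2_integral_min_approximation[where \<Psi> = "\<lambda>u. exp (a * u)" and L = "\<lambda>k. a * exp (a * k)",
      OF mono nonneg lip L, unfolded \<psi>]
  have cont: "continuous_on UNIV (l2_integral (\<psi> k))" for k
    by (rule SUP(1))
  have [measurable]: "l2_integral (\<psi> k) \<in> borel_measurable borel" for k
    by (rule borel_measurable_continuous_onI[OF cont])
  have eq: "exp_moment a \<phi> = (SUP k. ennreal (l2_integral (\<psi> k) \<phi>))" for \<phi>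
    unfolding exp_moment_def by (rule SUP(3))
  then show "exp_moment a \<in> borel_measurable borel"
    unfolding eq[abs_def] by measurable
  have [measurable]: "\<psi> k \<in> borel_measurable borel" for k
    unfolding \<psi>_def by measurable
  have "(\<integral>\<^sup>+\<gamma>. exp_moment a (brownian_loop \<gamma>) \<partial>gaussian_sequence)
      = (\<integral>\<^sup>+\<gamma>. (SUP k. ennreal (l2_integral (\<psi> k) (brownian_loop \<gamma>))) \<partial>gaussian_sequence)"
    by (simp only: eq)
  also have "\<dots> = (SUP k. \<integral>\<^sup>+\<gamma>. ennreal (l2_integral (\<psi> k) (brownian_loop \<gamma>)) \<partial>gaussian_sequence)"
  proof (rule nn_integral_monotone_convergence_SUP)
    show "incseq (\<lambda>k \<gamma>. ennreal (l2_integral (\<psi> k) (brownian_loop \<gamma>)))"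
      using SUP(2) by (auto simp: incseq_def le_fun_def)
  qed measurable
  also have "\<dots> \<le> ennreal (2 * exp (a\<^sup>2 * 9 / 2))"
  proof (rule SUP_least)
    fix k
    have "(\<integral>\<^sup>+\<gamma>. ennreal (l2_integral (\<psi> k) (brownian_loop \<gamma>)) \<partial>gaussian_sequence)
        = (\<integral>\<^sup>+\<gamma>. liminf (\<lambda>n. ennreal (l2_integral (\<psi> k) (partial_loop n \<gamma>))) \<partial>gaussian_sequence)"
    proof (rule nn_integral_cong_AE)
      show "AE \<gamma> in gaussian_sequence. ennreal (l2_integral (\<psi> k) (brownian_loop \<gamma>))
          = liminf (\<lambda>n. ennreal (l2_integral (\<psi> k) (partial_loop n \<gamma>)))"
        using AE_partial_loop_tendsto
      proof eventually_elim
        case (elim \<gamma>)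
        have "isCont (l2_integral (\<psi> k)) (brownian_loop \<gamma>)"
          using cont by (simp add: continuous_on_eq_continuous_at)
        then have "(\<lambda>n. ennreal (l2_integral (\<psi> k) (partial_loop n \<gamma>)))
            \<longlonglongrightarrow> ennreal (l2_integral (\<psi> k) (brownian_loop \<gamma>))"
          using elim by (intro tendsto_ennrealI) (rule isCont_tendsto_compose)
        then show ?case
          using lim_imp_Liminf trivial_limit_sequentially by metis
      qed
    qed
    also have "\<dots> \<le> liminf (\<lambda>n. \<integral>\<^sup>+\<gamma>. ennreal (l2_integral (\<psi> k) (partial_loop n \<gamma>)) \<partial>gaussian_sequence)"
    proof (rule nn_integral_liminf)
      have "continuous_on UNIV (\<lambda>\<gamma>. l2_integral (\<psi> k) (partial_loop n \<gamma>))" for n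
        unfolding partial_loop_def
        by (intro continuous_on_compose2[OF cont] continuous_intros continuous_on_product_coordinates) auto
      from borel_measurable_continuous_onI[OF this]
      show "(\<lambda>\<gamma>. ennreal (l2_integral (\<psi> k) (partial_loop n \<gamma>))) \<in> borel_measurable gaussian_sequence" for n
        by simp
    qed
    also have "\<dots> \<le> liminf (\<lambda>n. ennreal (2 * exp (a\<^sup>2 * 9 / 2)))"
    proof (intro Liminf_mono always_eventually allI)
      fix n
      have "ennreal (l2_integral (\<psi> k) (partial_loop n \<gamma>))
          \<le> (\<integral>\<^sup>+x. ennreal (exp (a * \<bar>partial_loop_fun n \<gamma> x\<bar>)) \<partial>torus)" for \<gamma>
      proof -
        have meas [measurable]: "partial_loop_fun n \<gamma> \<in> borel_measurable borel"
          using square_integrable_measurable[OF square_integrable_partial_loop_fun] by simp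
        have "integrable torus (\<lambda>x. \<psi> k (partial_loop_fun n \<gamma> x))"
        proof (rule integrable_torus_bounded[where B = "exp (a * real k)"])
          show "\<bar>\<psi> k (partial_loop_fun n \<gamma> x)\<bar> \<le> exp (a * real k)" for x
            using a by (simp add: \<psi>_def mult_left_mono)
        qed measurable
        moreover have "l2_integral (\<psi> k) (partial_loop n \<gamma>) = (LINT x|torus. \<psi> k (partial_loop_fun n \<gamma> x))"
          unfolding partial_loop_eq by (rule l2_integral_abs) (auto intro: square_integrable_partial_loop_fun)
        ultimately have "ennreal (l2_integral (\<psi> k) (partial_loop n \<gamma>))
            = (\<integral>\<^sup>+x. ennreal (\<psi> k (partial_loop_fun n \<gamma> x)) \<partial>torus)"
          by (simp add: nn_integral_eq_integral \<psi>_def)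
        also have "\<dots> \<le> (\<integral>\<^sup>+x. ennreal (exp (a * \<bar>partial_loop_fun n \<gamma> x\<bar>)) \<partial>torus)"
          using a by (intro nn_integral_mono ennreal_leI) (auto simp: \<psi>_def mult_left_mono)
        finally show ?thesis .
      qed
      then have "(\<integral>\<^sup>+\<gamma>. ennreal (l2_integral (\<psi> k) (partial_loop n \<gamma>)) \<partial>gaussian_sequence)
          \<le> (\<integral>\<^sup>+\<gamma>. \<integral>\<^sup>+x. ennreal (exp (a * \<bar>partial_loop_fun n \<gamma> x\<bar>)) \<partial>torus \<partial>gaussian_sequence)"
        by (intro nn_integral_mono)
      also have "\<dots> \<le> ennreal (2 * exp (a\<^sup>2 * 9 / 2))"
        by (rule nn_integral_exp_partial_loop[OF a])
      finally show "(\<integral>\<^sup>+\<gamma>. ennreal (l2_integral (\<psi> k) (partial_loop n \<gamma>)) \<partial>gaussian_sequence)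
          \<le> ennreal (2 * exp (a\<^sup>2 * 9 / 2))" .
    qed
    also have "\<dots> = ennreal (2 * exp (a\<^sup>2 * 9 / 2))" by (simp add: Liminf_const)
    finally show "(\<integral>\<^sup>+\<gamma>. ennreal (l2_integral (\<psi> k) (brownian_loop \<gamma>)) \<partial>gaussian_sequence)
        \<le> ennreal (2 * exp (a\<^sup>2 * 9 / 2))" .
  qed
  finally show "(\<integral>\<^sup>+\<gamma>. exp_moment a (brownian_loop \<gamma>) \<partial>gaussian_sequence) \<le> ennreal (2 * exp (a\<^sup>2 * 9 / 2))" .
qed

text \<open>Pointwise control of the cubic Gibbs weight on the ball by an integral of exponentials, whose
  expectation is then computed by Fubini. The inequality is Jensen's for the finite measure
  \<open>(1 + \<phi>\<^sup>2) dx\<close>: its mass is at most \<open>N + 1\<close> on the ball, and the integral of \<open>\<bar>\<phi>\<bar>\<close> against it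
  dominates that of \<open>\<bar>\<phi>\<bar>\<^sup>3\<close> against \<open>dx\<close>. Adding \<open>1\<close> to \<open>\<phi>\<^sup>2\<close> keeps the mass away from zero. The
  \<open>3\<close> in the exponent absorbs the factors \<open>\<bar>\<phi>\<bar>\<close> and \<open>1 + \<phi>\<^sup>2\<close>.\<close>

lemma
  fixes c N :: real
  assumes \<phi>: "\<phi> \<in> l2_ball N" and c: "0 \<le> c" and fin: "exp_moment (c * (N + 1) + 3) \<phi> < \<infinity>"
  shows integrable_abs_cube: "integrable torus (\<lambda>x. \<bar>rep_l2 \<phi> x\<bar> ^ 3)"
    and exp_abs_cube_le: "ennreal (exp (c * (LINT x|torus. \<bar>rep_l2 \<phi> x\<bar> ^ 3))) \<le> exp_moment (c * (N + 1) + 3) \<phi>"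
proof -
  define a where "a = c * (N + 1) + 3"
  define y where "y = (\<lambda>x. \<bar>rep_l2 \<phi> x\<bar>)"
  define w where "w = (\<lambda>x. 1 + (y x)\<^sup>2)"
  have [measurable]: "y \<in> borel_measurable torus" "w \<in> borel_measurable torus"
    unfolding w_def y_def borel_measurable_torus by measurable
  have y: "0 \<le> y x" for x by (simp add: y_def)
  have norm: "(norm \<phi>)\<^sup>2 \<le> N"
    using \<phi> by (simp add: l2_ball_def power2_norm_eq_inner)
  then have N: "0 \<le> N" using zero_le_power2 order_trans by blast
  have int_a: "integrable torus (\<lambda>x. exp (a * y x))"
    using fin by (intro integrableI_nonneg) (simp_all add: exp_moment_def a_def y_def borel_measurable_torus)
  have w_le: "w x \<le> exp (2 * y x)" for x
  proof -
    have "1 + 2 * y x + 2 * (y x)\<^sup>2 \<le> exp (2 * y x)"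
      using exp_lower_Taylor_quadratic[of "2 * y x"] y[of x] by (simp add: power_mult_distrib)
    then show ?thesis using y[of x] zero_le_power2[of "y x"] unfolding w_def by linarith
  qed
  have bound: "y x ^ i * w x * exp (b * y x) \<le> exp (a * y x)" if "i \<le> 1" "0 \<le> b" "b \<le> c * (N + 1)" for x i b
  proof -
    have "y x ^ i \<le> exp (y x)"
    proof -
      have "y x \<le> exp (y x)" using exp_ge_add_one_self[of "y x"] by linarith
      then show ?thesis using that(1) y[of x] by (cases i) auto
    qed
    then have "y x ^ i * w x * exp (b * y x) \<le> exp (y x) * exp (2 * y x) * exp (c * (N + 1) * y x)"
      using that w_le[of x] y[of x] by (intro mult_mono) (auto simp: w_def mult_right_mono)
    also have "\<dots> = exp (a * y x)"
      by (simp add: mult_exp_exp a_def algebra_simps)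
    finally show ?thesis .
  qed
  have int: "integrable torus (\<lambda>x. y x ^ i * w x * exp (b * y x))"
    if "i \<le> 1" "0 \<le> b" "b \<le> c * (N + 1)" for i b
    by (rule Bochner_Integration.integrable_bound[OF int_a]) (use bound[OF that] y in \<open>auto simp: w_def\<close>)
  have int_w: "integrable torus w" and int_yw: "integrable torus (\<lambda>x. y x * w x)"
    using int[of 0 0] int[of 1 0] c N by simp_all
  have cube_le: "y x ^ 3 \<le> y x * w x" for x
    using y[of x] by (simp add: w_def power3_eq_cube power2_eq_square algebra_simps)
  have "integrable torus (\<lambda>x. y x ^ 3)"
    by (rule Bochner_Integration.integrable_bound[OF int_yw]) (use cube_le y in \<open>auto simp: w_def\<close>)
  then show int_cube: "integrable torus (\<lambda>x. \<bar>rep_l2 \<phi> x\<bar> ^ 3)"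
    by (simp add: y_def)
  define W where "W = (LINT x|torus. w x)"
  have W_eq: "W = 1 + (norm \<phi>)\<^sup>2"
    using integrable_rep_l2_sq[of \<phi>] integral_rep_l2_sq[of \<phi>] torus.prob_space by (simp add: W_def w_def y_def)
  then have W: "1 \<le> W" "W \<le> N + 1" using norm by simp_all
  define m where "m = (LINT x|torus. y x * w x) / W"
  define b where "b = c * W"
  have b: "0 \<le> b" "b \<le> c * (N + 1)" using c W by (auto simp: b_def mult_left_mono)
  have "exp (b * m) \<le> exp (b * m) * W" using W by simp
  also have "\<dots> = (LINT x|torus. exp (b * m) * ((1 - b * m) * w x + b * (y x * w x)))"
  proof -
    have "(LINT x|torus. exp (b * m) * ((1 - b * m) * w x + b * (y x * w x)))
        = exp (b * m) * ((1 - b * m) * W + b * (LINT x|torus. y x * w x))"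
      unfolding W_def using int_w int_yw by simp
    also have "(LINT x|torus. y x * w x) = m * W" using W by (simp add: m_def)
    finally show ?thesis by (simp add: algebra_simps)
  qed
  also have "\<dots> \<le> (LINT x|torus. y x ^ 0 * w x * exp (b * y x))"
  proof (rule integral_mono)
    show "integrable torus (\<lambda>x. exp (b * m) * ((1 - b * m) * w x + b * (y x * w x)))"
      using int_w int_yw by simp
    show "integrable torus (\<lambda>x. y x ^ 0 * w x * exp (b * y x))"
      by (rule int) (use b in auto)
    fix x
    \<comment> \<open>The tangent at the mean \<open>m\<close> of \<open>y\<close> under the normalised measure.\<close>
    have "exp (b * m) * (1 + (b * y x - b * m)) \<le> exp (b * m) * exp (b * y x - b * m)"
      by (intro mult_left_mono exp_ge_add_one_self) auto
    also have "\<dots> = exp (b * y x)" by (simp add: mult_exp_exp)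
    finally have "w x * (exp (b * m) * (1 + (b * y x - b * m))) \<le> w x * exp (b * y x)"
      by (intro mult_left_mono) (auto simp: w_def)
    then show "exp (b * m) * ((1 - b * m) * w x + b * (y x * w x)) \<le> y x ^ 0 * w x * exp (b * y x)"
      by (simp add: algebra_simps)
  qed
  also have "\<dots> \<le> (LINT x|torus. exp (a * y x))"
    by (intro integral_mono int int_a bound) (use b in auto)
  finally have "exp (b * m) \<le> (LINT x|torus. exp (a * y x))" .
  moreover have "c * (LINT x|torus. \<bar>rep_l2 \<phi> x\<bar> ^ 3) \<le> b * m"
  proof -
    have "(LINT x|torus. \<bar>rep_l2 \<phi> x\<bar> ^ 3) \<le> (LINT x|torus. y x * w x)"
      using int_cube int_yw cube_le by (intro integral_mono) (auto simp: y_def)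
    then show ?thesis using W c by (simp add: b_def m_def mult_left_mono)
  qed
  ultimately have "exp (c * (LINT x|torus. \<bar>rep_l2 \<phi> x\<bar> ^ 3)) \<le> (LINT x|torus. exp (a * y x))"
    by (meson exp_le_cancel_iff order_trans)
  then show "ennreal (exp (c * (LINT x|torus. \<bar>rep_l2 \<phi> x\<bar> ^ 3))) \<le> exp_moment (c * (N + 1) + 3) \<phi>"
    unfolding exp_moment_def a_def[symmetric] y_def[symmetric]
    using int_a by (subst nn_integral_eq_integral) (auto simp: y_def intro!: ennreal_leI)
qed

lemma l2_integral_trunc_cube_tendsto:
  assumes int: "integrable torus (\<lambda>x. \<bar>rep_l2 \<phi> x\<bar> ^ 3)"
  shows "(\<lambda>k. l2_integral (trunc_cube (real k)) \<phi>) \<longlonglongrightarrow> cube_integral \<phi>"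
  unfolding l2_integral_def cube_integral_eq
proof (rule integral_dominated_convergence[OF _ _ int])
  have [measurable]: "trunc_cube (real k) \<in> borel_measurable borel" for k
    by (rule measurable_lipschitz[OF trunc_cube_lipschitz]) simp
  show "(\<lambda>x. trunc_cube (real k) (rep_l2 \<phi> x)) \<in> borel_measurable torus" for k
    by (simp add: borel_measurable_torus)
  show "AE x in torus. (\<lambda>k. trunc_cube (real k) (rep_l2 \<phi> x)) \<longlonglongrightarrow> rep_l2 \<phi> x ^ 3"
  proof (rule AE_I2)
    fix x
    obtain K :: nat where "\<bar>rep_l2 \<phi> x\<bar> \<le> real K" using real_arch_simple by blast
    then have "eventually (\<lambda>k. trunc_cube (real k) (rep_l2 \<phi> x) = rep_l2 \<phi> x ^ 3) sequentially"
      by (intro eventually_sequentiallyI[of K]) (auto intro!: trunc_cube_eq)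
    then show "(\<lambda>k. trunc_cube (real k) (rep_l2 \<phi> x)) \<longlonglongrightarrow> rep_l2 \<phi> x ^ 3"
      by (rule tendsto_eventually)
  qed
qed (auto simp: abs_trunc_cube_le borel_measurable_torus)

lemma continuous_on_trunc_cube_integral: "continuous_on A (l2_integral (trunc_cube (real k)))"
  by (rule continuous_on_l2_integral[OF trunc_cube_lipschitz]) simp

text \<open>Where the cube is integrable, its integral is the limit of the truncated ones, which are
  continuous; elsewhere it is zero by the convention for the Bochner integral.\<close>

lemma measurable_cube_integral: "cube_integral \<in> borel_measurable borel"
proof -
  define A where "A = (\<lambda>\<phi>. \<integral>\<^sup>+x. ennreal (\<bar>rep_l2 \<phi> x\<bar> ^ 3) \<partial>torus)"
  have [measurable]: "l2_integral (trunc_cube (real k)) \<in> borel_measurable borel" for k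
    by (rule borel_measurable_continuous_onI[OF continuous_on_trunc_cube_integral])
  have mono: "\<And>u v::real. 0 \<le> u \<Longrightarrow> u \<le> v \<Longrightarrow> u ^ 3 \<le> v ^ 3" by (rule power_mono)
  have nonneg: "\<And>u::real. 0 \<le> u \<Longrightarrow> 0 \<le> u ^ 3" and L: "\<And>k::real. 0 \<le> 3 * k\<^sup>2" by simp_all
  note SUP = l2_integral_min_approximation[where \<Psi> = "\<lambda>u. u ^ 3" and L = "\<lambda>k. 3 * k\<^sup>2",
      OF mono nonneg cube_lipschitz_below L]
  have [measurable]: "l2_integral (\<lambda>y. min \<bar>y\<bar> (real k) ^ 3) \<in> borel_measurable borel" for k
    by (rule borel_measurable_continuous_onI[OF SUP(1)])
  have A_eq: "A = (\<lambda>\<phi>. SUP k. ennreal (l2_integral (\<lambda>y. min \<bar>y\<bar> (real k) ^ 3) \<phi>))"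
    unfolding A_def by (intro ext SUP(3))
  have [measurable]: "A \<in> borel_measurable borel"
    unfolding A_eq by measurable
  show ?thesis
  proof (rule borel_measurable_LIMSEQ_real)
    show "(\<lambda>\<phi>. if A \<phi> < \<infinity> then l2_integral (trunc_cube (real k)) \<phi> else 0) \<in> borel_measurable borel" for k
      by measurable
    fix \<phi>
    show "(\<lambda>k. if A \<phi> < \<infinity> then l2_integral (trunc_cube (real k)) \<phi> else 0) \<longlonglongrightarrow> cube_integral \<phi>"
    proof (cases "A \<phi> < \<infinity>")
      case True
      then have "integrable torus (\<lambda>x. \<bar>rep_l2 \<phi> x\<bar> ^ 3)"
        by (intro integrableI_nonneg) (auto simp: A_def borel_measurable_torus)
      then show ?thesis using True by (simp add: l2_integral_trunc_cube_tendsto)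
    next
      case False
      have "\<not> integrable torus (\<lambda>x. rep_l2 \<phi> x ^ 3)"
      proof
        assume "integrable torus (\<lambda>x. rep_l2 \<phi> x ^ 3)"
        then have "(\<integral>\<^sup>+x. ennreal (norm (rep_l2 \<phi> x ^ 3)) \<partial>torus) < \<infinity>"
          by (simp add: integrable_iff_bounded)
        then show False using False by (simp add: A_def power_abs)
      qed
      then show ?thesis using False by (simp add: cube_integral_eq not_integrable_integral_eq)
    qed
  qed
qed

section \<open>Log-concavity of the truncated weight\<close>

lemma l2_ball_eq_cball: "l2_ball N = cball 0 (sqrt N)"
  by (auto simp: l2_ball_def norm_eq_sqrt_inner)

lemma partial_loop_affine:
  "partial_loop n (\<lambda>i. (1 - s) * x i + s * y i) = (1 - s) *\<^sub>R partial_loop n x + s *\<^sub>R partial_loop n y"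
  by (simp add: partial_loop_def scaleR_sum_right sum.distrib scaleR_add_left)

lemma partial_loop_diff: "partial_loop n x - partial_loop n y = partial_loop n (\<lambda>i. x i - y i)"
  by (simp add: partial_loop_def sum_subtractf scaleR_diff_left)

lemma partial_loop_coords: "partial_loop n (coords {- int n..int n} \<gamma>) = partial_loop n \<gamma>"
  by (simp add: partial_loop_def coords_def)

lemma continuous_on_partial_loop: "continuous_on A (partial_loop n)"
  unfolding partial_loop_def
  by (intro continuous_on_sum continuous_on_scaleR continuous_on_const)
    (rule continuous_on_subset[OF continuous_on_product_coordinates], simp)

lemma measurable_partial_loop [measurable]: "partial_loop n \<in> borel_measurable borel"
  by (rule borel_measurable_continuous_onI[OF continuous_on_partial_loop])

text \<open>The convexity defect of the cubic term in the Gaussian coordinates. In the pointwise defect, \<open>(a - b)\<^sup>2\<close> is bounded in supremum norm, by \<open>9\<close> times the squared Euclidean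
  distance of the coordinates, and the factor \<open>\<bar>a\<bar> + \<bar>b\<bar>\<close> in \<open>L\<^sup>1\<close>, hence by the \<open>L\<^sup>2\<close> norms.\<close>

lemma trunc_cube_integral_defect:
  fixes x y :: "int \<Rightarrow> real"
  assumes s: "0 \<le> s" "s \<le> 1" and k: "0 \<le> k"
  shows "(1 - s) * l2_integral (trunc_cube k) (partial_loop n x)
      + s * l2_integral (trunc_cube k) (partial_loop n y)
      - l2_integral (trunc_cube k) (partial_loop n (\<lambda>i. (1 - s) * x i + s * y i))
    \<le> 81 * s * (1 - s) * (\<Sum>i\<in>{- int n..int n}. (x i - y i)\<^sup>2)
        * (norm (partial_loop n x) + norm (partial_loop n y))"
proof -
  let ?z = "\<lambda>i. (1 - s) * x i + s * y i"
  let ?\<phi> = "rep_l2 (partial_loop n x)" and ?\<psi> = "rep_l2 (partial_loop n y)"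
    and ?\<zeta> = "rep_l2 (partial_loop n ?z)" and ?T = "trunc_cube k"
  define r where "r = (\<Sum>i\<in>{- int n..int n}. (x i - y i)\<^sup>2)"
  have r: "0 \<le> r" unfolding r_def by (intro sum_nonneg) simp
  note int = integrable_lipschitz_rep_l2[OF trunc_cube_lipschitz[OF k]]
  have rep: "AE u in torus. rep_l2 (partial_loop n \<gamma>) u = partial_loop_fun n \<gamma> u" for \<gamma>
    unfolding partial_loop_eq by (rule AE_rep_abs_l2[OF square_integrable_partial_loop_fun])
  have "(1 - s) * l2_integral ?T (partial_loop n x) + s * l2_integral ?T (partial_loop n y)
      - l2_integral ?T (partial_loop n ?z)
      = (LINT u|torus. (1 - s) * ?T (?\<phi> u) + s * ?T (?\<psi> u) - ?T (?\<zeta> u))"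
    unfolding l2_integral_def using int by simp
  also have "\<dots> \<le> (LINT u|torus. 81 * s * (1 - s) * r * (\<bar>?\<phi> u\<bar> + \<bar>?\<psi> u\<bar>))"
  proof (rule integral_mono_AE)
    show "AE u in torus. (1 - s) * ?T (?\<phi> u) + s * ?T (?\<psi> u) - ?T (?\<zeta> u)
        \<le> 81 * s * (1 - s) * r * (\<bar>?\<phi> u\<bar> + \<bar>?\<psi> u\<bar>)"
      using rep[of x] rep[of y] rep[of ?z]
    proof eventually_elim
      case (elim u)
      have z: "partial_loop_fun n ?z u = (1 - s) * ?\<phi> u + s * ?\<psi> u"
        unfolding elim
        by (simp add: partial_loop_fun_def sum_distrib_left distrib_right mult.assoc sum.distrib)
      have "?\<phi> u - ?\<psi> u = partial_loop_fun n (\<lambda>i. x i - y i) u"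
        unfolding elim by (simp add: partial_loop_fun_def sum_subtractf left_diff_distrib)
      then have diff: "(?\<phi> u - ?\<psi> u)\<^sup>2 \<le> 9 * r"
        using partial_loop_fun_sq_le[of n "\<lambda>i. x i - y i" u] by (simp add: r_def)
      have "(1 - s) * ?T (?\<phi> u) + s * ?T (?\<psi> u) - ?T (?\<zeta> u)
          \<le> 9 * s * (1 - s) * (?\<phi> u - ?\<psi> u)\<^sup>2 * (\<bar>?\<phi> u\<bar> + \<bar>?\<psi> u\<bar>)"
        unfolding elim(3) z by (rule trunc_cube_convexity_defect) (use s k in auto)
      also have "\<dots> \<le> 9 * s * (1 - s) * (9 * r) * (\<bar>?\<phi> u\<bar> + \<bar>?\<psi> u\<bar>)"
        using s by (intro mult_right_mono mult_left_mono diff) auto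
      finally show ?case by (simp add: mult_ac)
    qed
  qed (use int integrable_abs_rep_l2 in auto)
  also have "\<dots> = 81 * s * (1 - s) * r * ((LINT u|torus. \<bar>?\<phi> u\<bar>) + (LINT u|torus. \<bar>?\<psi> u\<bar>))"
    using integrable_abs_rep_l2 by simp
  also have "\<dots> \<le> 81 * s * (1 - s) * r * (norm (partial_loop n x) + norm (partial_loop n y))"
    using s r by (intro mult_left_mono add_mono integral_abs_rep_l2_le) auto
  finally show ?thesis by (simp add: r_def)
qed

locale lipschitz_on_ball =
  fixes \<beta> N :: real and F :: "l2 \<Rightarrow> real"
  assumes \<beta>: "0 < \<beta>" and N: "0 < N"
    and lipschitz: "\<And>\<phi> \<psi>. \<phi> \<in> l2_ball N \<Longrightarrow> \<psi> \<in> l2_ball N \<Longrightarrow> \<bar>F \<phi> - F \<psi>\<bar> \<le> norm (\<phi> - \<psi>)"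
begin

text \<open>The unnormalised Gibbs density tilted by \<open>exp (c F)\<close>. The interaction \<open>V\<close> is a parameter since
  both the cubic integral and its truncations are needed.\<close>

definition tilt :: "(l2 \<Rightarrow> real) \<Rightarrow> real \<Rightarrow> l2 \<Rightarrow> real" where
  "tilt V c \<phi> = indicator (l2_ball N) \<phi> * exp (c * F \<phi> + \<beta> / 6 * V \<phi>)"

abbreviation tilt_trunc :: "nat \<Rightarrow> real \<Rightarrow> l2 \<Rightarrow> real" where
  "tilt_trunc k \<equiv> tilt (l2_integral (trunc_cube (real k)))"

lemma zero_in_ball: "0 \<in> l2_ball N"
  using N by (simp add: l2_ball_eq_cball)

lemma norm_ball: "\<phi> \<in> l2_ball N \<Longrightarrow> norm \<phi> \<le> sqrt N"
  by (simp add: l2_ball_eq_cball)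

lemma F_bound: "\<phi> \<in> l2_ball N \<Longrightarrow> \<bar>F \<phi>\<bar> \<le> \<bar>F 0\<bar> + sqrt N"
  using lipschitz[OF _ zero_in_ball, of \<phi>] norm_ball[of \<phi>] by simp

lemma continuous_on_F: "continuous_on (l2_ball N) F"
proof -
  have "1-lipschitz_on (l2_ball N) F"
    using lipschitz by (auto simp: lipschitz_on_def dist_real_def dist_norm)
  then show ?thesis by (rule lipschitz_on_continuous_on)
qed

lemma sets_ball [measurable]: "l2_ball N \<in> sets borel"
  unfolding l2_ball_eq_cball by simp

lemma measurable_tilt:
  assumes [measurable]: "V \<in> borel_measurable borel"
  shows "tilt V c \<in> borel_measurable borel"
proof -
  have "(\<lambda>\<phi>. indicator (l2_ball N) \<phi> *\<^sub>R F \<phi>) \<in> borel_measurable borel"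
    by (rule borel_measurable_continuous_on_indicator[OF sets_ball continuous_on_F])
  then have [measurable]: "(\<lambda>\<phi>. indicator (l2_ball N) \<phi> * F \<phi>) \<in> borel_measurable borel" by simp
  have "tilt V c = (\<lambda>\<phi>. indicator (l2_ball N) \<phi> * exp (c * (indicator (l2_ball N) \<phi> * F \<phi>) + \<beta> / 6 * V \<phi>))"
    by (auto simp: tilt_def indicator_def)
  also have "\<dots> \<in> borel_measurable borel" by measurable
  finally show ?thesis .
qed

lemma measurable_tilt_trunc [measurable]: "tilt_trunc k c \<in> borel_measurable borel"
  by (intro measurable_tilt borel_measurable_continuous_onI continuous_on_trunc_cube_integral)

lemma tilt_nonneg: "0 \<le> tilt V c \<phi>"
  by (simp add: tilt_def)

lemma tilt_trunc_bounded:
  obtains K where "\<And>\<phi>. tilt_trunc k c \<phi> \<le> K" "0 < K"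
proof
  let ?I = "l2_integral (trunc_cube (real k))"
  let ?K = "exp (\<bar>c\<bar> * (\<bar>F 0\<bar> + sqrt N) + \<beta> / 6 * (\<bar>?I 0\<bar> + 3 * (real k)\<^sup>2 * sqrt N))"
  fix \<phi>
  show "tilt_trunc k c \<phi> \<le> ?K"
  proof (cases "\<phi> \<in> l2_ball N")
    case True
    have "c * F \<phi> \<le> \<bar>c\<bar> * \<bar>F \<phi>\<bar>" by (metis abs_ge_self abs_mult)
    also have "\<dots> \<le> \<bar>c\<bar> * (\<bar>F 0\<bar> + sqrt N)" using F_bound[OF True] by (rule mult_left_mono) simp
    finally have 1: "c * F \<phi> \<le> \<bar>c\<bar> * (\<bar>F 0\<bar> + sqrt N)" .
    have "\<bar>?I \<phi> - ?I 0\<bar> \<le> 3 * (real k)\<^sup>2 * norm (\<phi> - 0)"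
      by (rule l2_integral_lipschitz[OF trunc_cube_lipschitz]) simp
    also have "\<dots> \<le> 3 * (real k)\<^sup>2 * sqrt N"
      using norm_ball[OF True] by (intro mult_left_mono) auto
    finally have "?I \<phi> \<le> \<bar>?I 0\<bar> + 3 * (real k)\<^sup>2 * sqrt N" by linarith
    then have "\<beta> / 6 * ?I \<phi> \<le> \<beta> / 6 * (\<bar>?I 0\<bar> + 3 * (real k)\<^sup>2 * sqrt N)"
      using \<beta> by (intro mult_left_mono) auto
    with 1 True show ?thesis by (simp add: tilt_def)
  qed (simp add: tilt_def)
qed simp

text \<open>The parameters of the tilts are chosen so that \<open>1/4 t F\<close> and \<open>3/4 (- t/3) F\<close> cancel up to the
  Lipschitz bound \<open>\<bar>t\<bar> r / 4\<close>, where \<open>r\<close> is the Euclidean distance of the coordinates. The Gaussian gain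
  is \<open>3 r\<^sup>2 / 32\<close>. For \<open>\<beta> * sqrt N \<le> 1 / 162\<close> the cubic term uses up at most a third of it, and the
  remaining \<open>r\<^sup>2 / 16\<close> is just enough for \<open>\<bar>t\<bar> r / 4 \<le> t\<^sup>2 / 4 + r\<^sup>2 / 16\<close>.\<close>

lemma prekopa_leindler_partial_loop:
  assumes small: "\<beta> * sqrt N \<le> 1 / 162"
  shows "(LINT \<gamma>|gaussian_sequence. tilt_trunc k t (partial_loop n \<gamma>)) powr (1 / 4)
      * (LINT \<gamma>|gaussian_sequence. tilt_trunc k (- t / 3) (partial_loop n \<gamma>)) powr (3 / 4)
    \<le> exp (t\<^sup>2 / 4) * (LINT \<gamma>|gaussian_sequence. tilt_trunc k 0 (partial_loop n \<gamma>))"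
proof -
  let ?I = "l2_integral (trunc_cube (real k))"
  obtain K1 K2 K3 where K: "\<And>\<phi>. tilt_trunc k t \<phi> \<le> K1" "\<And>\<phi>. tilt_trunc k (- t / 3) \<phi> \<le> K2"
      "\<And>\<phi>. tilt_trunc k 0 \<phi> \<le> K3" "0 < K1" "0 < K2" "0 < K3"
    by (metis tilt_trunc_bounded)
  define K where "K = K1 + K2 + exp (t\<^sup>2 / 4) * K3"
  have "(LINT \<gamma>|gaussian_sequence. tilt_trunc k t (partial_loop n \<gamma>)) powr (1 - 3 / 4)
      * (LINT \<gamma>|gaussian_sequence. tilt_trunc k (- t / 3) (partial_loop n \<gamma>)) powr (3 / 4)
    \<le> (LINT \<gamma>|gaussian_sequence. exp (t\<^sup>2 / 4) * tilt_trunc k 0 (partial_loop n \<gamma>))"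
  proof (rule gaussian_prekopa_leindler[where I = "{- int n..int n}" and K = K])
    fix x :: "int \<Rightarrow> real"
    have "0 \<le> exp (t\<^sup>2 / 4) * K3" using K by simp
    then show "tilt_trunc k t (partial_loop n x) \<le> K" "tilt_trunc k (- t / 3) (partial_loop n x) \<le> K"
      using K(1,2)[of "partial_loop n x"] K(4,5) by (simp_all add: K_def)
    have "exp (t\<^sup>2 / 4) * tilt_trunc k 0 (partial_loop n x) \<le> exp (t\<^sup>2 / 4) * K3"
      by (intro mult_left_mono K) simp
    then show "exp (t\<^sup>2 / 4) * tilt_trunc k 0 (partial_loop n x) \<le> K"
      using K(4,5) unfolding K_def by linarith
  next
    fix x y :: "int \<Rightarrow> real"
    define \<phi> \<psi> \<zeta> where "\<phi> = partial_loop n x" and "\<psi> = partial_loop n y"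
      and "\<zeta> = partial_loop n (\<lambda>i. (1 - 3 / 4) * x i + 3 / 4 * y i)"
    define r2 where "r2 = (\<Sum>i\<in>{- int n..int n}. (x i - y i)\<^sup>2)"
    have r2: "0 \<le> r2" unfolding r2_def by (intro sum_nonneg) simp
    have "tilt_trunc k t \<phi> powr (1 - 3 / 4) * tilt_trunc k (- t / 3) \<psi> powr (3 / 4)
      \<le> exp (t\<^sup>2 / 4) * tilt_trunc k 0 \<zeta> * exp (3 / 4 * (1 - 3 / 4) / 2 * r2)"
    proof (cases "\<phi> \<in> l2_ball N \<and> \<psi> \<in> l2_ball N")
      case False
      then show ?thesis by (auto simp: tilt_def)
    next
      case True
      have "\<zeta> = (1 - 3 / 4) *\<^sub>R \<phi> + (3 / 4) *\<^sub>R \<psi>"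
        unfolding \<zeta>_def \<phi>_def \<psi>_def by (rule partial_loop_affine)
      then have \<zeta>: "\<zeta> \<in> l2_ball N"
        using True convexD[of "l2_ball N" \<phi> \<psi> "1 - 3 / 4" "3 / 4"] by (simp add: l2_ball_eq_cball)
      have "norm (\<phi> - \<psi>) \<le> sqrt r2"
        using norm_partial_loop_le[of n "\<lambda>i. x i - y i"]
        by (intro real_le_rsqrt) (simp add: \<phi>_def \<psi>_def partial_loop_diff r2_def)
      then have "\<bar>F \<phi> - F \<psi>\<bar> \<le> sqrt r2"
        using lipschitz[of \<phi> \<psi>] True by linarith
      then have "\<bar>t * (F \<phi> - F \<psi>)\<bar> \<le> \<bar>t\<bar> * sqrt r2"
        unfolding abs_mult by (rule mult_left_mono) simp
      then have "t * (F \<phi> - F \<psi>) \<le> \<bar>t\<bar> * sqrt r2" by linarith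
      moreover have "\<bar>t\<bar> * sqrt r2 \<le> t\<^sup>2 + r2 / 4"
        using sum_squares_bound[of "\<bar>t\<bar>" "sqrt r2 / 2"] r2 by (simp add: power_divide)
      ultimately have 1: "1 / 4 * (t * (F \<phi> - F \<psi>)) \<le> t\<^sup>2 / 4 + r2 / 16" by simp
      have "1 / 4 * ?I \<phi> + 3 / 4 * ?I \<psi> - ?I \<zeta> \<le> 81 * (3 / 4) * (1 / 4) * r2 * (norm \<phi> + norm \<psi>)"
        using trunc_cube_integral_defect[of "3 / 4" "real k" n x y]
        by (simp add: \<phi>_def \<psi>_def \<zeta>_def r2_def)
      also have "\<dots> \<le> 81 * (3 / 4) * (1 / 4) * r2 * (sqrt N + sqrt N)"
        using True r2 by (intro mult_left_mono add_mono norm_ball) auto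
      finally have "\<beta> / 6 * (1 / 4 * ?I \<phi> + 3 / 4 * ?I \<psi> - ?I \<zeta>)
          \<le> \<beta> / 6 * (81 * (3 / 4) * (1 / 4) * r2 * (sqrt N + sqrt N))"
        using \<beta> by (intro mult_left_mono) auto
      also have "\<dots> = 81 / 16 * r2 * (\<beta> * sqrt N)" by simp
      also have "\<dots> \<le> 81 / 16 * r2 * (1 / 162)"
        using r2 small by (intro mult_left_mono) auto
      finally have 2: "\<beta> / 6 * (1 / 4 * ?I \<phi> + 3 / 4 * ?I \<psi> - ?I \<zeta>) \<le> r2 / 32" by simp
      have "1 / 4 * (t * F \<phi> + \<beta> / 6 * ?I \<phi>) + 3 / 4 * (- t / 3 * F \<psi> + \<beta> / 6 * ?I \<psi>)
          \<le> t\<^sup>2 / 4 + (0 * F \<zeta> + \<beta> / 6 * ?I \<zeta>) + 3 / 4 * (1 - 3 / 4) / 2 * r2"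
        using 1 2 by (simp add: algebra_simps)
      then show ?thesis
        using True \<zeta> by (simp add: tilt_def powr_def mult_exp_exp)
    qed
    then show "tilt_trunc k t (partial_loop n x) powr (1 - 3 / 4)
        * tilt_trunc k (- t / 3) (partial_loop n y) powr (3 / 4)
      \<le> exp (t\<^sup>2 / 4) * tilt_trunc k 0 (partial_loop n (\<lambda>i. (1 - 3 / 4) * x i + 3 / 4 * y i))
        * exp (3 / 4 * (1 - 3 / 4) / 2 * (\<Sum>i\<in>{- int n..int n}. (x i - y i)\<^sup>2))"
      by (simp only: \<phi>_def \<psi>_def \<zeta>_def r2_def)
  qed (simp_all only: partial_loop_coords, auto simp: tilt_nonneg)
  then show ?thesis by simp
qed

end

section \<open>Passage to the full loop\<close>

context lipschitz_on_ball
begin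

text \<open>The indicator of the ball is discontinuous, but convergence holds without exception: if the
  limit lies in the ball then so do all partial sums, since their norms increase to that of the
  limit; otherwise the partial sums eventually leave the closed ball.\<close>

lemma tilt_trunc_partial_loop_tendsto:
  assumes lim: "(\<lambda>n. partial_loop n \<gamma>) \<longlonglongrightarrow> brownian_loop \<gamma>"
  shows "(\<lambda>n. tilt_trunc k c (partial_loop n \<gamma>)) \<longlonglongrightarrow> tilt_trunc k c (brownian_loop \<gamma>)"
proof (cases "brownian_loop \<gamma> \<in> l2_ball N")
  case True
  have "norm (partial_loop n \<gamma>) \<le> norm (brownian_loop \<gamma>)" for n
    by (rule incseq_le[OF _ tendsto_norm[OF lim]]) (simp add: incseq_def norm_partial_loop_mono)
  then have ball: "partial_loop n \<gamma> \<in> l2_ball N" for n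
    using True order_trans by (fastforce simp: l2_ball_eq_cball)
  have "(\<lambda>n. F (partial_loop n \<gamma>)) \<longlonglongrightarrow> F (brownian_loop \<gamma>)"
    by (rule continuous_on_tendsto_compose[OF continuous_on_F lim True]) (simp add: ball)
  moreover have "(\<lambda>n. l2_integral (trunc_cube (real k)) (partial_loop n \<gamma>))
      \<longlonglongrightarrow> l2_integral (trunc_cube (real k)) (brownian_loop \<gamma>)"
    by (rule continuous_on_tendsto_compose[OF continuous_on_trunc_cube_integral[of UNIV] lim]) auto
  ultimately show ?thesis
    using True ball by (auto simp: tilt_def intro!: tendsto_intros)
next
  case False
  then have "sqrt N < norm (brownian_loop \<gamma>)" by (simp add: l2_ball_eq_cball)
  then have "eventually (\<lambda>n. sqrt N < norm (partial_loop n \<gamma>)) sequentially"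
    by (rule order_tendstoD(1)[OF tendsto_norm[OF lim]])
  then have "eventually (\<lambda>n. tilt_trunc k c (partial_loop n \<gamma>) = tilt_trunc k c (brownian_loop \<gamma>)) sequentially"
    by eventually_elim (use False in \<open>auto simp: tilt_def l2_ball_eq_cball\<close>)
  then show ?thesis by (rule tendsto_eventually)
qed

lemma integral_tilt_trunc_partial_loop_tendsto:
  "(\<lambda>n. LINT \<gamma>|gaussian_sequence. tilt_trunc k c (partial_loop n \<gamma>))
    \<longlonglongrightarrow> (LINT \<gamma>|gaussian_sequence. tilt_trunc k c (brownian_loop \<gamma>))"
proof -
  obtain K where K: "\<And>\<phi>. tilt_trunc k c \<phi> \<le> K" using tilt_trunc_bounded[of k c] by metis
  have [measurable]: "partial_loop n \<in> borel_measurable gaussian_sequence" for n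
    using measurable_partial_loop by simp
  show ?thesis
  proof (rule integral_dominated_convergence[where w = "\<lambda>_. K"])
    show "AE \<gamma> in gaussian_sequence. (\<lambda>n. tilt_trunc k c (partial_loop n \<gamma>))
        \<longlonglongrightarrow> tilt_trunc k c (brownian_loop \<gamma>)"
      using AE_partial_loop_tendsto by eventually_elim (rule tilt_trunc_partial_loop_tendsto)
  qed (auto simp: K tilt_nonneg)
qed

abbreviation tilt_cube :: "real \<Rightarrow> l2 \<Rightarrow> real" where
  "tilt_cube \<equiv> tilt cube_integral"

lemma measurable_tilt_cube [measurable]: "tilt_cube c \<in> borel_measurable borel"
  by (intro measurable_tilt measurable_cube_integral)

text \<open>Removing the truncation: \<open>\<bar>trunc_cube k y\<bar> \<le> \<bar>y\<bar>\<^sup>3\<close> for every \<open>k\<close>, so \<open>exp_abs_cube_le\<close> provides a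
  majorant that is independent of \<open>k\<close> and integrable.\<close>

lemma
  shows integrable_tilt_cube: "integrable gaussian_sequence (\<lambda>\<gamma>. tilt_cube c (brownian_loop \<gamma>))"
    and integral_tilt_trunc_tendsto: "(\<lambda>k. LINT \<gamma>|gaussian_sequence. tilt_trunc k c (brownian_loop \<gamma>))
      \<longlonglongrightarrow> (LINT \<gamma>|gaussian_sequence. tilt_cube c (brownian_loop \<gamma>))"
proof -
  define a where "a = \<beta> / 6 * (N + 1) + 3"
  define C where "C = exp (\<bar>c\<bar> * (\<bar>F 0\<bar> + sqrt N))"
  define w where "w = (\<lambda>\<gamma>. C * enn2real (exp_moment a (brownian_loop \<gamma>)))"
  have a: "0 \<le> a" using \<beta> N by (simp add: a_def)
  note [measurable] = measurable_exp_moment[OF a]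
  have moment: "(\<integral>\<^sup>+\<gamma>. exp_moment a (brownian_loop \<gamma>) \<partial>gaussian_sequence) < \<infinity>"
    by (rule le_less_trans[OF nn_integral_exp_moment_loop[OF a]]) simp
  have fin: "AE \<gamma> in gaussian_sequence. exp_moment a (brownian_loop \<gamma>) < \<infinity>"
    using nn_integral_noteq_infinite[of "\<lambda>\<gamma>. exp_moment a (brownian_loop \<gamma>)" gaussian_sequence] moment
    by (auto simp: less_top)
  have w: "integrable gaussian_sequence w"
    unfolding w_def
  proof (intro integrable_mult_right integrableI_nonneg)
    have "(\<integral>\<^sup>+\<gamma>. ennreal (enn2real (exp_moment a (brownian_loop \<gamma>))) \<partial>gaussian_sequence)
        \<le> (\<integral>\<^sup>+\<gamma>. exp_moment a (brownian_loop \<gamma>) \<partial>gaussian_sequence)"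
      by (intro nn_integral_mono) (simp add: ennreal_enn2real_if)
    then show "(\<integral>\<^sup>+\<gamma>. ennreal (enn2real (exp_moment a (brownian_loop \<gamma>))) \<partial>gaussian_sequence) < \<infinity>"
      using moment by (rule le_less_trans)
  qed auto
  have bound: "tilt_trunc k c \<phi> \<le> C * enn2real (exp_moment a \<phi>)"
    if fin: "exp_moment a \<phi> < \<infinity>" for \<phi> k
  proof (cases "\<phi> \<in> l2_ball N")
    case True
    let ?A = "LINT x|torus. \<bar>rep_l2 \<phi> x\<bar> ^ 3"
    note cube = integrable_abs_cube[OF True _ fin[unfolded a_def]] exp_abs_cube_le[OF True _ fin[unfolded a_def]]
    have "l2_integral (trunc_cube (real k)) \<phi> \<le> ?A"
      unfolding l2_integral_def
    proof (rule integral_mono[OF _ cube(1)])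
      show "integrable torus (\<lambda>x. trunc_cube (real k) (rep_l2 \<phi> x))"
        by (rule integrable_lipschitz_rep_l2[OF trunc_cube_lipschitz]) simp
      show "trunc_cube (real k) (rep_l2 \<phi> x) \<le> \<bar>rep_l2 \<phi> x\<bar> ^ 3" for x
        using abs_trunc_cube_le[of "real k" "rep_l2 \<phi> x"] by simp
    qed (use \<beta> in auto)
    then have "\<beta> / 6 * l2_integral (trunc_cube (real k)) \<phi> \<le> \<beta> / 6 * ?A"
      using \<beta> by (intro mult_left_mono) auto
    moreover have "c * F \<phi> \<le> \<bar>c\<bar> * (\<bar>F 0\<bar> + sqrt N)"
    proof -
      have "c * F \<phi> \<le> \<bar>c\<bar> * \<bar>F \<phi>\<bar>" by (metis abs_ge_self abs_mult)
      also have "\<dots> \<le> \<bar>c\<bar> * (\<bar>F 0\<bar> + sqrt N)" using F_bound[OF True] by (rule mult_left_mono) simp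
      finally show ?thesis .
    qed
    ultimately have "tilt_trunc k c \<phi> \<le> C * exp (\<beta> / 6 * ?A)"
      using True by (simp add: tilt_def C_def mult_exp_exp)
    also have "exp (\<beta> / 6 * ?A) \<le> enn2real (exp_moment a \<phi>)"
    proof -
      have "enn2real (ennreal (exp (\<beta> / 6 * ?A))) \<le> enn2real (exp_moment a \<phi>)"
        using cube(2) \<beta> fin by (intro enn2real_mono) (auto simp: a_def)
      then show ?thesis by simp
    qed
    finally show ?thesis by (simp add: C_def)
  qed (simp add: tilt_def C_def)
  have lim: "AE \<gamma> in gaussian_sequence.
      (\<lambda>k. tilt_trunc k c (brownian_loop \<gamma>)) \<longlonglongrightarrow> tilt_cube c (brownian_loop \<gamma>)"
    using fin
  proof eventually_elim
    case (elim \<gamma>)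
    show ?case
    proof (cases "brownian_loop \<gamma> \<in> l2_ball N")
      case True
      have "(\<lambda>k. l2_integral (trunc_cube (real k)) (brownian_loop \<gamma>)) \<longlonglongrightarrow> cube_integral (brownian_loop \<gamma>)"
        by (intro l2_integral_trunc_cube_tendsto integrable_abs_cube[OF True, of "\<beta> / 6"])
          (use \<beta> elim in \<open>auto simp: a_def\<close>)
      then show ?thesis unfolding tilt_def by (intro tendsto_intros)
    qed (simp add: tilt_def)
  qed
  have dom: "AE \<gamma> in gaussian_sequence. norm (tilt_trunc k c (brownian_loop \<gamma>)) \<le> w \<gamma>" for k
    using fin by eventually_elim (simp add: w_def bound tilt_nonneg)
  have meas: "(\<lambda>\<gamma>. tilt_cube c (brownian_loop \<gamma>)) \<in> borel_measurable gaussian_sequence"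
    "(\<lambda>\<gamma>. tilt_trunc k c (brownian_loop \<gamma>)) \<in> borel_measurable gaussian_sequence" for k
    by measurable
  show "integrable gaussian_sequence (\<lambda>\<gamma>. tilt_cube c (brownian_loop \<gamma>))"
    by (rule integrable_dominated_convergence[OF meas w lim dom])
  show "(\<lambda>k. LINT \<gamma>|gaussian_sequence. tilt_trunc k c (brownian_loop \<gamma>))
      \<longlonglongrightarrow> (LINT \<gamma>|gaussian_sequence. tilt_cube c (brownian_loop \<gamma>))"
    by (rule integral_dominated_convergence[OF meas w lim dom])
qed

text \<open>The normalising constant of the Gibbs measure is \<open>tilt_mass 0\<close>, and its Laplace transform of \<open>F\<close>
  is \<open>tilt_mass c / tilt_mass 0\<close>.\<close>

definition tilt_mass :: "real \<Rightarrow> real" where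
  "tilt_mass c = (LINT \<gamma>|gaussian_sequence. tilt_cube c (brownian_loop \<gamma>))"

lemma tilt_mass_nonneg: "0 \<le> tilt_mass c"
  unfolding tilt_mass_def by (intro integral_nonneg_AE) (simp add: tilt_nonneg)

lemma prekopa_leindler_brownian_loop:
  assumes small: "\<beta> * sqrt N \<le> 1 / 162"
  shows "tilt_mass t powr (1 / 4) * tilt_mass (- t / 3) powr (3 / 4) \<le> exp (t\<^sup>2 / 4) * tilt_mass 0"
proof -
  have nonneg: "0 \<le> (LINT \<gamma>|gaussian_sequence. tilt V c (X \<gamma>))" for V c and X :: "(int \<Rightarrow> real) \<Rightarrow> l2"
    by (intro integral_nonneg_AE) (simp add: tilt_nonneg)
  have "(LINT \<gamma>|gaussian_sequence. tilt_trunc k t (brownian_loop \<gamma>)) powr (1 / 4)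
      * (LINT \<gamma>|gaussian_sequence. tilt_trunc k (- t / 3) (brownian_loop \<gamma>)) powr (3 / 4)
      \<le> exp (t\<^sup>2 / 4) * (LINT \<gamma>|gaussian_sequence. tilt_trunc k 0 (brownian_loop \<gamma>))" for k
  proof (rule LIMSEQ_le)
    show "(\<lambda>n. (LINT \<gamma>|gaussian_sequence. tilt_trunc k t (partial_loop n \<gamma>)) powr (1 / 4)
        * (LINT \<gamma>|gaussian_sequence. tilt_trunc k (- t / 3) (partial_loop n \<gamma>)) powr (3 / 4))
      \<longlonglongrightarrow> (LINT \<gamma>|gaussian_sequence. tilt_trunc k t (brownian_loop \<gamma>)) powr (1 / 4)
        * (LINT \<gamma>|gaussian_sequence. tilt_trunc k (- t / 3) (brownian_loop \<gamma>)) powr (3 / 4)"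
      by (intro tendsto_mult tendsto_powr2 tendsto_const integral_tilt_trunc_partial_loop_tendsto) (auto simp: nonneg)
    show "(\<lambda>n. exp (t\<^sup>2 / 4) * (LINT \<gamma>|gaussian_sequence. tilt_trunc k 0 (partial_loop n \<gamma>)))
      \<longlonglongrightarrow> exp (t\<^sup>2 / 4) * (LINT \<gamma>|gaussian_sequence. tilt_trunc k 0 (brownian_loop \<gamma>))"
      by (intro tendsto_mult tendsto_const integral_tilt_trunc_partial_loop_tendsto)
  qed (use prekopa_leindler_partial_loop[OF small] in blast)
  note trunc = this
  show ?thesis
    unfolding tilt_mass_def
  proof (rule LIMSEQ_le)
    show "(\<lambda>k. (LINT \<gamma>|gaussian_sequence. tilt_trunc k t (brownian_loop \<gamma>)) powr (1 / 4)
        * (LINT \<gamma>|gaussian_sequence. tilt_trunc k (- t / 3) (brownian_loop \<gamma>)) powr (3 / 4))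
      \<longlonglongrightarrow> (LINT \<gamma>|gaussian_sequence. tilt_cube t (brownian_loop \<gamma>)) powr (1 / 4)
        * (LINT \<gamma>|gaussian_sequence. tilt_cube (- t / 3) (brownian_loop \<gamma>)) powr (3 / 4)"
      by (intro tendsto_mult tendsto_powr2 tendsto_const integral_tilt_trunc_tendsto) (auto simp: nonneg)
    show "(\<lambda>k. exp (t\<^sup>2 / 4) * (LINT \<gamma>|gaussian_sequence. tilt_trunc k 0 (brownian_loop \<gamma>)))
      \<longlonglongrightarrow> exp (t\<^sup>2 / 4) * (LINT \<gamma>|gaussian_sequence. tilt_cube 0 (brownian_loop \<gamma>))"
      by (intro tendsto_mult tendsto_const integral_tilt_trunc_tendsto)
  qed (use trunc in blast)
qed

section \<open>The Gibbs measure\<close>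

lemma integral_loop_law:
  fixes g :: "l2 \<Rightarrow> real"
  assumes [measurable]: "g \<in> borel_measurable borel"
  shows "(LINT \<phi>|loop_law. g \<phi>) = (LINT \<gamma>|gaussian_sequence. g (brownian_loop \<gamma>))"
  unfolding loop_law_def gaussian_sequence_def[symmetric] by (rule integral_distr) auto

lemma sets_loop_law [measurable_cong, simp]: "sets loop_law = sets borel"
  and space_loop_law [simp]: "space loop_law = UNIV"
  by (simp_all add: loop_law_def)

lemma gibbs_weight_eq: "gibbs_weight N \<beta> \<phi> = ennreal (tilt_cube 0 \<phi>)"
  by (simp add: gibbs_weight_def tilt_def)

lemma gibbs_norm_const_eq: "gibbs_norm_const N \<beta> = ennreal (tilt_mass 0)"
proof -
  have "gibbs_norm_const N \<beta> = (\<integral>\<^sup>+\<gamma>. ennreal (tilt_cube 0 (brownian_loop \<gamma>)) \<partial>gaussian_sequence)"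
    unfolding gibbs_norm_const_def gibbs_weight_eq loop_law_def gaussian_sequence_def[symmetric]
    by (rule nn_integral_distr) auto
  also have "\<dots> = ennreal (tilt_mass 0)"
    unfolding tilt_mass_def by (intro nn_integral_eq_integral integrable_tilt_cube) (simp add: tilt_nonneg)
  finally show ?thesis .
qed

text \<open>If the normalising constant vanished, the quotient \<open>0 / 0 = 0\<close> in the density would make the
  Gibbs measure the zero measure, and every integral against it would vanish.\<close>

lemma integral_gibbs_degenerate:
  fixes g :: "l2 \<Rightarrow> real"
  assumes "tilt_mass 0 = 0"
  shows "(LINT \<phi>|gibbs N \<beta>. g \<phi>) = 0"
proof (rule integral_eq_zero_AE)
  have "(\<integral>\<^sup>+\<phi>. ennreal (tilt_cube 0 \<phi>) \<partial>loop_law) = 0"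
    using gibbs_norm_const_eq assms by (simp add: gibbs_norm_const_def gibbs_weight_eq)
  then have "AE \<phi> in loop_law. ennreal (tilt_cube 0 \<phi>) = 0"
    by (subst (asm) nn_integral_0_iff_AE) auto
  then show "AE \<phi> in gibbs N \<beta>. g \<phi> = 0"
    unfolding gibbs_def gibbs_weight_eq gibbs_norm_const_eq
    by (subst AE_density) (auto elim!: eventually_mono)
qed

lemma gibbs_eq_density:
  assumes "0 < tilt_mass 0"
  shows "gibbs N \<beta> = density loop_law (\<lambda>\<phi>. ennreal (tilt_cube 0 \<phi> / tilt_mass 0))"
  unfolding gibbs_def gibbs_weight_eq gibbs_norm_const_eq
  using assms by (simp add: divide_ennreal tilt_nonneg)

lemma integral_gibbs:
  fixes g :: "l2 \<Rightarrow> real"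
  assumes pos: "0 < tilt_mass 0" and g [measurable]: "g \<in> borel_measurable borel"
  shows "(LINT \<phi>|gibbs N \<beta>. g \<phi>)
    = (LINT \<gamma>|gaussian_sequence. tilt_cube 0 (brownian_loop \<gamma>) * g (brownian_loop \<gamma>)) / tilt_mass 0"
proof -
  have "(LINT \<phi>|gibbs N \<beta>. g \<phi>) = (LINT \<phi>|loop_law. tilt_cube 0 \<phi> / tilt_mass 0 * g \<phi>)"
    unfolding gibbs_eq_density[OF pos] using pos
    by (subst integral_density) (auto simp: tilt_nonneg)
  also have "\<dots> = (LINT \<gamma>|gaussian_sequence. tilt_cube 0 (brownian_loop \<gamma>) / tilt_mass 0 * g (brownian_loop \<gamma>))"
    by (rule integral_loop_law) measurable
  also have "\<dots> = (LINT \<gamma>|gaussian_sequence. tilt_cube 0 (brownian_loop \<gamma>) * g (brownian_loop \<gamma>)) / tilt_mass 0"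
    by (simp flip: integral_divide_zero)
  finally show ?thesis .
qed

lemma prob_space_gibbs:
  assumes pos: "0 < tilt_mass 0"
  shows "prob_space (gibbs N \<beta>)"
proof
  have "emeasure (gibbs N \<beta>) (space (gibbs N \<beta>)) = (\<integral>\<^sup>+\<phi>. gibbs_weight N \<beta> \<phi> / gibbs_norm_const N \<beta> \<partial>loop_law)"
    unfolding gibbs_def gibbs_weight_eq by (simp add: emeasure_density)
  also have "\<dots> = gibbs_norm_const N \<beta> / gibbs_norm_const N \<beta>"
    unfolding gibbs_norm_const_def gibbs_weight_eq by (rule nn_integral_divide) simp
  also have "\<dots> = 1"
    using pos by (simp add: gibbs_norm_const_eq divide_ennreal)
  finally show "emeasure (gibbs N \<beta>) (space (gibbs N \<beta>)) = 1" .
qed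

lemma measurable_on_ball:
  fixes g :: "real \<Rightarrow> real"
  assumes "continuous_on UNIV g"
  shows "(\<lambda>\<phi>. indicator (l2_ball N) \<phi> * g (F \<phi>)) \<in> borel_measurable borel"
proof -
  have "continuous_on (l2_ball N) (\<lambda>\<phi>. g (F \<phi>))"
    by (rule continuous_on_compose2[OF assms continuous_on_F]) simp
  from borel_measurable_continuous_on_indicator[OF sets_ball this] show ?thesis by simp
qed

lemma laplace_gibbs:
  assumes pos: "0 < tilt_mass 0"
  shows "(LINT \<phi>:l2_ball N|gibbs N \<beta>. exp (c * F \<phi>)) = tilt_mass c / tilt_mass 0"
proof -
  have "(\<lambda>\<phi>. indicator (l2_ball N) \<phi> * exp (c * F \<phi>)) \<in> borel_measurable borel"
    using measurable_on_ball[of "\<lambda>y. exp (c * y)"] by (simp add: continuous_intros)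
  then have "(LINT \<phi>:l2_ball N|gibbs N \<beta>. exp (c * F \<phi>))
      = (LINT \<gamma>|gaussian_sequence. tilt_cube 0 (brownian_loop \<gamma>)
          * (indicator (l2_ball N) (brownian_loop \<gamma>) * exp (c * F (brownian_loop \<gamma>)))) / tilt_mass 0"
    unfolding set_lebesgue_integral_def by (simp add: integral_gibbs[OF pos])
  also have "(\<lambda>\<gamma>. tilt_cube 0 (brownian_loop \<gamma>)
          * (indicator (l2_ball N) (brownian_loop \<gamma>) * exp (c * F (brownian_loop \<gamma>))))
      = (\<lambda>\<gamma>. tilt_cube c (brownian_loop \<gamma>))"
    by (auto simp: tilt_def exp_add indicator_def)
  finally show ?thesis by (simp add: tilt_mass_def)
qed

text \<open>Jensen's inequality, in the form \<open>1 + y \<le> exp y\<close>: a centred variable has Laplace transform at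
  least \<open>1\<close>.\<close>

lemma tilt_mass_ge:
  assumes pos: "0 < tilt_mass 0" and mean: "(LINT \<phi>:l2_ball N|gibbs N \<beta>. F \<phi>) = 0"
  shows "tilt_mass 0 \<le> tilt_mass c"
proof -
  let ?f = "\<lambda>\<gamma>. tilt_cube 0 (brownian_loop \<gamma>) * (indicator (l2_ball N) (brownian_loop \<gamma>) * F (brownian_loop \<gamma>))"
  have meas [measurable]: "(\<lambda>\<phi>. indicator (l2_ball N) \<phi> * F \<phi>) \<in> borel_measurable borel"
    using measurable_on_ball[of "\<lambda>y. y"] by (simp add: continuous_intros)
  have zero: "(LINT \<gamma>|gaussian_sequence. ?f \<gamma>) = 0"
    using mean pos unfolding set_lebesgue_integral_def by (simp add: integral_gibbs[OF pos])
  have int: "integrable gaussian_sequence ?f"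
  proof (rule Bochner_Integration.integrable_bound)
    show "integrable gaussian_sequence (\<lambda>\<gamma>. (\<bar>F 0\<bar> + sqrt N) * tilt_cube 0 (brownian_loop \<gamma>))"
      using integrable_tilt_cube by simp
    show "?f \<in> borel_measurable gaussian_sequence" by measurable
    show "AE \<gamma> in gaussian_sequence. norm (?f \<gamma>) \<le> norm ((\<bar>F 0\<bar> + sqrt N) * tilt_cube 0 (brownian_loop \<gamma>))"
    proof (rule AE_I2)
      fix \<gamma>
      have "\<bar>indicator (l2_ball N) (brownian_loop \<gamma>) * F (brownian_loop \<gamma>)\<bar> \<le> \<bar>F 0\<bar> + sqrt N"
        using F_bound[of "brownian_loop \<gamma>"] N by (auto simp: indicator_def)
      then have "tilt_cube 0 (brownian_loop \<gamma>) * \<bar>indicator (l2_ball N) (brownian_loop \<gamma>) * F (brownian_loop \<gamma>)\<bar>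
          \<le> tilt_cube 0 (brownian_loop \<gamma>) * (\<bar>F 0\<bar> + sqrt N)"
        by (intro mult_left_mono) (auto simp: tilt_nonneg)
      then show "norm (?f \<gamma>) \<le> norm ((\<bar>F 0\<bar> + sqrt N) * tilt_cube 0 (brownian_loop \<gamma>))"
        using N by (simp add: abs_mult tilt_nonneg mult.commute[of "tilt_cube 0 _"])
    qed
  qed
  have "tilt_mass 0 = (LINT \<gamma>|gaussian_sequence. tilt_cube 0 (brownian_loop \<gamma>) + c * ?f \<gamma>)"
    using integrable_tilt_cube int zero by (simp add: tilt_mass_def)
  also have "\<dots> \<le> tilt_mass c"
    unfolding tilt_mass_def
  proof (rule integral_mono)
    fix \<gamma>
    show "tilt_cube 0 (brownian_loop \<gamma>) + c * ?f \<gamma> \<le> tilt_cube c (brownian_loop \<gamma>)"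
      using mult_left_mono[OF exp_ge_add_one_self[of "c * F (brownian_loop \<gamma>)"],
          of "exp (\<beta> / 6 * cube_integral (brownian_loop \<gamma>))"]
      by (auto simp: tilt_def indicator_def exp_add algebra_simps)
  qed (use integrable_tilt_cube int in auto)
  finally show ?thesis .
qed

text \<open>The second factor of the Prekopa-Leindler bound is at least a power of \<open>tilt_mass 0\<close>; cancelling
  it and taking fourth powers turns \<open>exp (t\<^sup>2 / 4)\<close> into \<open>exp (t\<^sup>2)\<close>.\<close>

lemma laplace_gibbs_log_concave:
  assumes small: "\<beta> * sqrt N \<le> 1 / 162" and mean: "(LINT \<phi>:l2_ball N|gibbs N \<beta>. F \<phi>) = 0"
    and pos: "0 < tilt_mass 0"
  shows "(LINT \<phi>:l2_ball N|gibbs N \<beta>. exp (t * F \<phi>)) \<le> exp (t\<^sup>2)"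
proof -
  let ?Z = "tilt_mass 0"
  have "tilt_mass t powr (1 / 4) * ?Z powr (3 / 4)
      \<le> tilt_mass t powr (1 / 4) * tilt_mass (- t / 3) powr (3 / 4)"
    using tilt_mass_ge[OF pos mean, of "- t / 3"] pos by (intro mult_left_mono powr_mono2) auto
  also have "\<dots> \<le> exp (t\<^sup>2 / 4) * ?Z"
    by (rule prekopa_leindler_brownian_loop[OF small])
  also have "\<dots> = exp (t\<^sup>2 / 4) * ?Z powr (1 / 4) * ?Z powr (3 / 4)"
    using pos by (simp add: mult.assoc flip: powr_add)
  finally have "tilt_mass t powr (1 / 4) \<le> exp (t\<^sup>2 / 4) * ?Z powr (1 / 4)"
    using pos by simp
  then have "(tilt_mass t powr (1 / 4)) powr 4 \<le> (exp (t\<^sup>2 / 4) * ?Z powr (1 / 4)) powr 4"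
    by (intro powr_mono2) auto
  then have "tilt_mass t \<le> exp (t\<^sup>2) * ?Z"
    using pos tilt_mass_nonneg[of t] by (simp add: powr_powr powr_mult exp_powr_real)
  then show ?thesis using pos by (simp add: laplace_gibbs[OF pos] divide_le_eq)
qed

text \<open>A Lipschitz function on the ball takes values in an interval of length \<open>2 * sqrt N\<close> around its
  value at the centre, and \<open>(2 * sqrt N)\<^sup>2 / 8 = N / 2\<close>.\<close>

lemma laplace_gibbs_hoeffding:
  assumes mean: "(LINT \<phi>:l2_ball N|gibbs N \<beta>. F \<phi>) = 0" and pos: "0 < tilt_mass 0"
  shows "(LINT \<phi>:l2_ball N|gibbs N \<beta>. exp (t * F \<phi>)) \<le> exp (N / 2 * t\<^sup>2)"
proof -
  interpret prob_space "gibbs N \<beta>" by (rule prob_space_gibbs[OF pos])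
  \<comment> \<open>The value \<open>F 0\<close> outside the ball, a null set, keeps the function within the same interval.\<close>
  define f where "f = (\<lambda>\<phi>. if \<phi> \<in> l2_ball N then F \<phi> else F 0)"
  have sets [measurable_cong]: "sets (gibbs N \<beta>) = sets borel"
    by (simp add: gibbs_def)
  have "f = (\<lambda>\<phi>. indicator (l2_ball N) \<phi> * F \<phi> + indicator (- l2_ball N) \<phi> * F 0)"
    by (auto simp: f_def indicator_def)
  moreover have [measurable]: "(\<lambda>\<phi>. indicator (l2_ball N) \<phi> * F \<phi>) \<in> borel_measurable borel"
    using measurable_on_ball[of "\<lambda>y. y"] by (simp add: continuous_intros)
  ultimately have f_meas [measurable]: "f \<in> borel_measurable borel" by simp
  have ball: "AE \<phi> in gibbs N \<beta>. \<phi> \<in> l2_ball N"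
    unfolding gibbs_eq_density[OF pos]
    by (subst AE_density, measurable) (auto simp: tilt_def indicator_def)
  have f_range: "f \<phi> \<in> {F 0 - sqrt N..F 0 + sqrt N}" for \<phi>
    using lipschitz[OF _ zero_in_ball, of \<phi>] norm_ball[of \<phi>] N by (auto simp: f_def abs_le_iff)
  interpret f: interval_bounded_random_variable "gibbs N \<beta>" f "F 0 - sqrt N" "F 0 + sqrt N"
    by unfold_locales (use f_range in auto)
  interpret f': interval_bounded_random_variable "gibbs N \<beta>" "\<lambda>\<phi>. - f \<phi>" "- F 0 - sqrt N" "- F 0 + sqrt N"
    by unfold_locales (use f_range in \<open>auto simp: algebra_simps\<close>)
  have "expectation f = (LINT \<phi>:l2_ball N|gibbs N \<beta>. F \<phi>)"
    unfolding set_lebesgue_integral_def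
  proof (rule integral_cong_AE)
    show "AE \<phi> in gibbs N \<beta>. f \<phi> = indicator (l2_ball N) \<phi> *\<^sub>R F \<phi>"
      using ball by eventually_elim (simp add: f_def)
  qed simp_all
  then have mean_f: "expectation f = 0" using mean by simp
  have eq: "(LINT \<phi>:l2_ball N|gibbs N \<beta>. exp (t * F \<phi>)) = expectation (\<lambda>\<phi>. exp (t * f \<phi>))"
    unfolding set_lebesgue_integral_def
  proof (rule integral_cong_AE)
    show "AE \<phi> in gibbs N \<beta>. indicator (l2_ball N) \<phi> *\<^sub>R exp (t * F \<phi>) = exp (t * f \<phi>)"
      using ball by eventually_elim (simp add: f_def)
    show "(\<lambda>\<phi>. indicator (l2_ball N) \<phi> *\<^sub>R exp (t * F \<phi>)) \<in> borel_measurable (gibbs N \<beta>)"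
      using measurable_on_ball[of "\<lambda>y. exp (t * y)"] by (simp add: continuous_intros)
  qed simp
  have int: "integrable (gibbs N \<beta>) (\<lambda>\<phi>. exp (t * f \<phi>))"
  proof (rule integrable_const_bound[where B = "exp (\<bar>t\<bar> * (\<bar>F 0\<bar> + sqrt N))"])
    have "t * f \<phi> \<le> \<bar>t\<bar> * (\<bar>F 0\<bar> + sqrt N)" for \<phi>
    proof -
      have "\<bar>f \<phi>\<bar> \<le> \<bar>F 0\<bar> + sqrt N" using f_range[of \<phi>] N by auto
      then have "\<bar>t\<bar> * \<bar>f \<phi>\<bar> \<le> \<bar>t\<bar> * (\<bar>F 0\<bar> + sqrt N)" by (rule mult_left_mono) simp
      then show ?thesis by (metis abs_ge_self abs_mult order_trans)
    qed
    then show "AE \<phi> in gibbs N \<beta>. norm (exp (t * f \<phi>)) \<le> exp (\<bar>t\<bar> * (\<bar>F 0\<bar> + sqrt N))" by simp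
  qed measurable
  have width: "t\<^sup>2 * (2 * sqrt N)\<^sup>2 / 8 = N / 2 * t\<^sup>2" using N by (simp add: power_mult_distrib)
  have "ennreal (expectation (\<lambda>\<phi>. exp (t * f \<phi>))) \<le> ennreal (exp (N / 2 * t\<^sup>2))"
  proof (cases t "0 :: real" rule: linorder_cases)
    case greater
    then show ?thesis
      using f.Hoeffdings_lemma_nn_integral_0[OF greater mean_f] int width
      by (simp add: nn_integral_eq_integral mult_ac)
  next
    case less
    have "expectation (\<lambda>\<phi>. - f \<phi>) = 0" using mean_f by simp
    then show ?thesis
      using f'.Hoeffdings_lemma_nn_integral_0[of "- t"] less int width
      by (simp add: nn_integral_eq_integral mult_ac)
  qed (simp add: prob_space)
  then show ?thesis unfolding eq by simp
qed

end

text \<open>Since \<open>\<beta>\<^bsup>5/2\<^esup> N\<^bsup>9/4\<^esup> = (\<beta> sqrt N)\<^bsup>5/2\<^esup> N\<close>, the exponent is at least \<open>N\<close>.\<close>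

lemma half_le_exp_of_large_coupling:
  fixes \<beta> N :: real
  assumes \<beta>: "0 < \<beta>" and N: "0 < N" and large: "1 / 162 < \<beta> * sqrt N"
  shows "N / 2 \<le> exp (162 powr (5 / 2) * \<beta> powr (5 / 2) * N powr (9 / 4))"
proof -
  have "1 \<le> (162 * (\<beta> * sqrt N)) powr (5 / 2)"
    using large by (intro ge_one_powr_ge_zero) auto
  also have "\<dots> = 162 powr (5 / 2) * \<beta> powr (5 / 2) * N powr (5 / 4)"
    using \<beta> N by (simp add: powr_mult powr_powr flip: powr_half_sqrt)
  finally have "1 * N \<le> 162 powr (5 / 2) * \<beta> powr (5 / 2) * N powr (5 / 4) * N"
    using N by (intro mult_right_mono) auto
  also have "N powr (5 / 4) * N = N powr (9 / 4)"
    using N powr_add[of N "5 / 4" 1] by simp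
  then have "162 powr (5 / 2) * \<beta> powr (5 / 2) * N powr (5 / 4) * N
      = 162 powr (5 / 2) * \<beta> powr (5 / 2) * N powr (9 / 4)"
    by (simp only: mult.assoc)
  finally have "N \<le> 162 powr (5 / 2) * \<beta> powr (5 / 2) * N powr (9 / 4)" by simp
  then have "exp N \<le> exp (162 powr (5 / 2) * \<beta> powr (5 / 2) * N powr (9 / 4))" by simp
  moreover have "N / 2 \<le> exp N" using exp_ge_add_one_self[of N] N by linarith
  ultimately show ?thesis by linarith
qed

theorem corollary2:
  shows "\<exists>C::real. C > 0 \<and>
    (\<forall>(\<beta>::real) (N::real) (F :: l2 \<Rightarrow> real). \<beta> > 0 \<longrightarrow> N > 0 \<longrightarrow>
      (\<forall>\<phi>\<in>l2_ball N. \<forall>\<psi>\<in>l2_ball N. \<bar>F \<phi> - F \<psi>\<bar> \<le> norm (\<phi> - \<psi>)) \<longrightarrow>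
      (LINT \<phi>:l2_ball N|gibbs N \<beta>. F \<phi>) = 0 \<longrightarrow>
      (\<forall>t::real. (LINT \<phi>:l2_ball N|gibbs N \<beta>. exp (t * F \<phi>))
        \<le> exp (exp (C * \<beta> powr (5 / 2) * N powr (9 / 4)) * t\<^sup>2)))"
proof (intro exI[of _ "162 powr (5 / 2) :: real"] conjI allI impI)
  show "0 < (162 :: real) powr (5 / 2)" by simp
next
  fix \<beta> N :: real and F :: "l2 \<Rightarrow> real" and t :: real
  assume \<beta>: "\<beta> > 0" and N: "N > 0"
    and lip: "\<forall>\<phi>\<in>l2_ball N. \<forall>\<psi>\<in>l2_ball N. \<bar>F \<phi> - F \<psi>\<bar> \<le> norm (\<phi> - \<psi>)"
    and mean: "(LINT \<phi>:l2_ball N|gibbs N \<beta>. F \<phi>) = 0"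
  interpret lipschitz_on_ball \<beta> N F
    by unfold_locales (use \<beta> N lip in auto)
  define K where "K = exp (162 powr (5 / 2) * \<beta> powr (5 / 2) * N powr (9 / 4))"
  have K: "1 \<le> K" by (simp add: K_def)
  have "(LINT \<phi>:l2_ball N|gibbs N \<beta>. exp (t * F \<phi>)) \<le> exp (K * t\<^sup>2)"
  proof (cases "tilt_mass 0 = 0")
    case True
    then show ?thesis
      unfolding set_lebesgue_integral_def by (simp add: integral_gibbs_degenerate)
  next
    case False
    then have pos: "0 < tilt_mass 0" using tilt_mass_nonneg[of 0] by simp
    show ?thesis
    proof (cases "\<beta> * sqrt N \<le> 1 / 162")
      case True
      have "(LINT \<phi>:l2_ball N|gibbs N \<beta>. exp (t * F \<phi>)) \<le> exp (t\<^sup>2)"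
        by (rule laplace_gibbs_log_concave[OF True mean pos])
      also have "\<dots> \<le> exp (K * t\<^sup>2)" using mult_right_mono[OF K, of "t\<^sup>2"] by simp
      finally show ?thesis .
    next
      case False
      then have "N / 2 \<le> K"
        unfolding K_def by (intro half_le_exp_of_large_coupling \<beta> N) simp
      then have "exp (N / 2 * t\<^sup>2) \<le> exp (K * t\<^sup>2)" using mult_right_mono[of "N / 2" K "t\<^sup>2"] by simp
      then show ?thesis using laplace_gibbs_hoeffding[OF mean pos, of t] by linarith
    qed
  qed
  then show "(LINT \<phi>:l2_ball N|gibbs N \<beta>. exp (t * F \<phi>))
      \<le> exp (exp (162 powr (5 / 2) * \<beta> powr (5 / 2) * N powr (9 / 4)) * t\<^sup>2)"
    by (simp only: K_def)
qed

end
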